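(* Let $B$ be a real-valued radial function on $\mathbb{R}^2$, $B(x)=B(|x|)$, with $B\in L^1(\mathbb{R}_+,(1+r)\,dr)$, and assume that its total flux satisfies $\Phi\notin\mathbb{Z}$. Let $V\ge 0$ satisfy $V\in L^1_{loc}(\mathbb{R}^2,|\log|x||\,dx)$ and $V\in L^1(\mathbb{R}_+,L^\infty(\mathbb{S}^1))$. Then the quadratic form $$\int_{\mathbb{R}^2}\big(|(i\nabla+A)u|^2-V|u|^2\big)\,dx,\qquad u\in C_0^\infty(\mathbb{R}^2),$$ is closable, and there exists a constant $C_1=C_1(B)$, independent of $V$, such that $$N(H_B-V,0)\le C_1\big(\|V\log|x|\|_{L^1(\mathfrak{B}_1)}+\|V\|_{L^1(\mathbb{R}_+,L^\infty(\mathbb{S}^1))}\big).$$ In particular, if $V(x)=V(|x|)$, then $$N(H_B-V,0)\le C_1\big(\|V\log|x|\|_{L^1(\mathfrak{B}_1)}+\|V\|_{L^1(\mathbb{R}^2)}\big).$$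
   Context: $\mathfrak{B}_s=\{x\in\mathbb{R}^2:|x|<s\}$. In polar coordinates $(r,\theta)$, $\|V\|_{L^1(\mathbb{R}_+,L^\infty(\mathbb{S}^1))}=\int_0^\infty\tilde V(r)\,r\,dr$ with $\tilde V(r)=\operatorname{ess\,sup}_{0\le\theta\le2\pi}|V(r,\theta)|$, and $V\in L^1(\mathbb{R}_+,L^\infty(\mathbb{S}^1))$ means this is finite. The flux is $\Phi(r)=\frac1{2\pi}\int_{\{|x|\le r\}}B\,dx=\int_0^rB(t)\,t\,dt$ and the total flux is $\Phi=\frac1{2\pi}\int_{\mathbb{R}^2}B\,dx$. The vector potential $A$, with $\operatorname{curl}A=B$, is $A(r,\theta)=\frac{\Phi(r)}{r}(-\sin\theta,\cos\theta)$. $H_B-V$ is the Friedrichs extension in $L^2(\mathbb{R}^2)$ of the operator generated by the form $\int(|(i\nabla+A)u|^2-V|u|^2)\,dx$, $u\in C_0^\infty(\mathbb{R}^2)$ (complex-valued), defined when the form is bounded from below. "Closable" is understood in the sense of semibounded forms, i.e. the form is bounded from below and closable. For a self-adjoint operator $T$ in $L^2(\mathbb{R}^2)$, $N(T,s)$ denotes the number of discrete eigenvalues of $T$ below $s$, counted with multiplicities. *)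

theory Defs
  imports "HOL-Analysis.Analysis" "HOL-Probability.Essential_Supremum"
begin

section \<open>Semibounded quadratic forms and operators in complex \<open>L\<^sup>2\<close>\<close>

text \<open>
  \<open>L2 M\<close> consists of functions, not of classes modulo equality almost everywhere. Every notion
  below is therefore phrased so that it does not depend on the choice of representatives; an
  operator is given by its graph, a set of pairs of functions that is saturated under equality
  almost everywhere.
\<close>

definition L2 :: "'a measure \<Rightarrow> ('a \<Rightarrow> complex) set" where
  "L2 M = {u \<in> borel_measurable M. integrable M (\<lambda>x. (cmod (u x))\<^sup>2)}"

definition l2_inner :: "'a measure \<Rightarrow> ('a \<Rightarrow> complex) \<Rightarrow> ('a \<Rightarrow> complex) \<Rightarrow> complex" where
  "l2_inner M u v = (LINT x|M. u x * cnj (v x))"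

definition l2_norm :: "'a measure \<Rightarrow> ('a \<Rightarrow> complex) \<Rightarrow> real" where
  "l2_norm M u = sqrt (LINT x|M. (cmod (u x))\<^sup>2)"

text \<open>A quadratic form is given by its domain \<open>D\<close> and by its values \<open>q u\<close> for \<open>u \<in> D\<close>.\<close>

definition form_bounded_below ::
    "'a measure \<Rightarrow> ('a \<Rightarrow> complex) set \<Rightarrow> (('a \<Rightarrow> complex) \<Rightarrow> real) \<Rightarrow> bool" where
  "form_bounded_below M D q \<longleftrightarrow> (\<exists>c::real. \<forall>u\<in>D. c * (l2_norm M u)\<^sup>2 \<le> q u)"

definition form_converges ::
    "'a measure \<Rightarrow> ('a \<Rightarrow> complex) set \<Rightarrow> (('a \<Rightarrow> complex) \<Rightarrow> real)
      \<Rightarrow> (nat \<Rightarrow> 'a \<Rightarrow> complex) \<Rightarrow> ('a \<Rightarrow> complex) \<Rightarrow> bool" where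
  "form_converges M D q w u \<longleftrightarrow>
     (\<forall>n. w n \<in> D) \<and>
     (\<lambda>n. l2_norm M (\<lambda>x. w n x - u x)) \<longlonglongrightarrow> 0 \<and>
     (\<forall>e>0. \<exists>K. \<forall>m\<ge>K. \<forall>n\<ge>K. \<bar>q (\<lambda>x. w m x - w n x)\<bar> < e)"

definition form_closable ::
    "'a measure \<Rightarrow> ('a \<Rightarrow> complex) set \<Rightarrow> (('a \<Rightarrow> complex) \<Rightarrow> real) \<Rightarrow> bool" where
  "form_closable M D q \<longleftrightarrow>
     form_bounded_below M D q \<and>
     (\<forall>w. form_converges M D q w (\<lambda>_. 0) \<longrightarrow> (\<lambda>n. q (w n)) \<longlonglongrightarrow> 0)"

definition form_closure_domain ::
    "'a measure \<Rightarrow> ('a \<Rightarrow> complex) set \<Rightarrow> (('a \<Rightarrow> complex) \<Rightarrow> real) \<Rightarrow> ('a \<Rightarrow> complex) set" where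
  "form_closure_domain M D q = {u \<in> L2 M. \<exists>w. form_converges M D q w u}"

definition form_closure ::
    "'a measure \<Rightarrow> ('a \<Rightarrow> complex) set \<Rightarrow> (('a \<Rightarrow> complex) \<Rightarrow> real) \<Rightarrow> ('a \<Rightarrow> complex) \<Rightarrow> real" where
  "form_closure M D q u =
     (THE a. \<forall>w. form_converges M D q w u \<longrightarrow> (\<lambda>n. q (w n)) \<longlonglongrightarrow> a)"

text \<open>The sesquilinear form of a quadratic form, linear in the first argument.\<close>

definition polar_form ::
    "(('a \<Rightarrow> complex) \<Rightarrow> real) \<Rightarrow> ('a \<Rightarrow> complex) \<Rightarrow> ('a \<Rightarrow> complex) \<Rightarrow> complex" where
  "polar_form q u v =
     (of_real (q (\<lambda>x. u x + v x)) - of_real (q (\<lambda>x. u x - v x))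
      + \<i> * of_real (q (\<lambda>x. u x + \<i> * v x)) - \<i> * of_real (q (\<lambda>x. u x - \<i> * v x))) / 4"

type_synonym 'a l2_operator = "(('a \<Rightarrow> complex) \<times> ('a \<Rightarrow> complex)) set"

text \<open>
  The Friedrichs extension attached to a closable form: the self-adjoint operator associated with
  the closure of the form. The pair \<open>(u, f)\<close> belongs to it iff \<open>u\<close> is in the operator
  domain and is mapped to \<open>f\<close>.
\<close>

definition friedrichs_operator ::
    "'a measure \<Rightarrow> ('a \<Rightarrow> complex) set \<Rightarrow> (('a \<Rightarrow> complex) \<Rightarrow> real) \<Rightarrow> 'a l2_operator" where
  "friedrichs_operator M D q =
     {(u, f). u \<in> form_closure_domain M D q \<and> f \<in> L2 M \<and>
        (\<forall>v \<in> form_closure_domain M D q.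
           polar_form (form_closure M D q) u v = l2_inner M f v)}"


section \<open>Spectrum and counting of discrete eigenvalues\<close>

definition l2_resolvent_set :: "'a measure \<Rightarrow> 'a l2_operator \<Rightarrow> complex set" where
  "l2_resolvent_set M T =
     {z. (\<forall>g \<in> L2 M. \<exists>(u, f) \<in> T. AE x in M. f x - z * u x = g x) \<and>
         (\<exists>c::real. \<forall>(u, f) \<in> T. l2_norm M u \<le> c * l2_norm M (\<lambda>x. f x - z * u x))}"

definition l2_spectrum :: "'a measure \<Rightarrow> 'a l2_operator \<Rightarrow> complex set" where
  "l2_spectrum M T = - l2_resolvent_set M T"

definition l2_eigenspace :: "'a measure \<Rightarrow> 'a l2_operator \<Rightarrow> complex \<Rightarrow> ('a \<Rightarrow> complex) set" where
  "l2_eigenspace M T z = {u. \<exists>f. (u, f) \<in> T \<and> (AE x in M. f x = z * u x)}"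

definition ae_independent :: "'a measure \<Rightarrow> nat \<Rightarrow> (nat \<Rightarrow> 'a \<Rightarrow> complex) \<Rightarrow> bool" where
  "ae_independent M n u \<longleftrightarrow>
     (\<forall>c :: nat \<Rightarrow> complex. (AE x in M. (\<Sum>i<n. c i * u i x) = 0) \<longrightarrow> (\<forall>i<n. c i = 0))"

text \<open>The complex dimension of the image in \<open>L\<^sup>2\<close> of a linear space \<open>E\<close> of functions.\<close>

definition l2_dim :: "'a measure \<Rightarrow> ('a \<Rightarrow> complex) set \<Rightarrow> enat" where
  "l2_dim M E = (SUP n \<in> {n. \<exists>u. (\<forall>i<n. u i \<in> E) \<and> ae_independent M n u}. enat n)"

definition l2_multiplicity :: "'a measure \<Rightarrow> 'a l2_operator \<Rightarrow> complex \<Rightarrow> enat" where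
  "l2_multiplicity M T z = l2_dim M (l2_eigenspace M T z)"

definition discrete_eigenvalues :: "'a measure \<Rightarrow> 'a l2_operator \<Rightarrow> complex set" where
  "discrete_eigenvalues M T =
     {z \<in> l2_spectrum M T. \<not> z islimpt l2_spectrum M T \<and>
        0 < l2_multiplicity M T z \<and> l2_multiplicity M T z < \<infinity>}"

definition eigenvalue_count :: "'a measure \<Rightarrow> 'a l2_operator \<Rightarrow> real \<Rightarrow> ennreal" where
  "eigenvalue_count M T s =
     (\<Sum>\<^sub>\<infinity>t \<in> {t::real. t < s \<and> complex_of_real t \<in> discrete_eigenvalues M T}.
        ennreal_of_enat (l2_multiplicity M T (complex_of_real t)))"


section \<open>Test functions on the plane\<close>

definition partial_deriv :: "2 \<Rightarrow> (real^2 \<Rightarrow> complex) \<Rightarrow> real^2 \<Rightarrow> complex" where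
  "partial_deriv j u x = frechet_derivative u (at x) (axis j 1)"

primrec Ck :: "nat \<Rightarrow> (real^2 \<Rightarrow> complex) \<Rightarrow> bool" where
  "Ck 0 u \<longleftrightarrow> continuous_on UNIV u"
| "Ck (Suc k) u \<longleftrightarrow> (\<forall>x. u differentiable (at x)) \<and> (\<forall>j. Ck k (partial_deriv j u))"

definition test_functions :: "(real^2 \<Rightarrow> complex) set" where
  "test_functions = {u. (\<forall>k. Ck k u) \<and> compact (closure {x. u x \<noteq> 0})}"


section \<open>The magnetic Schroedinger operator\<close>

definition flux :: "(real^2 \<Rightarrow> real) \<Rightarrow> real \<Rightarrow> real" where
  "flux B r = (LINT x:{x. norm x \<le> r}|lebesgue. B x) / (2 * pi)"

definition total_flux :: "(real^2 \<Rightarrow> real) \<Rightarrow> real" where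
  "total_flux B = (LINT x|lebesgue. B x) / (2 * pi)"

text \<open>
  In polar coordinates \<open>\<Phi>(r) / r \<cdot> (- sin \<theta>, cos \<theta>)\<close>; the unit vector here is
  \<open>(- x\<^sub>2, x\<^sub>1) / norm x\<close>. The value at the origin is \<open>0\<close> and irrelevant.
\<close>

definition vector_potential :: "(real^2 \<Rightarrow> real) \<Rightarrow> real^2 \<Rightarrow> real^2" where
  "vector_potential B x =
     (flux B (norm x) / norm x) *\<^sub>R vector [- (x $ 2) / norm x, (x $ 1) / norm x]"

definition magnetic_form ::
    "(real^2 \<Rightarrow> real) \<Rightarrow> (real^2 \<Rightarrow> real) \<Rightarrow> (real^2 \<Rightarrow> complex) \<Rightarrow> real" where
  "magnetic_form B V u =
     (LINT x|lebesgue.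
        (\<Sum>j\<in>UNIV. (cmod (\<i> * partial_deriv j u x
                          + complex_of_real (vector_potential B x $ j) * u x))\<^sup>2)
        - V x * (cmod (u x))\<^sup>2)"

definition magnetic_schroedinger ::
    "(real^2 \<Rightarrow> real) \<Rightarrow> (real^2 \<Rightarrow> real) \<Rightarrow> (real^2) l2_operator" where
  "magnetic_schroedinger B V = friedrichs_operator lebesgue test_functions (magnetic_form B V)"

text \<open>The norm of \<open>V\<close> in \<open>L\<^sup>1(\<real>\<^sub>+, L\<^sup>\<infinity>(\<bbbS>\<^sup>1))\<close>, with respect to \<open>r dr\<close>.\<close>

definition mixed_norm :: "(real^2 \<Rightarrow> real) \<Rightarrow> ennreal" where
  "mixed_norm V =
     (\<integral>\<^sup>+ r \<in> {0<..}.
        esssup (lebesgue_on {0..2*pi}) (\<lambda>t. ennreal \<bar>V (vector [r * cos t, r * sin t])\<bar>)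
          * ennreal r \<partial>lebesgue)"

definition log_norm_unit_disc :: "(real^2 \<Rightarrow> real) \<Rightarrow> ennreal" where
  "log_norm_unit_disc V = (\<integral>\<^sup>+ x \<in> ball 0 1. ennreal \<bar>V x * ln (norm x)\<bar> \<partial>lebesgue)"

definition L1_norm :: "(real^2 \<Rightarrow> real) \<Rightarrow> ennreal" where
  "L1_norm V = (\<integral>\<^sup>+ x. ennreal \<bar>V x\<bar> \<partial>lebesgue)"

definition L1_loc_log :: "(real^2 \<Rightarrow> real) \<Rightarrow> bool" where
  "L1_loc_log V \<longleftrightarrow>
     (\<forall>K. compact K \<longrightarrow> set_integrable lebesgue K (\<lambda>x. V x * \<bar>ln (norm x)\<bar>))"

end

theory Submission
  imports Defs
begin

text \<open>
  By the variational principle it is enough to find at most \<open>C\<^sub>1 (\<dots>)\<close> linear functionals on the test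
  functions such that the form is nonnegative on their common kernel. In the coordinates
  \<open>x = e\<^sup>t (cos \<theta>, sin \<theta>)\<close> the kinetic energy is the integral of \<open>|u\<^sub>t|\<^sup>2 + |u\<^sub>\<theta> - i \<Phi>(e\<^sup>t) u|\<^sup>2\<close> over a
  cylinder. Since \<open>\<Phi>(r)\<close> stays away from the integers for large \<open>r\<close> and is \<open>O(r)\<close>, it dominates
  \<open>|u\<^sub>t|\<^sup>2 + |u\<^sub>\<theta>|\<^sup>2 + 1(t \<ge> 0) |u|\<^sup>2\<close>, which no longer involves the field. Cut the cylinder into cells
  \<open>[n, n + 1) \<times> [0, 2\<pi>)\<close> and split \<open>u\<close> into its cell means and the rest. For the rest,
  \<open>r\<^sup>2 V\<close> is bounded by a function of \<open>t\<close> alone; cells of large mass are bisected until length times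
  mass is small, each piece of length \<open>l\<close> is divided into \<open>1 / l\<close> boxes, and the functionals compare box
  means with the cell mean. The number of boxes is bounded by the total mass, that is by the mixed norm.
  The cell means form a sequence on the integers; a discrete Bargmann argument requires it to vanish
  at a number of points bounded by the integral of \<open>V (1 + |log |x||)\<close> over the disc plus the integral of
  \<open>V\<close> outside. The case without functionals is a Hardy inequality; applied to \<open>(V - k)\<^sup>+\<close> it yields
  the form bound and hence closability.
\<close>

section \<open>Hermitian forms\<close>

text \<open>The bound is linear in the norms without an additive constant, although there are
  infinitely many cells. Every count must therefore be zero for small mass: a light cell is compared
  only with its own mean, which costs no functional, and the zeros imposed on the cell means number
  at most the mass divided by a threshold. The splitting also explains the two norms. On a box, an
  H^1 function has L^2 traces on the slices of constant \<open>t\<close> that are bounded uniformly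
  in \<open>t\<close>, so for the oscillating part the weight in \<open>t\<close> has to be only
  integrable. The cell means live on a half-line without zero-order term as \<open>t\<close> tends
  to minus infinity, because the flux vanishes at the origin; the price is the number of steps to
  \<open>t = 0\<close>, that is the logarithm. A second obstacle is that eigenfunctions lie in the
  closure domain, whereas the functionals act on test functions and come with no continuity. The
  vanishing conditions are therefore imposed on approximating test functions, and only the
  normalized coefficients pass to a limit.\<close>

lemma Re_mult_cnj_mult: "Re (c * (cnj c * z)) = (cmod c)\<^sup>2 * Re z"
  unfolding cmod_power2 by (simp add: power2_eq_square algebra_simps)

lemma borel_measurable_cnj [measurable]:
  "f \<in> borel_measurable M \<Longrightarrow> (\<lambda>x. cnj (f x)) \<in> borel_measurable M"
  by (rule measurable_compose[OF _ borel_measurable_continuous_onI]) (auto intro!: continuous_intros)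

lemma cmod_add_sq: "(cmod (u + v))\<^sup>2 \<le> 2 * (cmod u)\<^sup>2 + 2 * (cmod v)\<^sup>2"
proof -
  have "(cmod (u + v))\<^sup>2 \<le> (cmod u + cmod v)\<^sup>2"
    by (simp add: norm_triangle_ineq power_mono)
  then show ?thesis using sum_squares_bound[of "cmod u" "cmod v"] by (simp add: power2_sum)
qed

text \<open>The algebra common to three forms: the inner product of \<open>L2\<close>, the magnetic
  form on test functions, and the latter shifted by a multiple of the inner product. As domains
  consist of functions and not of classes, positivity can only mean semidefiniteness.\<close>

locale hermitian_form =
  fixes D :: "('a \<Rightarrow> complex) set" and s :: "('a \<Rightarrow> complex) \<Rightarrow> ('a \<Rightarrow> complex) \<Rightarrow> complex"
  assumes zero_mem: "(\<lambda>_. 0) \<in> D"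
    and add_mem: "u \<in> D \<Longrightarrow> v \<in> D \<Longrightarrow> (\<lambda>x. u x + v x) \<in> D"
    and scale_mem: "u \<in> D \<Longrightarrow> (\<lambda>x. c * u x) \<in> D"
    and form_add: "u \<in> D \<Longrightarrow> v \<in> D \<Longrightarrow> w \<in> D \<Longrightarrow> s (\<lambda>x. u x + v x) w = s u w + s v w"
    and form_scale: "u \<in> D \<Longrightarrow> w \<in> D \<Longrightarrow> s (\<lambda>x. c * u x) w = c * s u w"
    and form_cnj: "u \<in> D \<Longrightarrow> v \<in> D \<Longrightarrow> s v u = cnj (s u v)"
begin

lemma lincomb_mem: "u \<in> D \<Longrightarrow> v \<in> D \<Longrightarrow> (\<lambda>x. u x + c * v x) \<in> D"
  by (intro add_mem scale_mem)

lemma diff_mem: "u \<in> D \<Longrightarrow> v \<in> D \<Longrightarrow> (\<lambda>x. u x - v x) \<in> D"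
  using lincomb_mem[of u v "-1"] by simp

lemma form_add_right: "u \<in> D \<Longrightarrow> v \<in> D \<Longrightarrow> w \<in> D \<Longrightarrow> s w (\<lambda>x. u x + v x) = s w u + s w v"
  using form_cnj[of "\<lambda>x. u x + v x" w] form_cnj[of u w] form_cnj[of v w] form_add[of u v w] add_mem[of u v] by simp

lemma form_scale_right: "u \<in> D \<Longrightarrow> w \<in> D \<Longrightarrow> s w (\<lambda>x. c * u x) = cnj c * s w u"
  using form_cnj[of "\<lambda>x. c * u x" w] form_cnj[of u w] form_scale[of u w c] scale_mem[of u c] by simp

lemma form_lincomb:
  assumes "u \<in> D" "v \<in> D"
  shows "Re (s (\<lambda>x. u x + c * v x) (\<lambda>x. u x + c * v x))
     = Re (s u u) + 2 * Re (cnj c * s u v) + (cmod c)\<^sup>2 * Re (s v v)"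
proof -
  have "s (\<lambda>x. u x + c * v x) (\<lambda>x. u x + c * v x)
      = s u u + cnj c * s u v + (c * s v u + c * (cnj c * s v v))"
    using assms by (simp add: form_add form_add_right form_scale form_scale_right add_mem scale_mem algebra_simps)
  moreover have "Re (c * s v u) = Re (cnj c * s u v)"
    by (subst form_cnj[OF assms]) simp
  moreover have "Re (c * (cnj c * s v v)) = (cmod c)\<^sup>2 * Re (s v v)"
    by (rule Re_mult_cnj_mult)
  ultimately show ?thesis by simp
qed

lemma sum_mem:
  assumes "finite I" "\<And>i. i \<in> I \<Longrightarrow> w i \<in> D"
  shows "(\<lambda>x. \<Sum>i\<in>I. c i * w i x) \<in> D"
  using assms by (induction I) (auto intro!: zero_mem add_mem scale_mem)

lemma form_zero: "w \<in> D \<Longrightarrow> s (\<lambda>_. 0) w = 0"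
  using form_scale[of "\<lambda>_. 0" w 0] zero_mem by simp

lemma form_sum:
  assumes "finite I" "\<And>i. i \<in> I \<Longrightarrow> w i \<in> D" "v \<in> D"
  shows "s (\<lambda>x. \<Sum>i\<in>I. c i * w i x) v = (\<Sum>i\<in>I. c i * s (w i) v)"
  using assms by (induction I) (auto simp: form_zero form_add form_scale scale_mem sum_mem)

lemma form_sum_right:
  assumes "finite I" "\<And>i. i \<in> I \<Longrightarrow> w i \<in> D" "v \<in> D"
  shows "s v (\<lambda>x. \<Sum>i\<in>I. c i * w i x) = (\<Sum>i\<in>I. cnj (c i) * s v (w i))"
proof -
  have "s v (\<lambda>x. \<Sum>i\<in>I. c i * w i x) = cnj (\<Sum>i\<in>I. c i * s (w i) v)"
    by (subst form_cnj[OF sum_mem[OF assms(1,2)] assms(3)]) (simp_all add: form_sum[OF assms])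
  also have "\<dots> = (\<Sum>i\<in>I. cnj (c i) * s v (w i))"
    by (auto intro!: sum.cong simp: form_cnj[OF assms(2) assms(3)])
  finally show ?thesis .
qed

lemma polar_form_eq:
  assumes "u \<in> D" "v \<in> D"
  shows "polar_form (\<lambda>u. Re (s u u)) u v = s u v"
proof -
  have "Re (s (\<lambda>x. u x - v x) (\<lambda>x. u x - v x)) = Re (s u u) - 2 * Re (s u v) + Re (s v v)"
    using form_lincomb[OF assms, of "-1"] by simp
  moreover have "Re (s (\<lambda>x. u x - \<i> * v x) (\<lambda>x. u x - \<i> * v x)) = Re (s u u) - 2 * Im (s u v) + Re (s v v)"
    using form_lincomb[OF assms, of "-\<i>"] by simp
  ultimately show ?thesis
    using form_lincomb[OF assms, of 1] form_lincomb[OF assms, of \<i>]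
    by (simp add: polar_form_def complex_eq_iff)
qed

end

locale positive_form = hermitian_form +
  assumes form_nonneg: "u \<in> D \<Longrightarrow> 0 \<le> Re (s u u)"
begin

definition nrm :: "('a \<Rightarrow> complex) \<Rightarrow> real" where "nrm u = sqrt (Re (s u u))"

lemma nrm_nonneg [simp]: "u \<in> D \<Longrightarrow> 0 \<le> nrm u"
  by (simp add: nrm_def form_nonneg)

lemma nrm_sq: "u \<in> D \<Longrightarrow> (nrm u)\<^sup>2 = Re (s u u)"
  by (simp add: nrm_def form_nonneg)

text \<open>Nonnegativity is evaluated at u - t z v with z = s u v and real t. For s v v > 0 the
  optimal t is its reciprocal; for s v v = 0 the quadratic term disappears and a large t forces z =
  0.\<close>

lemma cauchy_schwarz:
  assumes "u \<in> D" "v \<in> D"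
  shows "cmod (s u v) \<le> nrm u * nrm v"
proof -
  define z where "z = s u v"
  define A where "A = Re (s u u)"
  define B where "B = Re (s v v)"
  have A0: "0 \<le> A" and B0: "0 \<le> B" by (auto simp: A_def B_def form_nonneg assms)
  have *: "0 \<le> A - 2 * t * (cmod z)\<^sup>2 + (t\<^sup>2 * (cmod z)\<^sup>2) * B" for t :: real
  proof -
    have "0 \<le> Re (s (\<lambda>x. u x + (- of_real t * z) * v x) (\<lambda>x. u x + (- of_real t * z) * v x))"
      by (intro form_nonneg lincomb_mem assms)
    also have "\<dots> = A + 2 * Re (cnj (- of_real t * z) * z) + (cmod (- of_real t * z))\<^sup>2 * B"
      unfolding A_def B_def z_def by (rule form_lincomb[OF assms])
    also have "Re (cnj (- of_real t * z) * z) = - t * (cmod z)\<^sup>2"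
      unfolding cmod_power2 by (simp add: power2_eq_square algebra_simps)
    finally show ?thesis by (simp add: norm_mult power_mult_distrib mult.assoc)
  qed
  have "(cmod z)\<^sup>2 \<le> A * B"
  proof (cases "B = 0")
    case True
    have "(cmod z)\<^sup>2 = 0"
    proof (rule ccontr)
      assume ne: "(cmod z)\<^sup>2 \<noteq> 0"
      show False using *[of "(A + 1) / (cmod z)\<^sup>2"] ne True A0 by simp
    qed
    then show ?thesis using A0 B0 by simp
  next
    case False
    then have "B > 0" using B0 by simp
    then show ?thesis using *[of "1 / B"] by (simp add: field_simps power2_eq_square)
  qed
  then have "(cmod z)\<^sup>2 \<le> (nrm u * nrm v)\<^sup>2"
    by (simp add: power_mult_distrib nrm_sq assms A_def B_def)
  then show ?thesis unfolding z_def
    by (rule power2_le_imp_le) (simp add: assms)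
qed

lemma nrm_triangle:
  assumes "u \<in> D" "v \<in> D"
  shows "nrm (\<lambda>x. u x + v x) \<le> nrm u + nrm v"
proof (rule power2_le_imp_le)
  have "(nrm (\<lambda>x. u x + v x))\<^sup>2 = (nrm u)\<^sup>2 + 2 * Re (s u v) + (nrm v)\<^sup>2"
    using form_lincomb[OF assms, of 1] assms by (simp add: nrm_sq add_mem)
  also have "Re (s u v) \<le> nrm u * nrm v"
    using cauchy_schwarz[OF assms] complex_Re_le_cmod[of "s u v"] by linarith
  finally show "(nrm (\<lambda>x. u x + v x))\<^sup>2 \<le> (nrm u + nrm v)\<^sup>2"
    by (simp add: power2_sum)
qed (simp add: assms)

lemma nrm_scale: "u \<in> D \<Longrightarrow> nrm (\<lambda>x. c * u x) = cmod c * nrm u"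
proof -
  assume u: "u \<in> D"
  have "s (\<lambda>x. c * u x) (\<lambda>x. c * u x) = c * (cnj c * s u u)"
    using u by (simp add: form_scale form_scale_right scale_mem)
  then have "Re (s (\<lambda>x. c * u x) (\<lambda>x. c * u x)) = (cmod c)\<^sup>2 * Re (s u u)"
    by (simp only: Re_mult_cnj_mult)
  then show ?thesis by (simp add: nrm_def real_sqrt_mult)
qed

lemma nrm_diff_commute: "u \<in> D \<Longrightarrow> v \<in> D \<Longrightarrow> nrm (\<lambda>x. u x - v x) = nrm (\<lambda>x. v x - u x)"
  using nrm_scale[of "\<lambda>x. u x - v x" "-1"] by (simp add: diff_mem)

lemma nrm_triangle_diff:
  assumes "u \<in> D" "v \<in> D" "w \<in> D"
  shows "nrm (\<lambda>x. u x - w x) \<le> nrm (\<lambda>x. u x - v x) + nrm (\<lambda>x. v x - w x)"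
  using nrm_triangle[of "\<lambda>x. u x - v x" "\<lambda>x. v x - w x"] assms by (simp add: diff_mem)

lemma nrm_reverse_triangle:
  assumes "u \<in> D" "v \<in> D"
  shows "\<bar>nrm u - nrm v\<bar> \<le> nrm (\<lambda>x. u x - v x)"
  using nrm_triangle[of "\<lambda>x. u x - v x" v] nrm_triangle[of "\<lambda>x. v x - u x" u] assms
    nrm_diff_commute[of u v] by (simp add: diff_mem)

end

section \<open>The inner product on square-integrable functions\<close>

lemma L2_measurable [measurable_dest]: "u \<in> L2 M \<Longrightarrow> u \<in> borel_measurable M"
  by (simp add: L2_def)

lemma L2_integrable_mult:
  assumes "u \<in> L2 M" "v \<in> L2 M"
  shows "integrable M (\<lambda>x. u x * cnj (v x))"
proof (rule Bochner_Integration.integrable_bound)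
  show "integrable M (\<lambda>x. (cmod (u x))\<^sup>2 + (cmod (v x))\<^sup>2)"
    using assms by (auto simp: L2_def)
  show "(\<lambda>x. u x * cnj (v x)) \<in> borel_measurable M"
    using assms by measurable
  have "norm (u x * cnj (v x)) \<le> (cmod (u x))\<^sup>2 + (cmod (v x))\<^sup>2" for x
    using sum_squares_bound[of "cmod (u x)" "cmod (v x)"] mult_nonneg_nonneg[OF norm_ge_zero[of "u x"] norm_ge_zero[of "v x"]]
    by (simp add: norm_mult del: mult_nonneg_nonneg)
  then show "AE x in M. norm (u x * cnj (v x)) \<le> norm ((cmod (u x))\<^sup>2 + (cmod (v x))\<^sup>2)"
    by (simp add: abs_of_nonneg)
qed

lemma L2_add:
  assumes "u \<in> L2 M" "v \<in> L2 M"
  shows "(\<lambda>x. u x + v x) \<in> L2 M"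
proof -
  have "integrable M (\<lambda>x. (cmod (u x + v x))\<^sup>2)"
  proof (rule Bochner_Integration.integrable_bound)
    show "integrable M (\<lambda>x. 2 * (cmod (u x))\<^sup>2 + 2 * (cmod (v x))\<^sup>2)"
      using assms by (auto simp: L2_def)
    show "(\<lambda>x. (cmod (u x + v x))\<^sup>2) \<in> borel_measurable M"
      using assms by measurable
    then show "AE x in M. norm ((cmod (u x + v x))\<^sup>2) \<le> norm (2 * (cmod (u x))\<^sup>2 + 2 * (cmod (v x))\<^sup>2)"
      using cmod_add_sq by (simp add: abs_of_nonneg)
  qed
  then show ?thesis using assms by (auto simp: L2_def)
qed

lemma L2_scale: "u \<in> L2 M \<Longrightarrow> (\<lambda>x. c * u x) \<in> L2 M"
  by (auto simp: L2_def norm_mult power_mult_distrib)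

interpretation l2: positive_form "L2 M" "l2_inner M" for M :: "'a measure"
proof
  show "(\<lambda>_. 0) \<in> L2 M" by (simp add: L2_def)
  fix u v w :: "'a \<Rightarrow> complex" and c
  assume u: "u \<in> L2 M"
  show "(\<lambda>x. c * u x) \<in> L2 M" using u by (rule L2_scale)
  have "Re (l2_inner M u u) = (LINT x|M. (cmod (u x))\<^sup>2)"
    by (simp add: l2_inner_def integral_Re[symmetric] L2_integrable_mult u complex_norm_square[symmetric] del: of_real_power)
  then show "0 \<le> Re (l2_inner M u u)" by simp
  assume v: "v \<in> L2 M"
  show "(\<lambda>x. u x + v x) \<in> L2 M" using u v by (rule L2_add)
  show "l2_inner M v u = cnj (l2_inner M u v)"
    using Bochner_Integration.integral_cnj[of M "\<lambda>x. u x * cnj (v x)"] by (simp add: l2_inner_def mult.commute)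
  show "l2_inner M (\<lambda>x. c * u x) v = c * l2_inner M u v"
    by (simp add: l2_inner_def mult.assoc)
  assume w: "w \<in> L2 M"
  show "l2_inner M (\<lambda>x. u x + v x) w = l2_inner M u w + l2_inner M v w"
    using u v w by (simp add: l2_inner_def algebra_simps L2_integrable_mult)
qed

lemma l2_nrm_eq: "u \<in> L2 M \<Longrightarrow> l2.nrm M u = l2_norm M u"
  by (simp add: l2.nrm_def l2_norm_def l2_inner_def integral_Re[symmetric] L2_integrable_mult
      complex_norm_square[symmetric] del: of_real_power)

lemma l2_norm_sq_integral: "(l2_norm M u)\<^sup>2 = (LINT x|M. (cmod (u x))\<^sup>2)"
  by (simp add: l2_norm_def)

lemma l2_norm_add_le: "u \<in> L2 M \<Longrightarrow> v \<in> L2 M \<Longrightarrow> l2_norm M (\<lambda>x. u x + v x) \<le> l2_norm M u + l2_norm M v"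
  using l2.nrm_triangle[of u M v] by (simp add: l2_nrm_eq l2.add_mem)

lemma l2_norm_cmult: "u \<in> L2 M \<Longrightarrow> l2_norm M (\<lambda>x. c * u x) = cmod c * l2_norm M u"
  using l2.nrm_scale[of u M c] by (simp add: l2_nrm_eq l2.scale_mem)

lemma l2_norm_ge_0 [simp]: "0 \<le> l2_norm M u"
  by (simp add: l2_norm_def)

lemma l2_cauchy_schwarz: "u \<in> L2 M \<Longrightarrow> v \<in> L2 M \<Longrightarrow> cmod (l2_inner M u v) \<le> l2_norm M u * l2_norm M v"
  using l2.cauchy_schwarz[of u M v] by (simp add: l2_nrm_eq)

lemma l2_inner_self: "u \<in> L2 M \<Longrightarrow> Re (l2_inner M u u) = (l2_norm M u)\<^sup>2"
  using l2.nrm_sq[of u M] by (simp add: l2_nrm_eq)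

lemma l2_norm_eq_0_AE: "u \<in> L2 M \<Longrightarrow> l2_norm M u = 0 \<Longrightarrow> AE x in M. u x = 0"
  by (auto simp: l2_norm_def L2_def integral_nonneg_eq_0_iff_AE)

text \<open>Turns the Cauchy clause of \<open>form_converges\<close> into a limit along a product
  filter, so that limit rules and squeezing apply to it.\<close>

lemma double_limit_iff:
  fixes f :: "nat \<Rightarrow> nat \<Rightarrow> real"
  shows "(\<forall>e>0. \<exists>K. \<forall>m\<ge>K. \<forall>n\<ge>K. \<bar>f m n\<bar> < e) \<longleftrightarrow>
    ((\<lambda>p. f (fst p) (snd p)) \<longlongrightarrow> 0) (sequentially \<times>\<^sub>F sequentially)"
  unfolding tendsto_iff eventually_prod_sequentially dist_real_def
  by (auto 4 4)

lemma squeeze_0: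
  fixes f :: "'b \<Rightarrow> real"
  assumes "(g \<longlongrightarrow> 0) F" "\<And>x. 0 \<le> f x" "\<And>x. f x \<le> g x"
  shows "(f \<longlongrightarrow> 0) F"
  by (rule tendsto_sandwich[OF _ _ tendsto_const assms(1)]) (auto simp: assms)

section \<open>The variational bound for discrete eigenvalues\<close>

text \<open>Gaussian elimination by induction on the number of equations: the last one is solved for
  an unknown \<open>p\<close> with nonzero coefficient, and \<open>p\<close> is substituted into the
  others.\<close>

lemma underdetermined_solution:
  fixes L :: "nat \<Rightarrow> 'i \<Rightarrow> complex"
  assumes "finite I" "k < card I"
  shows "\<exists>c. (\<exists>i\<in>I. c i \<noteq> 0) \<and> (\<forall>j<k. (\<Sum>i\<in>I. c i * L j i) = 0)"
  using assms
proof (induction k arbitrary: I L)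
  case 0
  then have "I \<noteq> {}" by auto
  then show ?case by (intro exI[of _ "\<lambda>_. 1"]) auto
next
  case (Suc k)
  show ?case
  proof (cases "\<forall>i\<in>I. L k i = 0")
    case True
    obtain c where "\<exists>i\<in>I. c i \<noteq> 0" "\<forall>j<k. (\<Sum>i\<in>I. c i * L j i) = 0"
      using Suc.IH[of I L] Suc.prems by auto
    with True show ?thesis by (intro exI[of _ c]) (auto simp: less_Suc_eq)
  next
    case False
    then obtain p where p: "p \<in> I" "L k p \<noteq> 0" by auto
    define J where "J = I - {p}"
    have J: "finite J" "k < card J" "I = insert p J" "p \<notin> J"
      using Suc.prems p by (auto simp: J_def)
    obtain c where c: "\<exists>i\<in>J. c i \<noteq> 0" "\<forall>j<k. (\<Sum>i\<in>J. c i * (L j i - L j p * L k i / L k p)) = 0"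
      using Suc.IH[OF J(1,2), of "\<lambda>j i. L j i - L j p * L k i / L k p"] by blast
    define s where "s = (\<Sum>i\<in>J. c i * L k i)"
    define d where "d = c(p := - s / L k p)"
    have dJ: "(\<Sum>i\<in>J. d i * f i) = (\<Sum>i\<in>J. c i * f i)" for f
      by (intro sum.cong) (use J in \<open>auto simp: d_def\<close>)
    have "(\<Sum>i\<in>I. d i * L j i) = 0" if "j < Suc k" for j
    proof (cases "j = k")
      case True
      then show ?thesis using J p by (simp add: dJ) (simp add: d_def s_def)
    next
      case False
      then have "0 = (\<Sum>i\<in>J. c i * (L j i - L j p * L k i / L k p))" using c that by simp
      also have "\<dots> = (\<Sum>i\<in>J. c i * L j i) - L j p / L k p * s"
        by (simp add: s_def sum_distrib_left sum_subtractf algebra_simps)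
      finally show ?thesis using J p by (simp add: dJ) (simp add: d_def algebra_simps)
    qed
    moreover have "\<exists>i\<in>I. d i \<noteq> 0" using c(1) J by (auto simp: d_def)
    ultimately show ?thesis by blast
  qed
qed

lemma convergent_subsequence_finite:
  fixes c :: "nat \<Rightarrow> 'i \<Rightarrow> complex"
  assumes "finite I" "\<And>i n. i \<in> I \<Longrightarrow> cmod (c n i) \<le> 1"
  shows "\<exists>r :: nat \<Rightarrow> nat. strict_mono r \<and> (\<forall>i\<in>I. convergent (\<lambda>n. c (r n) i))"
  using assms
proof (induction I)
  case empty
  show ?case by (intro exI[of _ id]) (auto simp: strict_mono_def)
next
  case (insert p I)
  then obtain r :: "nat \<Rightarrow> nat" where r: "strict_mono r" "\<forall>i\<in>I. convergent (\<lambda>n. c (r n) i)" by auto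
  have "bounded (range (\<lambda>n. c (r n) p))"
    unfolding bounded_iff using insert.prems by auto
  then obtain l r' where r': "strict_mono (r' :: nat \<Rightarrow> nat)" "((\<lambda>n. c (r n) p) \<circ> r') \<longlonglongrightarrow> l"
    using bounded_imp_convergent_subsequence[of "\<lambda>n. c (r n) p"] by blast
  have "convergent (\<lambda>n. c ((r \<circ> r') n) i)" if "i \<in> insert p I" for i
    using that r r' convergent_subseq_convergent[of "\<lambda>n. c (r n) i" r']
    by (auto simp: o_def convergent_def)
  then show ?case using r r' strict_mono_o by blast
qed

lemma l2_dim_attained:
  assumes "l2_dim M E = enat n"
  shows "\<exists>u. (\<forall>i<n. u i \<in> E) \<and> ae_independent M n u"
proof -
  let ?A = "{n. \<exists>u. (\<forall>i<n. u i \<in> E) \<and> ae_independent M n u}"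
  have 0: "0 \<in> ?A" by (auto simp: ae_independent_def)
  have le: "m \<le> n" if "m \<in> ?A" for m
  proof -
    have "enat m \<le> l2_dim M E" unfolding l2_dim_def using that by (rule SUP_upper)
    with assms show ?thesis by simp
  qed
  have "n \<in> ?A"
  proof (rule ccontr)
    assume n: "n \<notin> ?A"
    \<comment> \<open>For \<open>n = 0\<close> the truncated \<open>n - 1\<close> is
      \<open>0\<close> again, so the bound only yields \<open>n = 0\<close>; this is refuted by the
      empty family, which always qualifies.\<close>
    have "l2_dim M E \<le> enat (n - 1)"
      unfolding l2_dim_def
    proof (rule SUP_least)
      fix m assume m: "m \<in> ?A"
      then have "m \<le> n" "m \<noteq> n" using le n by auto
      then show "enat m \<le> enat (n - 1)" by simp
    qed
    then have "n = 0" using assms by simp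
    with 0 n show False by simp
  qed
  then show ?thesis by simp
qed

section \<open>Closable forms and their closures\<close>

locale closable_form = hermitian_form D a for D :: "('a \<Rightarrow> complex) set" and a +
  fixes M :: "'a measure" and q :: "('a \<Rightarrow> complex) \<Rightarrow> real"
  assumes dom_L2: "D \<subseteq> L2 M"
    and q_eq: "u \<in> D \<Longrightarrow> q u = Re (a u u)"
    and closable: "form_closable M D q"
begin

definition shift :: real where
  "shift = (SOME k. \<forall>u\<in>D. 0 \<le> q u + k * (l2_norm M u)\<^sup>2)"

text \<open>The shift only makes the form nonnegative and need not dominate the L^2 norm. Its
  \<open>nrm\<close> is thus a seminorm, and L^2 convergence is tracked separately.\<close>

definition shifted_form :: "('a \<Rightarrow> complex) \<Rightarrow> ('a \<Rightarrow> complex) \<Rightarrow> complex" where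
  "shifted_form u v = a u v + of_real shift * l2_inner M u v"

lemma in_L2: "u \<in> D \<Longrightarrow> u \<in> L2 M"
  using dom_L2 by blast

lemma shift_nonneg: "u \<in> D \<Longrightarrow> 0 \<le> q u + shift * (l2_norm M u)\<^sup>2"
proof -
  obtain c where c: "\<forall>u\<in>D. c * (l2_norm M u)\<^sup>2 \<le> q u"
    using closable by (auto simp: form_closable_def form_bounded_below_def)
  have "\<forall>u\<in>D. 0 \<le> q u + shift * (l2_norm M u)\<^sup>2"
    unfolding shift_def by (rule someI[of _ "-c"]) (use c in simp)
  then show "u \<in> D \<Longrightarrow> 0 \<le> q u + shift * (l2_norm M u)\<^sup>2" by blast
qed

lemma Re_shifted_form: "u \<in> D \<Longrightarrow> Re (shifted_form u u) = q u + shift * (l2_norm M u)\<^sup>2"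
  by (simp add: shifted_form_def q_eq l2_inner_self[symmetric] in_L2)

sublocale sh: positive_form D shifted_form
proof
  fix u v w c
  assume u: "u \<in> D"
  show "0 \<le> Re (shifted_form u u)" using u by (simp add: Re_shifted_form shift_nonneg)
  assume w: "w \<in> D"
  show "shifted_form (\<lambda>x. c * u x) w = c * shifted_form u w"
    using u w by (simp add: shifted_form_def form_scale l2.form_scale in_L2 algebra_simps)
  show "shifted_form w u = cnj (shifted_form u w)"
    using form_cnj[OF u w] l2.form_cnj[OF in_L2[OF u] in_L2[OF w]] by (simp add: shifted_form_def)
  assume v: "v \<in> D"
  show "shifted_form (\<lambda>x. u x + v x) w = shifted_form u w + shifted_form v w"
    using u v w by (simp add: shifted_form_def form_add l2.form_add in_L2 algebra_simps)
qed (auto intro: zero_mem add_mem scale_mem)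

lemma q_nrm: "u \<in> D \<Longrightarrow> q u = (sh.nrm u)\<^sup>2 - shift * (l2_norm M u)\<^sup>2"
  by (simp add: sh.nrm_sq Re_shifted_form)

lemma l2_double_limit:
  assumes "u \<in> L2 M" "\<And>n. w n \<in> D" "(\<lambda>n. l2_norm M (\<lambda>x. w n x - u x)) \<longlonglongrightarrow> 0"
  shows "((\<lambda>p. l2_norm M (\<lambda>x. w (fst p) x - w (snd p) x)) \<longlongrightarrow> 0) (sequentially \<times>\<^sub>F sequentially)"
proof (rule squeeze_0)
  let ?d = "\<lambda>n. l2_norm M (\<lambda>x. w n x - u x)"
  have "((\<lambda>p. ?d (fst p) + ?d (snd p)) \<longlongrightarrow> 0 + 0) (sequentially \<times>\<^sub>F sequentially)"
    by (intro tendsto_add filterlim_compose[OF assms(3)] filterlim_fst filterlim_snd)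
  then show "((\<lambda>p. ?d (fst p) + ?d (snd p)) \<longlongrightarrow> 0) (sequentially \<times>\<^sub>F sequentially)" by simp
  fix p :: "nat \<times> nat"
  show "l2_norm M (\<lambda>x. w (fst p) x - w (snd p) x) \<le> ?d (fst p) + ?d (snd p)"
    using l2.nrm_triangle_diff[of "w (fst p)" M u "w (snd p)"] l2.nrm_diff_commute[of "w (snd p)" M u] assms(1,2)
    by (simp add: l2_nrm_eq l2.diff_mem in_L2)
qed simp

text \<open>Smallness of the possibly indefinite \<open>q\<close> on differences does not combine
  well under sums. Adding \<open>shift\<close> times the squared L^2 norm, which tends to 0 along a
  convergent sequence, replaces it by a seminorm with a triangle inequality.\<close>

lemma converges_iff:
  assumes "u \<in> L2 M"
  shows "form_converges M D q w u \<longleftrightarrow> (\<forall>n. w n \<in> D) \<and> (\<lambda>n. l2_norm M (\<lambda>x. w n x - u x)) \<longlonglongrightarrow> 0 \<and>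
    ((\<lambda>p. sh.nrm (\<lambda>x. w (fst p) x - w (snd p) x)) \<longlongrightarrow> 0) (sequentially \<times>\<^sub>F sequentially)"
proof -
  have "((\<lambda>p. q (\<lambda>x. w (fst p) x - w (snd p) x)) \<longlongrightarrow> 0) (sequentially \<times>\<^sub>F sequentially) \<longleftrightarrow>
    ((\<lambda>p. sh.nrm (\<lambda>x. w (fst p) x - w (snd p) x)) \<longlongrightarrow> 0) (sequentially \<times>\<^sub>F sequentially)"
    if w: "\<And>n. w n \<in> D" and l: "(\<lambda>n. l2_norm M (\<lambda>x. w n x - u x)) \<longlonglongrightarrow> 0"
  proof -
    let ?w = "\<lambda>p x. w (fst p) x - w (snd p) x"
    let ?F = "sequentially \<times>\<^sub>F sequentially :: (nat \<times> nat) filter"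
    have D: "?w p \<in> D" for p by (intro diff_mem w)
    have l: "((\<lambda>p. l2_norm M (?w p)) \<longlongrightarrow> 0) ?F"
      by (rule l2_double_limit[OF assms w l])
    then have l2: "((\<lambda>p. shift * (l2_norm M (?w p))\<^sup>2) \<longlongrightarrow> shift * 0\<^sup>2) ?F"
      by (intro tendsto_intros)
    show ?thesis
    proof
      assume "((\<lambda>p. q (?w p)) \<longlongrightarrow> 0) ?F"
      then have "((\<lambda>p. sqrt (q (?w p) + shift * (l2_norm M (?w p))\<^sup>2)) \<longlongrightarrow> sqrt (0 + shift * 0\<^sup>2)) ?F"
        by (intro tendsto_intros l2)
      then show "((\<lambda>p. sh.nrm (?w p)) \<longlongrightarrow> 0) ?F"
        by (simp add: sh.nrm_def Re_shifted_form D)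
    next
      assume "((\<lambda>p. sh.nrm (?w p)) \<longlongrightarrow> 0) ?F"
      then have "((\<lambda>p. (sh.nrm (?w p))\<^sup>2 - shift * (l2_norm M (?w p))\<^sup>2) \<longlongrightarrow> 0\<^sup>2 - shift * 0\<^sup>2) ?F"
        by (intro tendsto_intros l2)
      then show "((\<lambda>p. q (?w p)) \<longlongrightarrow> 0) ?F"
        by (simp add: q_nrm D)
    qed
  qed
  then show ?thesis
    unfolding form_converges_def double_limit_iff[of "\<lambda>m n. q (\<lambda>x. w m x - w n x)"] by blast
qed

lemma converges_lincomb:
  assumes u: "u \<in> L2 M" and v: "v \<in> L2 M"
    and w: "form_converges M D q w u" and w': "form_converges M D q w' v"
  shows "form_converges M D q (\<lambda>n x. w n x + c * w' n x) (\<lambda>x. u x + c * v x)"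
proof -
  have uv: "(\<lambda>x. u x + c * v x) \<in> L2 M" using u v by (rule l2.lincomb_mem)
  note W = w[unfolded converges_iff[OF u]] w'[unfolded converges_iff[OF v]]
  have D: "w n \<in> D" "w' n \<in> D" for n using W by auto
  show ?thesis unfolding converges_iff[OF uv]
  proof (intro conjI allI)
    show "(\<lambda>x. w n x + c * w' n x) \<in> D" for n by (intro lincomb_mem D)
    have "(\<lambda>n. l2_norm M (\<lambda>x. w n x - u x) + cmod c * l2_norm M (\<lambda>x. w' n x - v x)) \<longlonglongrightarrow> 0 + cmod c * 0"
      using W by (intro tendsto_intros) auto
    then have L: "(\<lambda>n. l2_norm M (\<lambda>x. w n x - u x) + cmod c * l2_norm M (\<lambda>x. w' n x - v x)) \<longlonglongrightarrow> 0" by simp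
    show "(\<lambda>n. l2_norm M (\<lambda>x. w n x + c * w' n x - (u x + c * v x))) \<longlonglongrightarrow> 0"
    proof (rule squeeze_0[OF L])
      fix n
      have "l2_norm M (\<lambda>x. (w n x - u x) + c * (w' n x - v x))
          \<le> l2_norm M (\<lambda>x. w n x - u x) + l2_norm M (\<lambda>x. c * (w' n x - v x))"
        by (intro l2_norm_add_le l2.scale_mem l2.diff_mem in_L2 D u v)
      also have "l2_norm M (\<lambda>x. c * (w' n x - v x)) = cmod c * l2_norm M (\<lambda>x. w' n x - v x)"
        by (intro l2_norm_cmult l2.diff_mem in_L2 D u v)
      also have "(\<lambda>x. (w n x - u x) + c * (w' n x - v x)) = (\<lambda>x. w n x + c * w' n x - (u x + c * v x))"
        by (simp add: algebra_simps fun_eq_iff)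
      finally show "l2_norm M (\<lambda>x. w n x + c * w' n x - (u x + c * v x))
        \<le> l2_norm M (\<lambda>x. w n x - u x) + cmod c * l2_norm M (\<lambda>x. w' n x - v x)" .
    qed simp
    let ?F = "sequentially \<times>\<^sub>F sequentially :: (nat \<times> nat) filter"
    have "((\<lambda>p. sh.nrm (\<lambda>x. w (fst p) x - w (snd p) x)
        + cmod c * sh.nrm (\<lambda>x. w' (fst p) x - w' (snd p) x)) \<longlongrightarrow> 0 + cmod c * 0) ?F"
      using W by (intro tendsto_intros) auto
    then have L: "((\<lambda>p. sh.nrm (\<lambda>x. w (fst p) x - w (snd p) x)
        + cmod c * sh.nrm (\<lambda>x. w' (fst p) x - w' (snd p) x)) \<longlongrightarrow> 0) ?F" by simp
    show "((\<lambda>p. sh.nrm (\<lambda>x. w (fst p) x + c * w' (fst p) x - (w (snd p) x + c * w' (snd p) x))) \<longlongrightarrow> 0) ?F"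
    proof (rule squeeze_0[OF L])
      fix p :: "nat \<times> nat"
      obtain m n where p: "p = (m, n)" by fastforce
      have "sh.nrm (\<lambda>x. (w m x - w n x) + c * (w' m x - w' n x))
          \<le> sh.nrm (\<lambda>x. w m x - w n x) + sh.nrm (\<lambda>x. c * (w' m x - w' n x))"
        by (intro sh.nrm_triangle scale_mem diff_mem D)
      also have "sh.nrm (\<lambda>x. c * (w' m x - w' n x)) = cmod c * sh.nrm (\<lambda>x. w' m x - w' n x)"
        by (intro sh.nrm_scale diff_mem D)
      also have "(\<lambda>x. (w m x - w n x) + c * (w' m x - w' n x)) = (\<lambda>x. w m x + c * w' m x - (w n x + c * w' n x))"
        by (simp add: algebra_simps fun_eq_iff)
      finally show "sh.nrm (\<lambda>x. w (fst p) x + c * w' (fst p) x - (w (snd p) x + c * w' (snd p) x))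
        \<le> sh.nrm (\<lambda>x. w (fst p) x - w (snd p) x) + cmod c * sh.nrm (\<lambda>x. w' (fst p) x - w' (snd p) x)"
        by (simp add: p)
    qed (intro sh.nrm_nonneg diff_mem lincomb_mem D)
  qed
qed

lemma converges_l2_norm:
  assumes "u \<in> L2 M" "form_converges M D q w u"
  shows "(\<lambda>n. l2_norm M (w n)) \<longlonglongrightarrow> l2_norm M u"
proof -
  have "(\<lambda>n. l2_norm M (\<lambda>x. w n x - u x)) \<longlonglongrightarrow> 0" and D: "\<And>n. w n \<in> D"
    using assms by (auto simp: form_converges_def)
  then have "(\<lambda>n. \<bar>l2_norm M (w n) - l2_norm M u\<bar>) \<longlonglongrightarrow> 0"
    by (rule_tac squeeze_0) (use l2.nrm_reverse_triangle[OF in_L2[OF D] assms(1)] in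
        \<open>simp_all add: l2_nrm_eq in_L2 D assms(1) l2.diff_mem\<close>)
  then show ?thesis by (simp add: tendsto_rabs_zero_iff LIM_zero_iff)
qed

lemma converges_nrm_convergent:
  assumes "u \<in> L2 M" "form_converges M D q w u"
  shows "convergent (\<lambda>n. sh.nrm (w n))"
proof -
  note W = assms(2)[unfolded converges_iff[OF assms(1)]]
  have "((\<lambda>p. \<bar>sh.nrm (w (fst p)) - sh.nrm (w (snd p))\<bar>) \<longlongrightarrow> 0) (sequentially \<times>\<^sub>F sequentially)"
  proof (rule squeeze_0)
    show "((\<lambda>p. sh.nrm (\<lambda>x. w (fst p) x - w (snd p) x)) \<longlongrightarrow> 0) (sequentially \<times>\<^sub>F sequentially)"
      using W by blast
    fix p :: "nat \<times> nat"
    show "\<bar>sh.nrm (w (fst p)) - sh.nrm (w (snd p))\<bar> \<le> sh.nrm (\<lambda>x. w (fst p) x - w (snd p) x)"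
      using W by (intro sh.nrm_reverse_triangle) auto
  qed simp
  then have "\<forall>e>0. \<exists>K. \<forall>m\<ge>K. \<forall>n\<ge>K. \<bar>sh.nrm (w m) - sh.nrm (w n)\<bar> < e"
    unfolding tendsto_rabs_zero_iff
    using double_limit_iff[of "\<lambda>m n. sh.nrm (w m) - sh.nrm (w n)"] by blast
  then show ?thesis
    by (auto simp: Cauchy_convergent_iff[symmetric] Cauchy_def dist_real_def)
qed

text \<open>The difference of the two sequences converges to zero in the sense of forms, so
  closability sends its form values to 0, and the reverse triangle inequality transfers the
  limit.\<close>

lemma converges_unique:
  assumes u: "u \<in> L2 M" and w: "form_converges M D q w u" and w': "form_converges M D q w' u"
    and L: "(\<lambda>n. sh.nrm (w n)) \<longlonglongrightarrow> L"
  shows "(\<lambda>n. sh.nrm (w' n)) \<longlonglongrightarrow> L"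
proof -
  have D: "w n \<in> D" "w' n \<in> D" for n using w w' by (auto simp: form_converges_def)
  have "form_converges M D q (\<lambda>n x. w n x - w' n x) (\<lambda>_. 0)"
    using converges_lincomb[OF u u w w', of "-1"] by simp
  moreover from this have "(\<lambda>n. q (\<lambda>x. w n x - w' n x)) \<longlonglongrightarrow> 0"
    using closable by (simp add: form_closable_def)
  ultimately have "(\<lambda>n. sqrt (q (\<lambda>x. w n x - w' n x) + shift * (l2_norm M (\<lambda>x. w n x - w' n x))\<^sup>2))
    \<longlonglongrightarrow> sqrt (0 + shift * (l2_norm M (\<lambda>_. 0))\<^sup>2)"
    using l2.zero_mem by (intro tendsto_intros converges_l2_norm) auto
  then have "(\<lambda>n. sh.nrm (\<lambda>x. w n x - w' n x)) \<longlonglongrightarrow> 0"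
    by (simp add: sh.nrm_def Re_shifted_form D diff_mem l2_norm_def)
  then have "(\<lambda>n. \<bar>sh.nrm (w' n) - sh.nrm (w n)\<bar>) \<longlonglongrightarrow> 0"
  proof (rule squeeze_0)
    fix n show "\<bar>sh.nrm (w' n) - sh.nrm (w n)\<bar> \<le> sh.nrm (\<lambda>x. w n x - w' n x)"
      using sh.nrm_reverse_triangle[OF D(1)[of n] D(2)[of n]] by linarith
  qed simp
  then have "(\<lambda>n. sh.nrm (w n) + (sh.nrm (w' n) - sh.nrm (w n))) \<longlonglongrightarrow> L + 0"
    by (intro tendsto_add L) (simp add: tendsto_rabs_zero_iff)
  then show ?thesis by simp
qed

text \<open>Gives the description operator in \<open>form_closure\<close> its meaning: the limit
  exists along every approximating sequence and is the same for all, and the given sequence makes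
  the described number unique.\<close>

lemma closure_limit:
  assumes u: "u \<in> L2 M" and w: "form_converges M D q w u"
  shows "(\<lambda>n. q (w n)) \<longlonglongrightarrow> form_closure M D q u"
proof -
  obtain L where L: "(\<lambda>n. sh.nrm (w n)) \<longlonglongrightarrow> L"
    using converges_nrm_convergent[OF u w] by (auto simp: convergent_def)
  let ?a = "L\<^sup>2 - shift * (l2_norm M u)\<^sup>2"
  have *: "\<forall>w. form_converges M D q w u \<longrightarrow> (\<lambda>n. q (w n)) \<longlonglongrightarrow> ?a"
  proof (intro allI impI)
    fix w' assume w': "form_converges M D q w' u"
    have D: "w' n \<in> D" for n using w' by (auto simp: form_converges_def)
    have "(\<lambda>n. (sh.nrm (w' n))\<^sup>2 - shift * (l2_norm M (w' n))\<^sup>2) \<longlonglongrightarrow> ?a"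
      by (intro tendsto_intros converges_unique[OF u w w' L] converges_l2_norm[OF u w'])
    then show "(\<lambda>n. q (w' n)) \<longlonglongrightarrow> ?a" by (simp add: q_nrm D)
  qed
  have "form_closure M D q u = ?a"
    unfolding form_closure_def
    by (rule the_equality) (use * w in \<open>auto intro: LIMSEQ_unique\<close>)
  then show ?thesis using * w by simp
qed

text \<open>Each of the four terms of \<open>polar_form\<close> is a closure value at u + c v with c
  one of 1, -1, i, -i, and is reached by the same combination of the approximating
  sequences.\<close>

lemma polar_limit:
  assumes "u \<in> L2 M" "v \<in> L2 M" "form_converges M D q w u" "form_converges M D q w' v"
  shows "(\<lambda>n. a (w n) (w' n)) \<longlonglongrightarrow> polar_form (form_closure M D q) u v"
proof -
  have D: "w n \<in> D" "w' n \<in> D" for n using assms by (auto simp: form_converges_def)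
  have L: "(\<lambda>n. q (\<lambda>x. w n x + c * w' n x)) \<longlonglongrightarrow> form_closure M D q (\<lambda>x. u x + c * v x)" for c
    by (intro closure_limit converges_lincomb l2.lincomb_mem assms)
  have "polar_form q (w n) (w' n) = a (w n) (w' n)" for n
    using polar_form_eq[of "w n" "w' n"] lincomb_mem[of "w n" "w' n" "\<i>"] lincomb_mem[of "w n" "w' n" "-\<i>"]
    by (simp add: polar_form_def q_eq D diff_mem add_mem)
  moreover have "(\<lambda>n. polar_form q (w n) (w' n)) \<longlonglongrightarrow> polar_form (form_closure M D q) u v"
    unfolding polar_form_def
    using L[of 1] L[of "-1"] L[of \<i>] L[of "-\<i>"] by (intro tendsto_intros) simp_all
  ultimately show ?thesis by simp
qed

text \<open>With more than \<open>k\<close> eigenfunctions, every stage of approximation admits a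
  normalized combination annihilated by all functionals, hence with nonnegative form. Along a
  subsequence the coefficients converge to some \<open>d\<close>, and the limiting form value is the
  sum over eigenvalues t of t times the squared norm of the part of the \<open>d\<close>-combination
  in that eigenspace. As every t is negative, all parts vanish, and independence contradicts that
  \<open>d\<close> is normalized.\<close>

lemma card_eigenfunctions_le:
  fixes u :: "'i \<Rightarrow> 'a \<Rightarrow> complex" and \<tau> :: "'i \<Rightarrow> real" and \<Lambda> :: "nat \<Rightarrow> ('a \<Rightarrow> complex) \<Rightarrow> complex"
  assumes I: "finite I"
    and dom: "\<And>i. i \<in> I \<Longrightarrow> u i \<in> form_closure_domain M D q"
    and eig: "\<And>i v. i \<in> I \<Longrightarrow> v \<in> form_closure_domain M D q \<Longrightarrow>
        polar_form (form_closure M D q) (u i) v = of_real (\<tau> i) * l2_inner M (u i) v"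
    and neg: "\<And>i. i \<in> I \<Longrightarrow> \<tau> i < 0"
    and indep: "\<And>t d i. AE x in M. (\<Sum>i\<in>{i \<in> I. \<tau> i = t}. d i * u i x) = 0 \<Longrightarrow> i \<in> I \<Longrightarrow> \<tau> i = t \<Longrightarrow> d i = 0"
    and add: "\<And>j f g. j < k \<Longrightarrow> f \<in> D \<Longrightarrow> g \<in> D \<Longrightarrow> \<Lambda> j (\<lambda>x. f x + g x) = \<Lambda> j f + \<Lambda> j g"
    and scale: "\<And>j f c. j < k \<Longrightarrow> f \<in> D \<Longrightarrow> \<Lambda> j (\<lambda>x. c * f x) = c * \<Lambda> j f"
    and pos: "\<And>f. f \<in> D \<Longrightarrow> (\<And>j. j < k \<Longrightarrow> \<Lambda> j f = 0) \<Longrightarrow> 0 \<le> q f"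
  shows "card I \<le> k"
proof (rule ccontr)
  assume "\<not> card I \<le> k"
  then have card: "k < card I" by simp
  have uL2: "u i \<in> L2 M" if "i \<in> I" for i using dom[OF that] by (simp add: form_closure_domain_def)
  have "\<forall>i\<in>I. \<exists>w. form_converges M D q w (u i)"
    using dom by (simp add: form_closure_domain_def)
  then obtain w where w: "\<And>i. i \<in> I \<Longrightarrow> form_converges M D q (w i) (u i)" by metis
  have wD: "w i n \<in> D" if "i \<in> I" for i n using w[OF that] by (simp add: form_converges_def)
  have lam_sum: "\<Lambda> j (\<lambda>x. \<Sum>i\<in>J. c i * w i n x) = (\<Sum>i\<in>J. c i * \<Lambda> j (w i n))"
    if "J \<subseteq> I" "j < k" for J j c n
    using finite_subset[OF that(1) I] that
  proof (induction J)
    case empty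
    then show ?case using scale[of j "\<lambda>_. 0" 0] zero_mem by simp
  next
    case (insert p J)
    then have "\<Lambda> j (\<lambda>x. c p * w p n x + (\<Sum>i\<in>J. c i * w i n x)) = \<Lambda> j (\<lambda>x. c p * w p n x) + \<Lambda> j (\<lambda>x. \<Sum>i\<in>J. c i * w i n x)"
      by (intro add scale_mem sum_mem wD) auto
    with insert show ?case by (simp add: scale wD)
  qed
  \<comment> \<open>The conditions are imposed on the approximants \<open>w i n\<close> separately
    for each \<open>n\<close>, because the functionals are available on \<open>D\<close> only.
    Normalization keeps the coefficients in a compact set.\<close>
  have "\<exists>c. (\<Sum>i\<in>I. (cmod (c i))\<^sup>2) = 1 \<and> (\<forall>j<k. (\<Sum>i\<in>I. c i * \<Lambda> j (w i n)) = 0)" for n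
  proof -
    obtain c where c: "\<exists>i\<in>I. c i \<noteq> 0" "\<forall>j<k. (\<Sum>i\<in>I. c i * \<Lambda> j (w i n)) = 0"
      using underdetermined_solution[OF I card, of "\<lambda>j i. \<Lambda> j (w i n)"] by blast
    define S where "S = (\<Sum>i\<in>I. (cmod (c i))\<^sup>2)"
    have "S > 0" unfolding S_def using c(1) I by (auto intro: sum_pos2)
    then have "(\<Sum>i\<in>I. (cmod (c i / of_real (sqrt S)))\<^sup>2) = 1"
      by (simp add: norm_divide power_divide S_def flip: sum_divide_distrib)
    moreover have "(\<Sum>i\<in>I. c i / of_real (sqrt S) * \<Lambda> j (w i n)) = 0" if "j < k" for j
      using c(2) that by (simp flip: sum_divide_distrib)
    ultimately show ?thesis by (intro exI[of _ "\<lambda>i. c i / of_real (sqrt S)"]) auto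
  qed
  then obtain c where c1: "\<And>n. (\<Sum>i\<in>I. (cmod (c n i))\<^sup>2) = 1"
    and c0: "\<And>n j. j < k \<Longrightarrow> (\<Sum>i\<in>I. c n i * \<Lambda> j (w i n)) = 0" by metis
  have "cmod (c n i) \<le> 1" if "i \<in> I" for n i
  proof -
    have "(cmod (c n i))\<^sup>2 \<le> 1" using member_le_sum[OF that, of "\<lambda>i. (cmod (c n i))\<^sup>2"] I c1[of n] by simp
    then show ?thesis by (simp add: power2_le_imp_le)
  qed
  then obtain r :: "nat \<Rightarrow> nat" where r: "strict_mono r" "\<forall>i\<in>I. convergent (\<lambda>n. c (r n) i)"
    using convergent_subsequence_finite[OF I, of c] by blast
  then obtain d where d: "\<And>i. i \<in> I \<Longrightarrow> (\<lambda>n. c (r n) i) \<longlonglongrightarrow> d i"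
    unfolding convergent_def by metis
  have Q: "0 \<le> Re (\<Sum>i\<in>I. \<Sum>j\<in>I. c n i * (cnj (c n j) * a (w i n) (w j n)))" for n
  proof -
    let ?f = "\<lambda>x. \<Sum>i\<in>I. c n i * w i n x"
    have f: "?f \<in> D" by (intro sum_mem I wD)
    have "0 \<le> q ?f" using lam_sum[of I _ "c n" n] c0 by (intro pos f) auto
    also have "q ?f = Re (\<Sum>i\<in>I. c n i * a (w i n) ?f)"
      by (simp add: q_eq f form_sum I wD)
    also have "\<dots> = Re (\<Sum>i\<in>I. c n i * (\<Sum>j\<in>I. cnj (c n j) * a (w i n) (w j n)))"
      by (simp add: form_sum_right I wD)
    finally show ?thesis by (simp add: sum_distrib_left)
  qed
  have lim: "(\<lambda>n. a (w i n) (w j n)) \<longlonglongrightarrow> of_real (\<tau> i) * l2_inner M (u i) (u j)" if "i \<in> I" "j \<in> I" for i j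
    using polar_limit[OF uL2[OF that(1)] uL2[OF that(2)] w[OF that(1)] w[OF that(2)]] eig[OF that(1) dom[OF that(2)]]
    by simp
  \<comment> \<open>By hermitian symmetry the same limit equals the inner product times \<tau> i and
    also times \<tau> j.\<close>
  have orth: "l2_inner M (u i) (u j) = 0" if "i \<in> I" "j \<in> I" "\<tau> i \<noteq> \<tau> j" for i j
  proof -
    have "(\<lambda>n. cnj (a (w j n) (w i n))) \<longlonglongrightarrow> cnj (of_real (\<tau> j) * l2_inner M (u j) (u i))"
      by (intro tendsto_cnj lim that)
    also have "(\<lambda>n. cnj (a (w j n) (w i n))) = (\<lambda>n. a (w i n) (w j n))"
      using form_cnj[OF wD[OF that(2)] wD[OF that(1)]] by (simp add: fun_eq_iff)
    also have "cnj (of_real (\<tau> j) * l2_inner M (u j) (u i)) = of_real (\<tau> j) * l2_inner M (u i) (u j)"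
      using l2.form_cnj[OF uL2[OF that(2)] uL2[OF that(1)]] by simp
    finally have "of_real (\<tau> j) * l2_inner M (u i) (u j) = of_real (\<tau> i) * l2_inner M (u i) (u j)"
      using lim[OF that(1,2)] LIMSEQ_unique by blast
    then show ?thesis using that(3) by simp
  qed
  define G where "G = (\<lambda>i j. d i * (cnj (d j) * (of_real (\<tau> i) * l2_inner M (u i) (u j))))"
  have "(\<lambda>n. Re (\<Sum>i\<in>I. \<Sum>j\<in>I. c (r n) i * (cnj (c (r n) j) * a (w i (r n)) (w j (r n)))))
      \<longlonglongrightarrow> Re (\<Sum>i\<in>I. \<Sum>j\<in>I. G i j)"
    unfolding G_def
    by (intro tendsto_intros d LIMSEQ_subseq_LIMSEQ[OF lim r(1), unfolded o_def])
  then have G0: "0 \<le> Re (\<Sum>i\<in>I. \<Sum>j\<in>I. G i j)"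
    by (rule LIMSEQ_le_const) (use Q in auto)
  define g where "g = (\<lambda>t x. \<Sum>i\<in>{i \<in> I. \<tau> i = t}. d i * u i x)"
  have gL2: "g t \<in> L2 M" for t unfolding g_def by (intro l2.sum_mem) (use I uL2 in auto)
  have inner: "(\<Sum>i\<in>{i \<in> I. \<tau> i = t}. \<Sum>j\<in>I. G i j) = of_real t * l2_inner M (g t) (g t)" for t
  proof -
    have "l2_inner M (g t) (g t) = (\<Sum>i\<in>{i \<in> I. \<tau> i = t}. d i * (\<Sum>j\<in>{i \<in> I. \<tau> i = t}. cnj (d j) * l2_inner M (u i) (u j)))"
    proof -
      let ?J = "{i \<in> I. \<tau> i = t}"
      have J: "finite ?J" "\<And>i. i \<in> ?J \<Longrightarrow> u i \<in> L2 M" using I uL2 by auto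
      have "l2_inner M (g t) (g t) = (\<Sum>i\<in>?J. d i * l2_inner M (u i) (g t))"
        using l2.form_sum[OF J gL2[of t], where c=d] by (simp add: g_def)
      also have "\<dots> = (\<Sum>i\<in>?J. d i * (\<Sum>j\<in>?J. cnj (d j) * l2_inner M (u i) (u j)))"
        unfolding g_def by (rule sum.cong[OF refl], subst l2.form_sum_right[OF J]) (use uL2 in auto)
      finally show ?thesis .
    qed
    moreover have "(\<Sum>j\<in>I. G i j) = (\<Sum>j\<in>{i \<in> I. \<tau> i = t}. G i j)" if "i \<in> I" "\<tau> i = t" for i
      by (rule sum.mono_neutral_right) (use I that orth[OF _ _ not_sym] in \<open>auto simp: G_def\<close>)
    ultimately show ?thesis
      by (auto simp: G_def sum_distrib_left algebra_simps intro!: sum.cong)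
  qed
  \<comment> \<open>Independence is known only within one eigenvalue, so the double sum is grouped
    by eigenvalue; orthogonality has removed the mixed terms.\<close>
  have "(\<Sum>i\<in>I. \<Sum>j\<in>I. G i j) = (\<Sum>t\<in>\<tau> ` I. of_real t * l2_inner M (g t) (g t))"
    by (subst sum.group[OF I, of "\<tau> ` I" \<tau>, symmetric]) (auto simp: inner I)
  then have "0 \<le> (\<Sum>t\<in>\<tau> ` I. t * (l2_norm M (g t))\<^sup>2)"
    using G0 by (simp add: l2_inner_self[symmetric] gL2)
  then have sum0: "(\<Sum>t\<in>\<tau> ` I. (- t) * (l2_norm M (g t))\<^sup>2) = 0"
    by (intro antisym) (use neg in \<open>auto simp: sum_negf less_imp_le intro!: sum_nonneg sum_nonpos mult_nonpos_nonneg\<close>)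
  have "d i = 0" if i: "i \<in> I" for i
  proof -
    have "(- \<tau> i) * (l2_norm M (g (\<tau> i)))\<^sup>2 = 0"
      using sum_nonneg_0[OF _ _ sum0, of "\<tau> i"] I i neg by (force simp: mult_nonpos_nonneg less_imp_le)
    then have "AE x in M. g (\<tau> i) x = 0"
      using neg[OF i] by (intro l2_norm_eq_0_AE gL2) auto
    then show ?thesis using indep[where t="\<tau> i" and d=d and i=i] i by (simp add: g_def)
  qed
  moreover have "(\<lambda>n. \<Sum>i\<in>I. (cmod (c (r n) i))\<^sup>2) \<longlonglongrightarrow> (\<Sum>i\<in>I. (cmod (d i))\<^sup>2)"
    by (intro tendsto_intros d)
  then have "(\<Sum>i\<in>I. (cmod (d i))\<^sup>2) = 1" using c1 LIMSEQ_unique[OF _ tendsto_const] by fastforce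
  ultimately show False by simp
qed

text \<open>The count is an infinite sum of nonnegative terms, hence the supremum of its finite
  subsums. For finitely many discrete eigenvalues the multiplicities are finite and attained, and
  the eigenfunctions are indexed jointly by pairs of an eigenvalue and a position.\<close>

theorem eigenvalue_count_le:
  fixes \<Lambda> :: "nat \<Rightarrow> ('a \<Rightarrow> complex) \<Rightarrow> complex"
  assumes add: "\<And>j f g. j < k \<Longrightarrow> f \<in> D \<Longrightarrow> g \<in> D \<Longrightarrow> \<Lambda> j (\<lambda>x. f x + g x) = \<Lambda> j f + \<Lambda> j g"
    and scale: "\<And>j f c. j < k \<Longrightarrow> f \<in> D \<Longrightarrow> \<Lambda> j (\<lambda>x. c * f x) = c * \<Lambda> j f"
    and pos: "\<And>f. f \<in> D \<Longrightarrow> (\<And>j. j < k \<Longrightarrow> \<Lambda> j f = 0) \<Longrightarrow> 0 \<le> q f"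
  shows "eigenvalue_count M (friedrichs_operator M D q) 0 \<le> of_nat k"
proof -
  let ?T = "friedrichs_operator M D q"
  let ?A = "{t::real. t < 0 \<and> complex_of_real t \<in> discrete_eigenvalues M ?T}"
  let ?m = "\<lambda>t. l2_multiplicity M ?T (complex_of_real t)"
  have "(\<Sum>t\<in>F. ennreal_of_enat (?m t)) \<le> of_nat k" if F: "finite F" "F \<subseteq> ?A" for F
  proof -
    have "\<forall>t\<in>F. \<exists>n. ?m t = enat n"
      using F(2) by (auto simp: discrete_eigenvalues_def)
    then obtain n where n: "\<And>t. t \<in> F \<Longrightarrow> ?m t = enat (n t)" by metis
    have "\<forall>t\<in>F. \<exists>u. (\<forall>i<n t. u i \<in> l2_eigenspace M ?T (of_real t)) \<and> ae_independent M (n t) u"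
      using l2_dim_attained n unfolding l2_multiplicity_def by blast
    then obtain u where u: "\<And>t i. t \<in> F \<Longrightarrow> i < n t \<Longrightarrow> u t i \<in> l2_eigenspace M ?T (of_real t)"
      and ind: "\<And>t. t \<in> F \<Longrightarrow> ae_independent M (n t) (u t)" by metis
    let ?I = "SIGMA t:F. {..<n t}"
    have "card ?I \<le> k"
    proof (rule card_eigenfunctions_le[where u="\<lambda>p. u (fst p) (snd p)" and \<tau>=fst and \<Lambda>=\<Lambda>])
      show "finite ?I" using F by auto
      fix p assume p: "p \<in> ?I"
      then have "u (fst p) (snd p) \<in> l2_eigenspace M ?T (of_real (fst p))" by (auto intro: u)
      then obtain f where f: "(u (fst p) (snd p), f) \<in> ?T" "AE x in M. f x = of_real (fst p) * u (fst p) (snd p) x"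
        by (auto simp: l2_eigenspace_def)
      then show dom: "u (fst p) (snd p) \<in> form_closure_domain M D q" by (auto simp: friedrichs_operator_def)
      show "fst p < 0" using p F by auto
      fix v assume v: "v \<in> form_closure_domain M D q"
      have "polar_form (form_closure M D q) (u (fst p) (snd p)) v = l2_inner M f v"
        using f(1) v by (auto simp: friedrichs_operator_def)
      also have "\<dots> = l2_inner M (\<lambda>x. of_real (fst p) * u (fst p) (snd p) x) v"
        unfolding l2_inner_def
      proof (rule integral_cong_AE)
        have [measurable]: "f \<in> borel_measurable M" "v \<in> borel_measurable M" "u (fst p) (snd p) \<in> borel_measurable M"
          using f(1) v dom by (auto simp: friedrichs_operator_def form_closure_domain_def L2_measurable)
        show "(\<lambda>x. f x * cnj (v x)) \<in> borel_measurable M"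
          "(\<lambda>x. of_real (fst p) * u (fst p) (snd p) x * cnj (v x)) \<in> borel_measurable M" by measurable
        show "AE x in M. f x * cnj (v x) = of_real (fst p) * u (fst p) (snd p) x * cnj (v x)"
          using f(2) by auto
      qed
      also have "\<dots> = of_real (fst p) * l2_inner M (u (fst p) (snd p)) v"
        by (rule l2.form_scale) (use dom v in \<open>auto simp: form_closure_domain_def\<close>)
      finally show "polar_form (form_closure M D q) (u (fst p) (snd p)) v = of_real (fst p) * l2_inner M (u (fst p) (snd p)) v" .
    next
      fix t d p assume AE: "AE x in M. (\<Sum>i\<in>{i \<in> ?I. fst i = t}. d i * u (fst i) (snd i) x) = 0" and p: "p \<in> ?I" "fst p = t"
      have t: "t \<in> F" using p by auto
      have eq: "{i \<in> ?I. fst i = t} = Pair t ` {..<n t}" using t by auto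
      have "(\<Sum>i\<in>{i \<in> ?I. fst i = t}. d i * u (fst i) (snd i) x) = (\<Sum>i<n t. d (t, i) * u t i x)" for x
        unfolding eq by (subst sum.reindex) (auto simp: inj_on_def)
      with AE have "AE x in M. (\<Sum>i<n t. d (t, i) * u t i x) = 0" by simp
      then show "d p = 0" using ind[OF t, unfolded ae_independent_def, rule_format, of "\<lambda>i. d (t, i)" "snd p"] p by auto
    qed (use add scale pos in auto)
    then have "(\<Sum>t\<in>F. n t) \<le> k" using F by (simp add: card_SigmaI)
    moreover have "(\<Sum>t\<in>F. ennreal_of_enat (?m t)) = of_nat (\<Sum>t\<in>F. n t)"
      by (simp add: n)
    ultimately show ?thesis by (simp only: of_nat_le_iff)
  qed
  then show ?thesis
    unfolding eigenvalue_count_def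
    by (subst nonneg_infsum_complete) (auto intro!: SUP_least)
qed

end

section \<open>Poincare inequalities on the cylinder\<close>

lemma borel_measurable_fst_comp [measurable (raw)]:
  fixes f :: "'a \<Rightarrow> 'b::topological_space \<times> 'c::topological_space"
  shows "f \<in> borel_measurable M \<Longrightarrow> (\<lambda>x. fst (f x)) \<in> borel_measurable M"
  by (rule measurable_compose[OF _ borel_measurable_continuous_onI]) (auto intro!: continuous_intros)

lemma borel_measurable_snd_comp [measurable (raw)]:
  fixes f :: "'a \<Rightarrow> 'b::topological_space \<times> 'c::topological_space"
  shows "f \<in> borel_measurable M \<Longrightarrow> (\<lambda>x. snd (f x)) \<in> borel_measurable M"
  by (rule measurable_compose[OF _ borel_measurable_continuous_onI]) (auto intro!: continuous_intros)

text \<open>Integrability is not among the assumptions: for a non-integrable function the Bochner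
  integral is 0 and the bound is trivial.\<close>

lemma set_integral_Cauchy_Schwarz:
  fixes f :: "'a \<Rightarrow> complex"
  assumes [measurable]: "f \<in> borel_measurable M" "S \<in> sets M"
  shows "ennreal ((cmod (LINT z:S|M. f z))\<^sup>2) \<le> emeasure M S * (\<integral>\<^sup>+z\<in>S. ennreal ((cmod (f z))\<^sup>2) \<partial>M)"
proof -
  let ?g = "\<lambda>z. indicator S z *\<^sub>R f z"
  have "ennreal (cmod (LINT z:S|M. f z)) \<le> (\<integral>\<^sup>+z. ennreal (cmod (?g z)) \<partial>M)"
    unfolding set_lebesgue_integral_def
  proof (cases "integrable M ?g")
    case True then show "ennreal (cmod (integral\<^sup>L M ?g)) \<le> (\<integral>\<^sup>+z. ennreal (cmod (?g z)) \<partial>M)"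
      by (rule integral_norm_bound_ennreal)
  qed (simp add: not_integrable_integral_eq)
  also have "\<dots> = (\<integral>\<^sup>+z. indicator S z * ennreal (cmod (?g z)) \<partial>M)"
    by (intro nn_integral_cong) (simp add: indicator_def)
  finally have "(ennreal (cmod (LINT z:S|M. f z)))\<^sup>2 \<le> (\<integral>\<^sup>+z. indicator S z * ennreal (cmod (?g z)) \<partial>M)\<^sup>2"
    by (intro power_mono) auto
  also have "\<dots> \<le> (\<integral>\<^sup>+z. (indicator S z)\<^sup>2 \<partial>M) * (\<integral>\<^sup>+z. (ennreal (cmod (?g z)))\<^sup>2 \<partial>M)"
    by (intro Cauchy_Schwarz_nn_integral) measurable
  also have "(\<integral>\<^sup>+z. (indicator S z)\<^sup>2 \<partial>M) = (\<integral>\<^sup>+z. indicator S z \<partial>M)"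
    by (intro nn_integral_cong) (simp add: indicator_def)
  also have "\<dots> = emeasure M S" by simp
  also have "(\<integral>\<^sup>+z. (ennreal (cmod (?g z)))\<^sup>2 \<partial>M) = (\<integral>\<^sup>+z\<in>S. ennreal ((cmod (f z))\<^sup>2) \<partial>M)"
    by (intro nn_integral_cong) (simp add: indicator_def ennreal_power)
  finally show ?thesis by (simp add: ennreal_power)
qed

lemma diff_sq_le_integral_deriv:
  fixes f :: "real \<Rightarrow> complex"
  assumes der: "\<And>t. (f has_vector_derivative f' t) (at t)" and cont: "continuous_on UNIV f'"
    and "x \<in> {a..b}" "y \<in> {a..b}"
  shows "ennreal ((cmod (f y - f x))\<^sup>2) \<le> ennreal (b - a) * (\<integral>\<^sup>+t\<in>{a..<b}. ennreal ((cmod (f' t))\<^sup>2) \<partial>lborel)"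
proof -
  have [measurable]: "f' \<in> borel_measurable borel" by (rule borel_measurable_continuous_onI[OF cont])
  have *: "ennreal ((cmod (f y - f x))\<^sup>2) \<le> ennreal (b - a) * (\<integral>\<^sup>+t\<in>{a..<b}. ennreal ((cmod (f' t))\<^sup>2) \<partial>lborel)"
    if "a \<le> x" "x \<le> y" "y \<le> b" for x y
  proof -
    have "has_bochner_integral lborel (\<lambda>t. indicator {x..y} t *\<^sub>R f' t) (f y - f x)"
      using that by (intro has_bochner_integral_FTC_Icc has_vector_derivative_at_within[OF der] continuous_on_subset[OF cont]) auto
    then have "f y - f x = (LINT t:{x..y}|lborel. f' t)"
      by (simp add: set_lebesgue_integral_def has_bochner_integral_integral_eq)
    then have "ennreal ((cmod (f y - f x))\<^sup>2) \<le> emeasure lborel {x..y} * (\<integral>\<^sup>+t\<in>{x..y}. ennreal ((cmod (f' t))\<^sup>2) \<partial>lborel)"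
      by (simp only:) (intro set_integral_Cauchy_Schwarz; measurable)
    also have "emeasure lborel {x..y} \<le> ennreal (b - a)"
      using that by (simp add: ennreal_leI)
    also have "(\<integral>\<^sup>+t\<in>{x..y}. ennreal ((cmod (f' t))\<^sup>2) \<partial>lborel) \<le> (\<integral>\<^sup>+t\<in>{a..<b}. ennreal ((cmod (f' t))\<^sup>2) \<partial>lborel)"
    proof (rule nn_integral_mono_AE)
      \<comment> \<open>Half-open intervals tile without overlap, but \<open>x\<close> or
        \<open>y\<close> may be the right endpoint \<open>b\<close>; that point is a null
        set.\<close>
      show "AE t in lborel. ennreal ((cmod (f' t))\<^sup>2) * indicator {x..y} t \<le> ennreal ((cmod (f' t))\<^sup>2) * indicator {a..<b} t"
        using AE_lborel_singleton[of b] by eventually_elim (use that in \<open>auto simp: indicator_def\<close>)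
    qed
    finally show ?thesis by (simp add: mult_right_mono mult_left_mono)
  qed
  show ?thesis
  proof (cases "x \<le> y")
    case True then show ?thesis using * assms by simp
  next
    case False then show ?thesis using *[of y x] assms by (simp add: norm_minus_commute)
  qed
qed

lemma ennreal_cmod_add_sq:
  "ennreal ((cmod (u + v))\<^sup>2) \<le> 2 * ennreal ((cmod u)\<^sup>2) + 2 * ennreal ((cmod v)\<^sup>2)"
proof -
  have "ennreal ((cmod (u + v))\<^sup>2) \<le> ennreal (2 * (cmod u)\<^sup>2 + 2 * (cmod v)\<^sup>2)"
    by (intro ennreal_leI cmod_add_sq)
  then show ?thesis by (simp add: ennreal_plus ennreal_mult)
qed

lemma nn_integral_box:
  fixes f :: "real \<times> real \<Rightarrow> ennreal"
  assumes [measurable]: "f \<in> borel_measurable borel" "A \<in> sets borel" "B \<in> sets borel"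
  shows "(\<integral>\<^sup>+z\<in>A \<times> B. f z \<partial>lborel) = (\<integral>\<^sup>+t\<in>A. (\<integral>\<^sup>+x\<in>B. f (t, x) \<partial>lborel) \<partial>lborel)"
    and "(\<integral>\<^sup>+z\<in>A \<times> B. f z \<partial>lborel) = (\<integral>\<^sup>+x\<in>B. (\<integral>\<^sup>+t\<in>A. f (t, x) \<partial>lborel) \<partial>lborel)"
proof -
  let ?g = "\<lambda>z. f z * indicator (A \<times> B) z"
  have [measurable]: "A \<times> B \<in> sets borel" by (intro borel_Times assms)
  have g: "?g \<in> borel_measurable (lborel \<Otimes>\<^sub>M lborel)"
    by (simp add: lborel_prod)
  have "(\<integral>\<^sup>+z. ?g z \<partial>lborel) = (\<integral>\<^sup>+t. \<integral>\<^sup>+x. ?g (t, x) \<partial>lborel \<partial>lborel)"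
    using lborel.nn_integral_fst[OF g] by (simp add: lborel_prod)
  also have "\<dots> = (\<integral>\<^sup>+t\<in>A. (\<integral>\<^sup>+x\<in>B. f (t, x) \<partial>lborel) \<partial>lborel)"
    by (intro nn_integral_cong) (auto simp: indicator_def)
  finally show "(\<integral>\<^sup>+z. ?g z \<partial>lborel) = (\<integral>\<^sup>+t\<in>A. (\<integral>\<^sup>+x\<in>B. f (t, x) \<partial>lborel) \<partial>lborel)" .
  have "(\<integral>\<^sup>+z. ?g z \<partial>lborel) = (\<integral>\<^sup>+x. \<integral>\<^sup>+t. ?g (t, x) \<partial>lborel \<partial>lborel)"
    using lborel_pair.nn_integral_snd[OF g] by (simp add: lborel_prod)
  also have "\<dots> = (\<integral>\<^sup>+x\<in>B. (\<integral>\<^sup>+t\<in>A. f (t, x) \<partial>lborel) \<partial>lborel)"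
    by (intro nn_integral_cong) (auto simp: indicator_def)
  finally show "(\<integral>\<^sup>+z. ?g z \<partial>lborel) = (\<integral>\<^sup>+x\<in>B. (\<integral>\<^sup>+t\<in>A. f (t, x) \<partial>lborel) \<partial>lborel)" .
qed

lemma box_in_borel [measurable, simp]: "{a..<b} \<times> {c..<d} \<in> sets borel"
  for a b :: "'a::linorder_topology" and c d :: "'b::linorder_topology"
  by (intro borel_Times) auto

lemma emeasure_lborel_half_open_box: "a \<le> b \<Longrightarrow> c \<le> d \<Longrightarrow>
    emeasure lborel ({a..<b} \<times> {c..<d::real}) = ennreal ((b - a) * (d - c))" for a :: real
  by (subst lborel_prod[symmetric]) (simp add: lborel.emeasure_pair_measure_Times ennreal_mult)

lemma set_integrable_half_open_box:
  fixes U :: "real \<times> real \<Rightarrow> complex"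
  assumes "continuous_on UNIV U"
  shows "set_integrable lborel ({a..<b} \<times> {c..<d}) U"
proof -
  have "set_integrable lborel (cbox (a, c) (b, d)) U"
    unfolding set_integrable_def
    by (intro borel_integrable_compact continuous_on_subset[OF assms]) auto
  then show ?thesis
    by (rule set_integrable_subset) (auto simp: cbox_Pair_eq)
qed

locale cyl_fun =
  fixes U Ut Uh :: "real \<times> real \<Rightarrow> complex"
  assumes deriv_t: "((\<lambda>t. U (t, x)) has_vector_derivative Ut (t, x)) (at t)"
    and deriv_h: "((\<lambda>x. U (t, x)) has_vector_derivative Uh (t, x)) (at x)"
    and cont: "continuous_on UNIV U" "continuous_on UNIV Ut" "continuous_on UNIV Uh"
begin

lemma cyl_measurable [measurable]: "U \<in> borel_measurable borel" "Ut \<in> borel_measurable borel" "Uh \<in> borel_measurable borel"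
  using cont by (auto intro: borel_measurable_continuous_onI)

definition energy :: "(real \<times> real) set \<Rightarrow> ennreal" where
  "energy S = (\<integral>\<^sup>+z\<in>S. ennreal ((cmod (Ut z))\<^sup>2 + (cmod (Uh z))\<^sup>2) \<partial>lborel)"

lemma cont_sections:
  "continuous_on UNIV (\<lambda>t. Ut (t, x))" "continuous_on UNIV (\<lambda>x. Uh (t, x))"
  by (auto intro!: continuous_on_compose2[OF cont(2)] continuous_on_compose2[OF cont(3)] continuous_intros)

text \<open>The difference between U at (t, x) and at (s, y) is split at the corner (s, x) and
  averaged over (s, y). The \<open>t\<close> derivative is then integrated along the line through
  \<open>x\<close> only, the angular derivative over the whole box. As H^1 does not control point
  values in two dimensions, the first term has to stay on its line until \<open>x\<close> is
  integrated.\<close>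

lemma box_mean_pointwise:
  assumes l: "0 < l" and al: "0 < \<alpha>" and t: "t \<in> {a..a + l}" and x: "x \<in> {b..b + \<alpha>}"
    and m: "(LINT z:{a..<a + l} \<times> {b..<b + \<alpha>}|lborel. U z) = of_real (l * \<alpha>) * m"
  shows "ennreal ((cmod (U (t, x) - m))\<^sup>2) \<le>
    ennreal (2 * l) * (\<integral>\<^sup>+s\<in>{a..<a + l}. ennreal ((cmod (Ut (s, x)))\<^sup>2) \<partial>lborel) +
    ennreal (2 * \<alpha> / l) * (\<integral>\<^sup>+z\<in>{a..<a + l} \<times> {b..<b + \<alpha>}. ennreal ((cmod (Uh z))\<^sup>2) \<partial>lborel)"
proof -
  let ?I = "{a..<a + l}" and ?J = "{b..<b + \<alpha>}"
  let ?S = "?I \<times> ?J"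
  define G where "G = (\<integral>\<^sup>+s\<in>?I. ennreal ((cmod (Ut (s, x)))\<^sup>2) \<partial>lborel)"
  define H where "H = (\<lambda>s. \<integral>\<^sup>+y\<in>?J. ennreal ((cmod (Uh (s, y)))\<^sup>2) \<partial>lborel)"
  have meas_S: "emeasure lborel ?S = ennreal (l * \<alpha>)"
    using emeasure_lborel_half_open_box[of a "a + l" b "b + \<alpha>"] l al by simp
  have int_c: "set_integrable lborel ?S (\<lambda>z. U (t, x))"
    unfolding set_integrable_def
    by (intro integrable_scaleR_left) (simp add: meas_S integrable_indicator_iff)
  have "(LINT z:?S|lborel. U (t, x) - U z) = (LINT z:?S|lborel. U (t, x)) - (LINT z:?S|lborel. U z)"
    by (intro set_integral_diff int_c set_integrable_half_open_box cont(1))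
  also have "(LINT z:?S|lborel. U (t, x)) = of_real (l * \<alpha>) * U (t, x)"
    using meas_S l al by (simp add: set_lebesgue_integral_def measure_def scaleR_conv_of_real integrable_indicator_iff)
  finally have eq: "(LINT z:?S|lborel. U (t, x) - U z) = of_real (l * \<alpha>) * (U (t, x) - m)"
    unfolding m by (simp only: right_diff_distrib)
  have pt: "ennreal ((cmod (U (t, x) - U z))\<^sup>2) \<le> ennreal (2 * l) * G + ennreal (2 * \<alpha>) * H (fst z)" if "z \<in> ?S" for z
  proof -
    obtain s y where z: "z = (s, y)" by fastforce
    have "U (t, x) - U z = (U (t, x) - U (s, x)) + (U (s, x) - U (s, y))" by (simp add: z)
    then have "ennreal ((cmod (U (t, x) - U z))\<^sup>2) \<le> 2 * ennreal ((cmod (U (t, x) - U (s, x)))\<^sup>2) + 2 * ennreal ((cmod (U (s, x) - U (s, y)))\<^sup>2)"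
      by (metis ennreal_cmod_add_sq)
    also have "ennreal ((cmod (U (t, x) - U (s, x)))\<^sup>2) \<le> ennreal l * G"
      using diff_sq_le_integral_deriv[OF deriv_t cont_sections(1), of s a "a + l" t x] that t by (simp add: z G_def)
    also have "ennreal ((cmod (U (s, x) - U (s, y)))\<^sup>2) \<le> ennreal \<alpha> * H s"
      using diff_sq_le_integral_deriv[OF deriv_h cont_sections(2), of y b "b + \<alpha>" x s] that x by (simp add: z H_def)
    finally show ?thesis using l al
      by (simp add: z ennreal_mult mult.assoc add_mono mult_left_mono)
  qed
  have H_meas [measurable]: "H \<in> borel_measurable borel" unfolding H_def by measurable
  have "ennreal ((l * \<alpha>)\<^sup>2) * ennreal ((cmod (U (t, x) - m))\<^sup>2) = ennreal ((cmod (LINT z:?S|lborel. U (t, x) - U z))\<^sup>2)"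
    using l al by (simp add: eq norm_mult power_mult_distrib ennreal_mult)
  also have "\<dots> \<le> emeasure lborel ?S * (\<integral>\<^sup>+z\<in>?S. ennreal ((cmod (U (t, x) - U z))\<^sup>2) \<partial>lborel)"
    by (intro set_integral_Cauchy_Schwarz) (auto simp: borel_Times)
  also have "(\<integral>\<^sup>+z\<in>?S. ennreal ((cmod (U (t, x) - U z))\<^sup>2) \<partial>lborel)
      \<le> (\<integral>\<^sup>+z\<in>?S. (ennreal (2 * l) * G + ennreal (2 * \<alpha>) * H (fst z)) \<partial>lborel)"
    by (intro nn_integral_mono) (auto simp: indicator_def pt)
  also have "\<dots> = (\<integral>\<^sup>+s\<in>?I. (\<integral>\<^sup>+y\<in>?J. (ennreal (2 * l) * G + ennreal (2 * \<alpha>) * H s) \<partial>lborel) \<partial>lborel)"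
    by (subst nn_integral_box(1)) simp_all
  also have "\<dots> = (\<integral>\<^sup>+s\<in>?I. (ennreal \<alpha> * (ennreal (2 * l) * G) + ennreal (2 * \<alpha>) * ennreal \<alpha> * H s) \<partial>lborel)"
    by (intro nn_integral_cong, subst nn_integral_cmult_indicator) (use al in \<open>simp_all add: algebra_simps\<close>)
  also have "\<dots> = ennreal l * (ennreal \<alpha> * (ennreal (2 * l) * G)) + ennreal (2 * \<alpha>) * ennreal \<alpha> * (\<integral>\<^sup>+s\<in>?I. H s \<partial>lborel)"
    using l by (simp add: distrib_right nn_integral_add nn_integral_cmult mult.assoc nn_integral_multc) (simp add: ac_simps)
  also have "(\<integral>\<^sup>+s\<in>?I. H s \<partial>lborel) = (\<integral>\<^sup>+z\<in>?S. ennreal ((cmod (Uh z))\<^sup>2) \<partial>lborel)" (is "_ = ?E")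
    unfolding H_def by (subst nn_integral_box(1)) simp_all
  finally have le: "ennreal ((l * \<alpha>)\<^sup>2) * ennreal ((cmod (U (t, x) - m))\<^sup>2) \<le>
      emeasure lborel ?S * (ennreal l * (ennreal \<alpha> * (ennreal (2 * l) * G)) + ennreal (2 * \<alpha>) * ennreal \<alpha> * ?E)"
    by (simp add: mult_left_mono)
  also have "\<dots> = ennreal ((l * \<alpha>)\<^sup>2) * (ennreal (2 * l) * G + ennreal (2 * \<alpha> / l) * ?E)"
  proof -
    have 1: "ennreal (l * \<alpha>) * (ennreal l * (ennreal \<alpha> * (ennreal (2 * l) * G))) = ennreal ((l * \<alpha>)\<^sup>2) * (ennreal (2 * l) * G)"
      using l al by (simp add: power2_eq_square ennreal_mult' mult.assoc mult.left_commute)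
    have "l * \<alpha> * (2 * \<alpha> * \<alpha>) = (l * \<alpha>)\<^sup>2 * (2 * \<alpha> / l)"
      using l by (simp add: field_simps power2_eq_square)
    then have 2: "ennreal (l * \<alpha>) * (ennreal (2 * \<alpha>) * ennreal \<alpha> * ?E) = ennreal ((l * \<alpha>)\<^sup>2) * (ennreal (2 * \<alpha> / l) * ?E)"
      using l al by (simp add: mult.assoc[symmetric] flip: ennreal_mult)
    show ?thesis unfolding meas_S distrib_left 1 2 ..
  qed
  finally show ?thesis
    unfolding G_def using l al by (subst (asm) ennreal_mult_le_mult_iff) auto
qed

lemma energy_eq: "S \<in> sets borel \<Longrightarrow> energy S = (\<integral>\<^sup>+z\<in>S. ennreal ((cmod (Ut z))\<^sup>2) \<partial>lborel) + (\<integral>\<^sup>+z\<in>S. ennreal ((cmod (Uh z))\<^sup>2) \<partial>lborel)"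
  unfolding energy_def by (subst nn_integral_add[symmetric]) (auto simp: ennreal_plus distrib_right)

text \<open>Integrating the pointwise bound over \<open>x\<close> turns the line term into a box
  integral. What results is a trace inequality on the slice at \<open>t\<close>, with a constant
  independent of \<open>t\<close>.\<close>

lemma box_mean_slice:
  assumes l: "0 < l" and al: "\<alpha> = 2 * pi * l" and t: "t \<in> {a..a + l}"
    and m: "(LINT z:{a..<a + l} \<times> {b..<b + \<alpha>}|lborel. U z) = of_real (l * \<alpha>) * m"
  shows "(\<integral>\<^sup>+x\<in>{b..<b + \<alpha>}. ennreal ((cmod (U (t, x) - m))\<^sup>2) \<partial>lborel)
    \<le> ennreal (8 * pi\<^sup>2 * l) * energy ({a..<a + l} \<times> {b..<b + \<alpha>})"
proof -
  let ?I = "{a..<a + l}" and ?J = "{b..<b + \<alpha>}"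
  let ?Et = "\<integral>\<^sup>+z\<in>?I \<times> ?J. ennreal ((cmod (Ut z))\<^sup>2) \<partial>lborel"
  let ?Eh = "\<integral>\<^sup>+z\<in>?I \<times> ?J. ennreal ((cmod (Uh z))\<^sup>2) \<partial>lborel"
  have al0: "0 < \<alpha>" using l al by simp
  have "(\<integral>\<^sup>+x\<in>?J. ennreal ((cmod (U (t, x) - m))\<^sup>2) \<partial>lborel)
      \<le> (\<integral>\<^sup>+x\<in>?J. (ennreal (2 * l) * (\<integral>\<^sup>+s\<in>?I. ennreal ((cmod (Ut (s, x)))\<^sup>2) \<partial>lborel) + ennreal (2 * \<alpha> / l) * ?Eh) \<partial>lborel)"
  proof (rule nn_integral_mono)
    fix x
    show "ennreal ((cmod (U (t, x) - m))\<^sup>2) * indicator ?J x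
      \<le> (ennreal (2 * l) * (\<integral>\<^sup>+s\<in>?I. ennreal ((cmod (Ut (s, x)))\<^sup>2) \<partial>lborel) + ennreal (2 * \<alpha> / l) * ?Eh) * indicator ?J x"
      by (cases "x \<in> ?J") (simp_all add: box_mean_pointwise[OF l al0 t _ m])
  qed
  also have "\<dots> = ennreal (2 * l) * (\<integral>\<^sup>+x\<in>?J. (\<integral>\<^sup>+s\<in>?I. ennreal ((cmod (Ut (s, x)))\<^sup>2) \<partial>lborel) \<partial>lborel)
      + (\<integral>\<^sup>+x\<in>?J. (ennreal (2 * \<alpha> / l) * ?Eh) \<partial>lborel)"
    by (simp add: distrib_right nn_integral_add nn_integral_cmult mult.assoc)
  also have "(\<integral>\<^sup>+x\<in>?J. (\<integral>\<^sup>+s\<in>?I. ennreal ((cmod (Ut (s, x)))\<^sup>2) \<partial>lborel) \<partial>lborel) = ?Et"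
    by (subst nn_integral_box(2)) simp_all
  also have "(\<integral>\<^sup>+x\<in>?J. (ennreal (2 * \<alpha> / l) * ?Eh) \<partial>lborel) = ennreal (8 * pi\<^sup>2 * l) * ?Eh"
  proof -
    \<comment> \<open>With the aspect ratio 2 pi both terms scale like \<open>l\<close>, and the
      angular one has the larger constant.\<close>
    have "2 * \<alpha> / l * \<alpha> = 8 * pi\<^sup>2 * l" using l by (simp add: al power2_eq_square)
    then have "ennreal (2 * \<alpha> / l) * ennreal \<alpha> = ennreal (8 * pi\<^sup>2 * l)"
      using l al0 by (simp flip: ennreal_mult)
    moreover have "(\<integral>\<^sup>+x\<in>?J. (ennreal (2 * \<alpha> / l) * ?Eh) \<partial>lborel) = (ennreal (2 * \<alpha> / l) * ennreal \<alpha>) * ?Eh"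
      by (subst nn_integral_cmult_indicator) (use al0 in \<open>simp_all add: ac_simps\<close>)
    ultimately show "(\<integral>\<^sup>+x\<in>?J. (ennreal (2 * \<alpha> / l) * ?Eh) \<partial>lborel) = ennreal (8 * pi\<^sup>2 * l) * ?Eh" by (simp only:)
  qed
  also have "ennreal (2 * l) * ?Et \<le> ennreal (8 * pi\<^sup>2 * l) * ?Et"
  proof (rule mult_right_mono)
    have "1 \<le> pi\<^sup>2" using pi_gt3 by (simp add: one_le_power)
    then show "ennreal (2 * l) \<le> ennreal (8 * pi\<^sup>2 * l)" using l by (intro ennreal_leI) simp
  qed simp
  finally show ?thesis by (simp add: energy_eq distrib_left)
qed

text \<open>Since the slice bound is uniform in \<open>t\<close>, only the mass of the weight
  counts. This is where a norm that is L^1 in the radius and a supremum in the angle enters.\<close>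

lemma box_mean_weighted:
  assumes l: "0 < l" and al: "\<alpha> = 2 * pi * l" and W [measurable]: "W \<in> borel_measurable borel"
    and m: "(LINT z:{a..<a + l} \<times> {b..<b + \<alpha>}|lborel. U z) = of_real (l * \<alpha>) * m"
  shows "(\<integral>\<^sup>+z\<in>{a..<a + l} \<times> {b..<b + \<alpha>}. W (fst z) * ennreal ((cmod (U z - m))\<^sup>2) \<partial>lborel)
    \<le> ennreal (8 * pi\<^sup>2 * l) * (\<integral>\<^sup>+t\<in>{a..<a + l}. W t \<partial>lborel) * energy ({a..<a + l} \<times> {b..<b + \<alpha>})"
proof -
  let ?I = "{a..<a + l}" and ?J = "{b..<b + \<alpha>}"
  let ?K = "ennreal (8 * pi\<^sup>2 * l) * energy (?I \<times> ?J)"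
  have "(\<integral>\<^sup>+z\<in>?I \<times> ?J. (W (fst z) * ennreal ((cmod (U z - m))\<^sup>2)) \<partial>lborel)
      = (\<integral>\<^sup>+t\<in>?I. (\<integral>\<^sup>+x\<in>?J. (W t * ennreal ((cmod (U (t, x) - m))\<^sup>2)) \<partial>lborel) \<partial>lborel)"
    by (subst nn_integral_box(1)) simp_all
  also have "\<dots> = (\<integral>\<^sup>+t\<in>?I. (W t * (\<integral>\<^sup>+x\<in>?J. (ennreal ((cmod (U (t, x) - m))\<^sup>2)) \<partial>lborel)) \<partial>lborel)"
    by (intro nn_integral_cong) (simp add: nn_integral_cmult mult.assoc)
  also have "\<dots> \<le> (\<integral>\<^sup>+t\<in>?I. (W t * ?K) \<partial>lborel)"
  proof (rule nn_integral_mono)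
    fix t
    show "W t * (\<integral>\<^sup>+x\<in>?J. (ennreal ((cmod (U (t, x) - m))\<^sup>2)) \<partial>lborel) * indicator ?I t \<le> W t * ?K * indicator ?I t"
      by (cases "t \<in> ?I") (simp_all add: mult_left_mono box_mean_slice[OF l al _ m])
  qed
  also have "\<dots> = (\<integral>\<^sup>+t. W t * indicator ?I t * ?K \<partial>lborel)"
    by (intro nn_integral_cong) (simp add: ac_simps)
  also have "\<dots> = (\<integral>\<^sup>+t\<in>?I. W t \<partial>lborel) * ?K"
    by (subst nn_integral_multc) auto
  finally show ?thesis by (simp add: ac_simps)
qed

end

section \<open>Dyadic subdivision of strips\<close>

lemma indicator_subdivision:
  assumes "0 < (d::real)"
  shows "(indicator {0..<d * real n} x :: ennreal) = (\<Sum>k<n. indicator {d * real k..<d * real k + d} x)"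
proof (induction n)
  case (Suc n)
  have "(indicator {0..<d * real (Suc n)} x :: ennreal) = indicator {0..<d * real n} x + indicator {d * real n..<d * real n + d} x"
    using assms by (auto simp: indicator_def algebra_simps)
      (smt (verit, best) mult_nonneg_nonneg of_nat_0_le_iff)+
  then show ?case using Suc by simp
qed simp

definition strip :: "real \<Rightarrow> real \<Rightarrow> (real \<times> real) set" where
  "strip a l = {a..<a + l} \<times> {0..<2 * pi}"

lemma strip_borel [measurable, simp]: "strip a l \<in> sets borel"
  by (simp add: strip_def)

lemma strip_subdivision:
  assumes [measurable]: "f \<in> borel_measurable borel" and n: "0 < n"
  shows "(\<integral>\<^sup>+z\<in>strip a l. f z \<partial>lborel)
    = (\<Sum>k<n. \<integral>\<^sup>+z\<in>{a..<a + l} \<times> {2 * pi / real n * real k..<2 * pi / real n * real k + 2 * pi / real n}. f z \<partial>lborel)"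
proof -
  let ?d = "2 * pi / real n"
  let ?B = "\<lambda>k. {a..<a + l} \<times> {?d * real k..<?d * real k + ?d}"
  have "indicator (strip a l) z = (\<Sum>k<n. indicator (?B k) z :: ennreal)" for z
    using indicator_subdivision[of ?d n "snd z"] n
    by (simp add: strip_def indicator_times sum_distrib_left)
  then have "(\<integral>\<^sup>+z\<in>strip a l. f z \<partial>lborel) = (\<integral>\<^sup>+z. (\<Sum>k<n. f z * indicator (?B k) z) \<partial>lborel)"
    by (simp add: sum_distrib_left)
  also have "\<dots> = (\<Sum>k<n. \<integral>\<^sup>+z. f z * indicator (?B k) z \<partial>lborel)"
    by (intro nn_integral_sum) measurable
  finally show ?thesis .
qed

lemma strip_halves:
  assumes [measurable]: "f \<in> borel_measurable borel" and h: "0 \<le> h"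
  shows "(\<integral>\<^sup>+z\<in>strip a (2 * h). f z \<partial>lborel) = (\<integral>\<^sup>+z\<in>strip a h. f z \<partial>lborel) + (\<integral>\<^sup>+z\<in>strip (a + h) h. f z \<partial>lborel)"
proof -
  have "f z * indicator (strip a (2 * h)) z = f z * indicator (strip a h) z + f z * indicator (strip (a + h) h) z" for z
    using h by (auto simp: strip_def indicator_def)
  then show ?thesis by (simp add: nn_integral_add)
qed

definition box_mean :: "(real \<times> real) set \<Rightarrow> (real \<times> real \<Rightarrow> complex) \<Rightarrow> complex" where
  "box_mean S U = (LINT z:S|lborel. U z) / of_real (measure lborel S)"

definition boxes :: "(real \<times> real) set set" where
  "boxes = {{a..<b} \<times> {c..<d} | a b c d. a < b \<and> c < d}"

locale cyl_weight =
  fixes W :: "real \<Rightarrow> ennreal"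
  assumes W_meas [measurable]: "W \<in> borel_measurable borel"
    and W_finite: "(\<integral>\<^sup>+t. W t \<partial>lborel) < \<infinity>"
begin

definition mass :: "real set \<Rightarrow> real" where
  "mass I = enn2real (\<integral>\<^sup>+t\<in>I. W t \<partial>lborel)"

lemma mass_nonneg [simp]: "0 \<le> mass I"
  by (simp add: mass_def)

lemma ennreal_mass: "ennreal (mass I) = (\<integral>\<^sup>+t\<in>I. W t \<partial>lborel)"
proof -
  have "(\<integral>\<^sup>+t\<in>I. W t \<partial>lborel) \<le> (\<integral>\<^sup>+t. W t \<partial>lborel)"
    by (intro nn_integral_mono) (simp add: indicator_def)
  then show ?thesis using W_finite by (simp add: mass_def ennreal_enn2real_if top_unique less_top)
qed

lemma mass_halves: "0 \<le> h \<Longrightarrow> mass {a..<a + 2 * h} = mass {a..<a + h} + mass {a + h..<a + h + h}"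
proof -
  assume h: "0 \<le> h"
  have "W t * indicator {a..<a + 2 * h} t = W t * indicator {a..<a + h} t + W t * indicator {a + h..<a + h + h} t" for t
    using h by (auto simp: indicator_def)
  then have "ennreal (mass {a..<a + 2 * h}) = ennreal (mass {a..<a + h} + mass {a + h..<a + h + h})"
    by (simp add: ennreal_mass ennreal_plus nn_integral_add)
  then show ?thesis by (subst (asm) ennreal_inj) (auto simp: add_nonneg_nonneg)
qed

text \<open>\<open>m\<close> stands for the mean over the cell, with which the functionals will
  force all box means to agree. Quantifying over the function makes the boxes depend on the weight
  alone, and the common \<open>m\<close> lets neighbouring strips be joined.\<close>

definition controls :: "real \<Rightarrow> (real \<times> real) set set \<Rightarrow> real \<Rightarrow> real \<Rightarrow> bool" where
  "controls c Bs a l \<longleftrightarrow> (\<forall>U Ut Uh m. cyl_fun U Ut Uh \<longrightarrow> (\<forall>b\<in>Bs. box_mean b U = m) \<longrightarrow>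
     (\<integral>\<^sup>+z\<in>strip a l. (W (fst z) * ennreal ((cmod (U z - m))\<^sup>2)) \<partial>lborel)
       \<le> ennreal (8 * pi\<^sup>2 * c) * cyl_fun.energy Ut Uh (strip a l))"

text \<open>As \<open>l\<close> is the reciprocal of an integer, exactly \<open>n\<close> boxes of
  angular width 2 pi l tile the circle, and on each of them the Poincare constant is 8 pi^2 times
  length times mass.\<close>

lemma leaf_boxes:
  assumes n: "0 < n" and l: "l = 1 / real n" and small: "l * mass {a..<a + l} \<le> c"
  defines "Bs \<equiv> (\<lambda>k. {a..<a + l} \<times> {2 * pi * l * real k..<2 * pi * l * real k + 2 * pi * l}) ` {..<n}"
  shows "controls c Bs a l"
  unfolding controls_def
proof (intro allI impI)
  fix U Ut Uh m
  assume "cyl_fun U Ut Uh" and mean: "\<forall>b\<in>Bs. box_mean b U = m"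
  interpret cyl_fun U Ut Uh by fact
  let ?B = "\<lambda>k. {a..<a + l} \<times> {2 * pi * l * real k..<2 * pi * l * real k + 2 * pi * l}"
  have l0: "0 < l" using n l by simp
  have d: "2 * pi / real n = 2 * pi * l" by (simp add: l)
  have box: "(\<integral>\<^sup>+z\<in>?B k. (W (fst z) * ennreal ((cmod (U z - m))\<^sup>2)) \<partial>lborel) \<le> ennreal (8 * pi\<^sup>2 * c) * energy (?B k)" if "k < n" for k
  proof -
    have "box_mean (?B k) U = m" using mean that by (auto simp: Bs_def)
    moreover have "measure lborel (?B k) = l * (2 * pi * l)"
      using emeasure_lborel_half_open_box[of a "a + l" "2 * pi * l * real k" "2 * pi * l * real k + 2 * pi * l"] l0
      by (simp add: measure_def)
    ultimately have "(LINT z:?B k|lborel. U z) = of_real (l * (2 * pi * l)) * m"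
      using l0 by (auto simp: box_mean_def field_simps)
    then have "(\<integral>\<^sup>+z\<in>?B k. (W (fst z) * ennreal ((cmod (U z - m))\<^sup>2)) \<partial>lborel)
        \<le> ennreal (8 * pi\<^sup>2 * l) * ennreal (mass {a..<a + l}) * energy (?B k)"
      unfolding ennreal_mass by (intro box_mean_weighted l0 W_meas refl)
    also have "ennreal (8 * pi\<^sup>2 * l) * ennreal (mass {a..<a + l}) \<le> ennreal (8 * pi\<^sup>2 * c)"
    proof -
      have "8 * pi\<^sup>2 * l * mass {a..<a + l} \<le> 8 * pi\<^sup>2 * c"
        using mult_left_mono[OF small, of "8 * pi\<^sup>2"] by (simp add: mult.assoc)
      then show ?thesis using l0 by (simp add: ennreal_leI flip: ennreal_mult)
    qed
    finally show ?thesis by (simp add: mult_right_mono)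
  qed
  have "(\<integral>\<^sup>+z\<in>strip a l. (W (fst z) * ennreal ((cmod (U z - m))\<^sup>2)) \<partial>lborel)
      \<le> (\<Sum>k<n. ennreal (8 * pi\<^sup>2 * c) * energy (?B k))"
    by (subst strip_subdivision[OF _ n]) (auto simp: d intro!: sum_mono box)
  also have "\<dots> = ennreal (8 * pi\<^sup>2 * c) * energy (strip a l)"
    unfolding energy_def by (subst strip_subdivision[OF _ n]) (auto simp: d sum_distrib_left)
  finally show "(\<integral>\<^sup>+z\<in>strip a l. (W (fst z) * ennreal ((cmod (U z - m))\<^sup>2)) \<partial>lborel)
      \<le> ennreal (8 * pi\<^sup>2 * c) * energy (strip a l)" .
qed

lemma controls_halves:
  assumes "controls c Bs a h" "controls c Bs' (a + h) h" "0 \<le> h"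
  shows "controls c (Bs \<union> Bs') a (2 * h)"
  unfolding controls_def
proof (intro allI impI)
  fix U Ut Uh m
  assume cyl: "cyl_fun U Ut Uh" and mean: "\<forall>b\<in>Bs \<union> Bs'. box_mean b U = m"
  interpret cyl_fun U Ut Uh by (rule cyl)
  have "(\<integral>\<^sup>+z\<in>strip a h. (W (fst z) * ennreal ((cmod (U z - m))\<^sup>2)) \<partial>lborel) \<le> ennreal (8 * pi\<^sup>2 * c) * energy (strip a h)"
    using assms(1) cyl mean by (auto simp: controls_def)
  moreover have "(\<integral>\<^sup>+z\<in>strip (a + h) h. (W (fst z) * ennreal ((cmod (U z - m))\<^sup>2)) \<partial>lborel) \<le> ennreal (8 * pi\<^sup>2 * c) * energy (strip (a + h) h)"
    using assms(2) cyl mean by (auto simp: controls_def)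
  moreover have "energy (strip a (2 * h)) = energy (strip a h) + energy (strip (a + h) h)"
    unfolding energy_def using assms(3) by (intro strip_halves) measurable
  ultimately show "(\<integral>\<^sup>+z\<in>strip a (2 * h). (W (fst z) * ennreal ((cmod (U z - m))\<^sup>2)) \<partial>lborel)
      \<le> ennreal (8 * pi\<^sup>2 * c) * energy (strip a (2 * h))"
    using assms(3) by (subst strip_halves) (auto simp: distrib_left intro!: add_mono)
qed

text \<open>An interval of length \<open>2\<^sup>-\<^sup>i\<close> that is split has \<open>2\<^sup>i < mass / c\<close>. The surplus \<open>2 \<cdot> 2\<^sup>i\<close> in the bound
  for split intervals absorbs the boxes of a sibling that is not split, which need not satisfy any
  lower bound on its mass.\<close>

lemma dyadic_boxes:
  assumes c: "0 < c" and "(1/2)^i * mass {a..<a + (1/2)^i} \<le> 2^n * c"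
  shows "\<exists>Bs. finite Bs \<and> Bs \<subseteq> boxes \<and> controls c Bs a ((1/2)^i) \<and>
    ((1/2)^i * mass {a..<a + (1/2)^i} \<le> c \<and> card Bs \<le> 2^i \<or>
     real (card Bs) + 2 * 2^i \<le> 6 / c * mass {a..<a + (1/2)^i})"
  using assms(2)
\<comment> \<open>\<open>n\<close> bounds the number of halvings still needed: length times mass
  drops at least by the factor 2 each time.\<close>
proof (induction n arbitrary: i a)
  have leaf: "\<exists>Bs. finite Bs \<and> Bs \<subseteq> boxes \<and> controls c Bs a ((1/2)^i) \<and> card Bs \<le> 2^i"
    if small: "(1/2)^i * mass {a..<a + (1/2)^i} \<le> c" for i a
  proof -
    let ?l = "(1/2::real)^i"
    let ?B = "(\<lambda>k. {a..<a + ?l} \<times> {2 * pi * ?l * real k..<2 * pi * ?l * real k + 2 * pi * ?l}) ` {..<2^i::nat}"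
    have "controls c ?B a ?l"
      using small by (intro leaf_boxes) (auto simp: power_divide)
    moreover have "?B \<subseteq> boxes" by (fastforce simp: boxes_def)
    moreover have "card ?B \<le> 2^i" using card_image_le[of "{..<2^i::nat}"] by fastforce
    ultimately show ?thesis by (intro exI[of _ ?B]) auto
  qed
  {
    case (0 i a)
    then show ?case using leaf[of i a] by auto
  next
    case (Suc n i a)
    let ?l = "(1/2::real)^i" and ?h = "(1/2::real)^Suc i"
    show ?case
    proof (cases "?l * mass {a..<a + ?l} \<le> c")
      case True
      then show ?thesis using leaf[of i a] by blast
    next
      case False
      have l: "?l = 2 * ?h" and h0: "0 \<le> ?h" by simp_all
      let ?m = "mass {a..<a + ?l}" and ?m1 = "mass {a..<a + ?h}" and ?m2 = "mass {a + ?h..<a + ?h + ?h}"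
      have m: "?m = ?m1 + ?m2" unfolding l by (rule mass_halves[OF h0])
      have "?h * ?m \<le> 2^n * c" using Suc.prems by simp
      moreover have "?h * ?m1 \<le> ?h * ?m" "?h * ?m2 \<le> ?h * ?m"
        by (intro mult_left_mono; simp add: m)+
      ultimately have "?h * ?m1 \<le> 2^n * c" "?h * ?m2 \<le> 2^n * c" by linarith+
      from Suc.IH[OF this(1)] Suc.IH[OF this(2)] obtain B1 B2 where
        B1: "finite B1" "B1 \<subseteq> boxes" "controls c B1 a ?h"
          "?h * ?m1 \<le> c \<and> card B1 \<le> 2^Suc i \<or> real (card B1) + 2 * 2^Suc i \<le> 6 / c * ?m1" and
        B2: "finite B2" "B2 \<subseteq> boxes" "controls c B2 (a + ?h) ?h"
          "?h * ?m2 \<le> c \<and> card B2 \<le> 2^Suc i \<or> real (card B2) + 2 * 2^Suc i \<le> 6 / c * ?m2"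
        by blast
      have "c < ?m / 2^i" using False by (simp add: power_divide)
      then have big: "2^i < ?m / c" using c by (simp add: field_simps)
      have mc: "6 / c * ?m = 6 / c * ?m1 + 6 / c * ?m2" by (simp add: m distrib_left)
      have nn: "0 \<le> 6 / c * ?m1" "0 \<le> 6 / c * ?m2" and p0: "0 \<le> (2::real)^i" using c by auto
      have leaf: "real k \<le> 2 * 2^i" if "k \<le> 2^Suc i" for k :: nat
        using that by (metis of_nat_le_iff of_nat_power of_nat_numeral power_Suc of_nat_mult)
      have "real (card (B1 \<union> B2)) \<le> real (card B1) + real (card B2)"
        by (metis card_Un_le of_nat_add of_nat_le_iff)
      moreover have "real (card B1) + real (card B2) + 2 * 2^i \<le> 6 / c * ?m"
        using B1(4) B2(4)
      proof (elim disjE conjE)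
        \<comment> \<open>Two unsplit halves have at most 4 * 2^i boxes; with the surplus this makes
          6 * 2^i, less than 6 / c times the mass because the parent was split. This is the origin
          of the factor 6.\<close>
        assume "card B1 \<le> 2^Suc i" "card B2 \<le> 2^Suc i"
        then show ?thesis using leaf[of "card B1"] leaf[of "card B2"] big by simp
      next
        assume "card B1 \<le> 2^Suc i" "real (card B2) + 2 * 2^Suc i \<le> 6 / c * ?m2"
        then show ?thesis using leaf[of "card B1"] nn mc by simp
      next
        assume "card B2 \<le> 2^Suc i" "real (card B1) + 2 * 2^Suc i \<le> 6 / c * ?m1"
        then show ?thesis using leaf[of "card B2"] nn mc by simp
      next
        assume "real (card B1) + 2 * 2^Suc i \<le> 6 / c * ?m1" "real (card B2) + 2 * 2^Suc i \<le> 6 / c * ?m2"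
        then show ?thesis unfolding mc power_Suc using p0 by linarith
      qed
      moreover have "controls c (B1 \<union> B2) a ?l"
        unfolding l by (intro controls_halves B1 B2 h0)
      ultimately show ?thesis using B1 B2 by (intro exI[of _ "B1 \<union> B2"]) auto
    qed
  }
qed

end

section \<open>A discrete Bargmann bound\<close>

lemma sum_le_nn_integral_count_space:
  fixes f :: "'a \<Rightarrow> ennreal"
  assumes "finite F"
  shows "(\<Sum>i\<in>F. f i) \<le> (\<integral>\<^sup>+i. f i \<partial>count_space UNIV)"
proof -
  have "(\<Sum>i\<in>F. f i) = (\<integral>\<^sup>+i. f i \<partial>count_space F)"
    by (simp add: nn_integral_count_space_finite assms)
  also have "\<dots> = (\<integral>\<^sup>+i. f i * indicator F i \<partial>count_space UNIV)"
    by (rule nn_integral_count_space_indicator) simp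
  also have "\<dots> \<le> (\<integral>\<^sup>+i. f i \<partial>count_space UNIV)"
    by (intro nn_integral_mono) (simp add: indicator_def)
  finally show ?thesis .
qed

text \<open>A group of integers may be infinite; this reduces its mass to finite subsets, which have
  a least and a greatest element.\<close>

lemma emeasure_le_of_finite_subsets:
  fixes A :: "int set"
  assumes sets: "sets N = UNIV" and le: "\<And>F. finite F \<Longrightarrow> F \<subseteq> A \<Longrightarrow> emeasure N F \<le> e"
  shows "emeasure N A \<le> e"
proof -
  let ?A = "\<lambda>k::nat. A \<inter> {- int k..int k}"
  have "(\<Union>k. ?A k) = A"
  proof -
    have "x \<in> (\<Union>k. ?A k)" if "x \<in> A" for x
      using that by (auto intro!: exI[of _ "nat \<bar>x\<bar>"])
    then show ?thesis by blast
  qed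
  moreover have "(SUP k. emeasure N (?A k)) = emeasure N (\<Union>k. ?A k)"
    by (rule SUP_emeasure_incseq) (auto simp: sets incseq_def)
  ultimately show ?thesis
    by (metis (no_types, lifting) SUP_least le finite_Int finite_atLeastAtMost_int inf_le1)
qed

text \<open>The number of integers on the path from \<open>n\<close> to 0, both ends included, and 1
  for n \<ge> 0. At radius about exp n it is the discrete counterpart of the logarithmic
  weight.\<close>

definition rho :: "int \<Rightarrow> real" where
  "rho n = 1 + of_int (max 0 (- n))"

text \<open>For negative \<open>n\<close> only increments of the cell means are controlled; from 0
  on the mean itself is, by the zero-order term that the field provides there.\<close>

definition step_energy :: "(int \<Rightarrow> complex) \<Rightarrow> int \<Rightarrow> real" where
  "step_energy m n = (if n < 0 then (cmod (m (n + 1) - m n))\<^sup>2 else (cmod (m n))\<^sup>2)"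

lemma step_energy_nonneg [simp]: "0 \<le> step_energy m n"
  by (simp add: step_energy_def)

text \<open>Telescoping to the right until the next point lies in \<open>S\<close>, where
  \<open>m\<close> vanishes, or until 0, where \<open>step_energy\<close> is the squared value.
  Steps that do not enter \<open>S\<close> keep \<open>g\<close> constant, so the path stays in the
  group of \<open>n\<close>.\<close>

lemma path_to_zero:
  fixes g :: "int \<Rightarrow> 'b"
  assumes S: "\<And>n. n \<in> S \<Longrightarrow> m n = 0" and g: "\<And>n. n \<notin> S \<Longrightarrow> g (n - 1) = g n"
  shows "\<exists>F. finite F \<and> real (card F) \<le> rho n \<and> (\<forall>i\<in>F. g i = g n) \<and> cmod (m n) \<le> (\<Sum>i\<in>F. sqrt (step_energy m i))"
proof (cases "0 \<le> n")
  case True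
  then show ?thesis
    by (intro exI[of _ "{n}"]) (auto simp: rho_def step_energy_def)
next
  case False
  have "\<exists>F. finite F \<and> F \<subseteq> {n..0} \<and> (\<forall>i\<in>F. g i = g n) \<and> cmod (m n) \<le> (\<Sum>i\<in>F. sqrt (step_energy m i))"
    if "n = - int k" for k n
    using that
  proof (induction k arbitrary: n)
    case 0
    then show ?case by (intro exI[of _ "{0}"]) (auto simp: step_energy_def)
  next
    case (Suc k)
    then have n: "n < 0" "n + 1 = - int k" by auto
    show ?case
    proof (cases "n + 1 \<in> S")
      case True
      then show ?thesis using n S[OF True]
        by (intro exI[of _ "{n}"]) (auto simp: step_energy_def)
    next
      case False
      obtain F where F: "finite F" "F \<subseteq> {n + 1..0}" "\<forall>i\<in>F. g i = g (n + 1)" "cmod (m (n + 1)) \<le> (\<Sum>i\<in>F. sqrt (step_energy m i))"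
        using Suc.IH[OF n(2)] by blast
      have "cmod (m n) \<le> cmod (m (n + 1) - m n) + cmod (m (n + 1))"
        using norm_triangle_ineq4[of "m (n + 1)" "m (n + 1) - m n"] by simp
      also have "\<dots> \<le> (\<Sum>i\<in>insert n F. sqrt (step_energy m i))"
        using F n by (subst sum.insert) (auto simp: step_energy_def)
      finally have le: "cmod (m n) \<le> (\<Sum>i\<in>insert n F. sqrt (step_energy m i))" .
      have gn: "g (n + 1) = g n" using g[OF False] by simp
      have "\<forall>i\<in>insert n F. g i = g n" using F(3) gn by simp
      moreover have "insert n F \<subseteq> {n..0}" using F(2) n by force
      ultimately show ?thesis using F(1) le by blast
    qed
  qed
  from this[of n "nat (- n)"] False obtain F where F: "finite F" "F \<subseteq> {n..0}"
    "\<forall>i\<in>F. g i = g n" "cmod (m n) \<le> (\<Sum>i\<in>F. sqrt (step_energy m i))" by auto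
  have "real (card F) \<le> rho n"
    using card_mono[OF _ F(2)] False by (auto simp: rho_def)
  with F show ?thesis by blast
qed

text \<open>The integers are grouped by \<open>g n = \<lfloor>M n / \<epsilon>\<rfloor>\<close>, where \<open>M n\<close> is the mass of \<open>{..n}\<close>. Every
  group carries mass at most \<open>\<epsilon>\<close> apart from its first element, and \<open>m\<close> is required to vanish at
  the first elements; so from every point a path inside its group leads either to a zero of \<open>m\<close> or to \<open>0\<close>,
  where \<open>step_energy\<close> controls \<open>m\<close> itself.\<close>

lemma discrete_bargmann:
  fixes v :: "int \<Rightarrow> real"
  assumes v: "\<And>n. 0 \<le> v n" and T: "(\<integral>\<^sup>+n. ennreal (v n * rho n) \<partial>count_space UNIV) \<le> ennreal T"
    and T0: "0 \<le> T" and eps: "0 < \<epsilon>"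
  shows "\<exists>S. finite S \<and> real (card S) \<le> T / \<epsilon> \<and> (\<forall>m. (\<forall>n\<in>S. m n = 0) \<longrightarrow>
    (\<integral>\<^sup>+n. ennreal (v n * (cmod (m n))\<^sup>2) \<partial>count_space UNIV)
      \<le> ennreal \<epsilon> * (\<integral>\<^sup>+n. ennreal (step_energy m n) \<partial>count_space UNIV))"
proof -
  define a where "a = (\<lambda>n. v n * rho n)"
  have rho: "1 \<le> rho n" for n by (simp add: rho_def)
  have a0: "0 \<le> a n" for n using v[of n] rho[of n] by (simp add: a_def)
  define N where "N = density (count_space UNIV) (\<lambda>n. ennreal (a n))"
  have N: "emeasure N A = (\<integral>\<^sup>+n\<in>A. ennreal (a n) \<partial>count_space UNIV)" for A
    unfolding N_def by (rule emeasure_density) auto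
  have sets [simp]: "sets N = UNIV" by (simp add: N_def)
  have space [simp]: "space N = UNIV" by (simp add: N_def)
  have NT: "emeasure N UNIV \<le> ennreal T" using T by (simp add: N a_def)
  interpret N: finite_measure N
    by (rule finite_measureI) (use NT in \<open>auto simp: top_unique\<close>)
  define g where "g = (\<lambda>n. \<lfloor>measure N {..n} / \<epsilon>\<rfloor>)"
  have mono: "g n \<le> g n'" if "n \<le> n'" for n n'
    unfolding g_def using that eps by (intro floor_mono divide_right_mono N.finite_measure_mono) auto
  define S where "S = {n. g (n - 1) < g n}"
  have gS: "g (n - 1) = g n" if "n \<notin> S" for n
    using that mono[of "n - 1" n] by (simp add: S_def)
  have "finite F \<longrightarrow> F \<subseteq> S \<longrightarrow> card F \<le> nat \<lfloor>T / \<epsilon>\<rfloor>" for F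
  proof (intro impI)
    assume F: "finite F" "F \<subseteq> S"
    have lt: "g n < g n'" if "n < n'" "n' \<in> F" for n n'
      using that F mono[of n "n' - 1"] by (auto simp: S_def)
    have "inj_on g F"
      by (intro inj_onI) (metis lt linorder_neqE less_irrefl)
    \<comment> \<open>The values start at 1 because \<open>g\<close> jumps up from a nonnegative
      value. Hence no additive constant: \<open>S\<close> is empty as soon as T <
      \<epsilon>.\<close>
    moreover have "g ` F \<subseteq> {1..\<lfloor>T / \<epsilon>\<rfloor>}"
    proof
      fix j assume "j \<in> g ` F"
      then obtain n where n: "n \<in> F" "j = g n" by auto
      have "0 \<le> g (n - 1)" using eps by (simp add: g_def)
      moreover have "g (n - 1) < g n" using n F by (auto simp: S_def)
      moreover have "measure N {..n} \<le> T"
        using emeasure_mono[of "{..n}" UNIV N] NT T0 by (auto simp: N.emeasure_eq_measure simp flip: ennreal_le_iff)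
      then have "g n \<le> \<lfloor>T / \<epsilon>\<rfloor>" unfolding g_def using eps by (intro floor_mono divide_right_mono) auto
      ultimately show "j \<in> {1..\<lfloor>T / \<epsilon>\<rfloor>}" using n by auto
    qed
    ultimately have "card F \<le> card {1..\<lfloor>T / \<epsilon>\<rfloor>}"
      by (metis card_image card_mono finite_atLeastAtMost_int)
    then show "card F \<le> nat \<lfloor>T / \<epsilon>\<rfloor>" by simp
  qed
  then have S: "finite S" "card S \<le> nat \<lfloor>T / \<epsilon>\<rfloor>"
    using finite_if_finite_subsets_card_bdd[of S "nat \<lfloor>T / \<epsilon>\<rfloor>"] by auto
  have cardS: "real (card S) \<le> T / \<epsilon>"
  proof -
    have "real (card S) \<le> real_of_int \<lfloor>T / \<epsilon>\<rfloor>" using S(2) T0 eps by (simp add: nat_le_iff le_nat_iff)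
    then show ?thesis using of_int_floor_le[of "T / \<epsilon>"] by linarith
  qed
  have group: "emeasure N {n. n \<notin> S \<and> g n = j} \<le> ennreal \<epsilon>" for j
  proof (rule emeasure_le_of_finite_subsets)
    fix F assume F: "finite F" "F \<subseteq> {n. n \<notin> S \<and> g n = j}"
    show "emeasure N F \<le> ennreal \<epsilon>"
    proof (cases "F = {}")
      case False
      define lo hi where "lo = Min F" and "hi = Max F"
      have lohi: "lo \<in> F" "hi \<in> F" "F \<subseteq> {lo..hi}" using F False by (auto simp: lo_def hi_def)
      \<comment> \<open>As \<open>lo\<close> is outside \<open>S\<close>, its predecessor already
        has level \<open>j\<close>. So the mass up to \<open>lo - 1\<close> is at least j
        \<epsilon>, while the mass up to \<open>hi\<close> is below (j + 1) \<epsilon>.\<close>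
      have "g (lo - 1) = j" "g hi = j" using lohi F gS[of lo] by auto
      then have 1: "j \<le> measure N {..lo - 1} / \<epsilon>" "measure N {..hi} / \<epsilon> < j + 1"
        unfolding g_def by linarith+
      then have 1: "j * \<epsilon> \<le> measure N {..lo - 1}" "measure N {..hi} < j * \<epsilon> + \<epsilon>"
        using eps by (simp_all add: field_simps)
      have "lo \<le> hi" using lohi by auto
      then have "{..hi} = {..lo - 1} \<union> {lo..hi}" by auto
      then have "measure N {..hi} = measure N {..lo - 1} + measure N {lo..hi}"
        by (simp only:) (rule N.finite_measure_Union; auto)
      moreover have "measure N F \<le> measure N {lo..hi}" using lohi by (intro N.finite_measure_mono) auto
      ultimately have "measure N F \<le> \<epsilon>" using 1 by linarith
      then show ?thesis by (simp add: N.emeasure_eq_measure ennreal_leI)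
    qed simp
  qed simp
  have "(\<integral>\<^sup>+n. ennreal (v n * (cmod (m n))\<^sup>2) \<partial>count_space UNIV)
      \<le> ennreal \<epsilon> * (\<integral>\<^sup>+n. ennreal (step_energy m n) \<partial>count_space UNIV)" if m: "\<forall>n\<in>S. m n = 0" for m
  proof -
    let ?e = "\<lambda>i. ennreal (step_energy m i)"
    \<comment> \<open>Cauchy-Schwarz along the path costs its number of points, at most
      \<open>rho n\<close>; this is why masses are measured with \<open>v n * rho n\<close>. The
      indicator records that the path stays in one group.\<close>
    have pt: "ennreal (v n * (cmod (m n))\<^sup>2) \<le> (\<integral>\<^sup>+i. ?e i * indicator {i. g i = g n} i * (ennreal (a n) * indicator {n. n \<notin> S} n) \<partial>count_space UNIV)" for n
    proof (cases "n \<in> S")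
      case True
      then show ?thesis using m by simp
    next
      case False
      obtain F where F: "finite F" "real (card F) \<le> rho n" "\<forall>i\<in>F. g i = g n" "cmod (m n) \<le> (\<Sum>i\<in>F. sqrt (step_energy m i))"
        using path_to_zero[of S m g n] m gS by blast
      have "(cmod (m n))\<^sup>2 \<le> (\<Sum>i\<in>F. sqrt (step_energy m i))\<^sup>2" using F(4) by (intro power_mono) auto
      also have "\<dots> \<le> (\<Sum>i\<in>F. (sqrt (step_energy m i))\<^sup>2) * real (card F)"
        using Cauchy_Schwarz_ineq_sum[of "\<lambda>i. sqrt (step_energy m i)" "\<lambda>_. 1" F] by simp
      also have "\<dots> \<le> (\<Sum>i\<in>F. step_energy m i) * rho n"
        using F(2) by (intro mult_mono) (auto intro: sum_nonneg)
      finally have "v n * (cmod (m n))\<^sup>2 \<le> v n * ((\<Sum>i\<in>F. step_energy m i) * rho n)"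
        using v by (intro mult_left_mono)
      also have "\<dots> = (\<Sum>i\<in>F. step_energy m i * a n)"
        by (simp add: a_def sum_distrib_right sum_distrib_left ac_simps)
      finally have "ennreal (v n * (cmod (m n))\<^sup>2) \<le> ennreal (\<Sum>i\<in>F. step_energy m i * a n)"
        by (rule ennreal_leI)
      also have "\<dots> = (\<Sum>i\<in>F. ?e i * indicator {i. g i = g n} i * (ennreal (a n) * indicator {n. n \<notin> S} n))"
        using F(3) False a0 by (subst sum_ennreal[symmetric]) (auto simp: ennreal_mult intro!: sum.cong)
      also have "\<dots> \<le> (\<integral>\<^sup>+i. ?e i * indicator {i. g i = g n} i * (ennreal (a n) * indicator {n. n \<notin> S} n) \<partial>count_space UNIV)"
        by (rule sum_le_nn_integral_count_space[OF F(1)])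
      finally show ?thesis .
    qed
    have "(\<integral>\<^sup>+n. ennreal (v n * (cmod (m n))\<^sup>2) \<partial>count_space UNIV)
      \<le> (\<integral>\<^sup>+n. (\<integral>\<^sup>+i. ?e i * indicator {i. g i = g n} i * (ennreal (a n) * indicator {n. n \<notin> S} n) \<partial>count_space UNIV) \<partial>count_space UNIV)"
      by (intro nn_integral_mono pt)
    \<comment> \<open>After the exchange, the inner sum for fixed \<open>i\<close> is the mass of
      the points outside \<open>S\<close> in the group of \<open>i\<close>, which is at most
      \<epsilon>.\<close>
    also have "\<dots> = (\<integral>\<^sup>+i. (\<integral>\<^sup>+n. ?e i * indicator {i. g i = g n} i * (ennreal (a n) * indicator {n. n \<notin> S} n) \<partial>count_space UNIV) \<partial>count_space UNIV)"
      by (rule nn_integral_count_space_nn_integral) auto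
    also have "\<dots> \<le> (\<integral>\<^sup>+i. ennreal \<epsilon> * ?e i \<partial>count_space UNIV)"
    proof (rule nn_integral_mono)
      fix i
      have "(\<integral>\<^sup>+n. ?e i * indicator {i. g i = g n} i * (ennreal (a n) * indicator {n. n \<notin> S} n) \<partial>count_space UNIV)
          = (\<integral>\<^sup>+n. ?e i * (ennreal (a n) * indicator {n. n \<notin> S \<and> g n = g i} n) \<partial>count_space UNIV)"
        by (intro nn_integral_cong) (auto simp: indicator_def)
      also have "\<dots> = ?e i * emeasure N {n. n \<notin> S \<and> g n = g i}"
        by (simp add: nn_integral_cmult N)
      also have "\<dots> \<le> ?e i * ennreal \<epsilon>" by (intro mult_left_mono group) simp
      finally show "(\<integral>\<^sup>+n. ?e i * indicator {i. g i = g n} i * (ennreal (a n) * indicator {n. n \<notin> S} n) \<partial>count_space UNIV) \<le> ennreal \<epsilon> * ?e i"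
        by (simp add: mult.commute)
    qed
    also have "\<dots> = ennreal \<epsilon> * (\<integral>\<^sup>+i. ?e i \<partial>count_space UNIV)"
      by (rule nn_integral_cmult) simp
    finally show ?thesis .
  qed
  then show ?thesis using S cardS by blast
qed

section \<open>Unit cells of the cylinder and the bound on the codimension\<close>

lemma nn_integral_split_count_space:
  fixes \<phi> :: "'a \<Rightarrow> int"
  assumes [measurable]: "f \<in> borel_measurable M" "\<phi> \<in> measurable M (count_space UNIV)"
  shows "(\<integral>\<^sup>+z. f z \<partial>M) = (\<integral>\<^sup>+n. (\<integral>\<^sup>+z. f z * indicator {z. \<phi> z = n} z \<partial>M) \<partial>count_space UNIV)"
proof -
  have "(\<integral>\<^sup>+z. f z \<partial>M) = (\<integral>\<^sup>+z. (\<integral>\<^sup>+n. f z * indicator {z. \<phi> z = n} z \<partial>count_space UNIV) \<partial>M)"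
  proof (rule nn_integral_cong)
    fix z
    have "(\<integral>\<^sup>+n. f z * indicator {z. \<phi> z = n} z \<partial>count_space UNIV) = (\<integral>\<^sup>+n. f z * indicator {\<phi> z} n \<partial>count_space UNIV)"
      by (intro nn_integral_cong) (auto simp: indicator_def)
    then show "f z = (\<integral>\<^sup>+n. f z * indicator {z. \<phi> z = n} z \<partial>count_space UNIV)"
      by (simp add: nn_integral_cmult_indicator)
  qed
  also have "\<dots> = (\<integral>\<^sup>+n. (\<integral>\<^sup>+z. f z * indicator {z. \<phi> z = n} z \<partial>M) \<partial>count_space UNIV)"
    by (rule nn_integral_count_space_nn_integral) (auto simp: indicator_def)
  finally show ?thesis .
qed

definition cylinder :: "(real \<times> real) set" where
  "cylinder = UNIV \<times> {0..<2 * pi}"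

lemma cylinder_borel [measurable, simp]: "cylinder \<in> sets borel"
  unfolding cylinder_def by (intro borel_Times) auto

abbreviation cell :: "int \<Rightarrow> (real \<times> real) set" where
  "cell n \<equiv> strip (of_int n) 1"

lemma nn_integral_cells:
  assumes [measurable]: "f \<in> borel_measurable borel"
  shows "(\<integral>\<^sup>+z\<in>cylinder. f z \<partial>lborel) = (\<integral>\<^sup>+n. (\<integral>\<^sup>+z\<in>cell n. f z \<partial>lborel) \<partial>count_space UNIV)"
proof -
  have "f z * indicator cylinder z * indicator {z. \<lfloor>fst z\<rfloor> = n} z = f z * indicator (cell n) z" for z n
    by (auto simp: indicator_def cylinder_def strip_def floor_eq_iff mem_Times_iff)
  moreover have "(\<lambda>z::real\<times>real. \<lfloor>fst z\<rfloor>) \<in> measurable lborel (count_space UNIV)" by measurable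
  ultimately show ?thesis
    using nn_integral_split_count_space[of "\<lambda>z. f z * indicator cylinder z" lborel "\<lambda>z. \<lfloor>fst z\<rfloor>"] by simp
qed

lemma nn_integral_unit_intervals:
  fixes f :: "real \<Rightarrow> ennreal"
  assumes [measurable]: "f \<in> borel_measurable borel"
  shows "(\<integral>\<^sup>+t. f t \<partial>lborel) = (\<integral>\<^sup>+n. (\<integral>\<^sup>+t\<in>{of_int n..<of_int n + 1}. f t \<partial>lborel) \<partial>count_space (UNIV :: int set))"
proof -
  have "f t * indicator {t. \<lfloor>t\<rfloor> = n} t = f t * indicator {of_int n..<of_int n + 1} t" for t n
    by (auto simp: indicator_def floor_eq_iff)
  moreover have "(\<lambda>t::real. \<lfloor>t\<rfloor>) \<in> measurable lborel (count_space UNIV)" by measurable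
  ultimately show ?thesis
    using nn_integral_split_count_space[of f lborel "\<lambda>t. \<lfloor>t\<rfloor>"] by simp
qed

lemma measure_cell: "measure lborel (cell n) = 2 * pi"
  using emeasure_lborel_half_open_box[of "of_int n" "of_int n + 1" 0 "2 * pi"] by (simp add: strip_def measure_def)

lemma emeasure_cell: "emeasure lborel (cell n) = ennreal (2 * pi)"
  using emeasure_lborel_half_open_box[of "of_int n" "of_int n + 1" 0 "2 * pi"] by (simp add: strip_def)

lemma set_integrable_boxes:
  fixes U :: "real \<times> real \<Rightarrow> complex"
  shows "continuous_on UNIV U \<Longrightarrow> b \<in> boxes \<Longrightarrow> set_integrable lborel b U"
  by (auto simp: boxes_def intro: set_integrable_half_open_box)

lemma box_mean_add:
  assumes "continuous_on UNIV U" "continuous_on UNIV V" "b \<in> boxes"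
  shows "box_mean b (\<lambda>z. U z + V z) = box_mean b U + box_mean b V"
  using assms by (simp add: box_mean_def set_integral_add set_integrable_boxes add_divide_distrib)

lemma box_mean_scale: "box_mean b (\<lambda>z. c * U z) = c * box_mean b U"
  by (simp add: box_mean_def)

lemma strip_in_boxes: "0 < l \<Longrightarrow> strip a l \<in> boxes"
  unfolding strip_def boxes_def using pi_gt_zero by fastforce

context cyl_fun
begin

lemma cell_integral: "(LINT z:cell n|lborel. U z) = of_real (2 * pi) * box_mean (cell n) U"
  unfolding box_mean_def measure_cell by simp

lemma cell_slice:
  assumes "t \<in> {of_int n..of_int n + 1}"
  shows "(\<integral>\<^sup>+x\<in>{0..<2 * pi}. ennreal ((cmod (U (t, x) - box_mean (cell n) U))\<^sup>2) \<partial>lborel)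
    \<le> ennreal (8 * pi\<^sup>2) * energy (cell n)"
  using box_mean_slice[of 1 "2 * pi" t "of_int n" 0 "box_mean (cell n) U"] assms cell_integral[of n]
  by (simp add: strip_def)

text \<open>Both means are compared with \<open>U\<close> on the common boundary circle
  \<open>t = n + 1\<close>. The slice estimate includes both ends of a cell for this
  purpose.\<close>

lemma cell_mean_step:
  "ennreal ((cmod (box_mean (cell (n + 1)) U - box_mean (cell n) U))\<^sup>2)
    \<le> ennreal (8 * pi) * (energy (cell n) + energy (cell (n + 1)))"
proof -
  let ?m = "\<lambda>n. box_mean (cell n) U" and ?t = "of_int (n + 1) :: real" and ?J = "{0..<2 * pi}"
  have "ennreal (2 * pi) * ennreal ((cmod (?m (n + 1) - ?m n))\<^sup>2) = (\<integral>\<^sup>+x\<in>?J. ennreal ((cmod (?m (n + 1) - ?m n))\<^sup>2) \<partial>lborel)"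
    by (subst nn_integral_cmult_indicator) (simp_all add: mult.commute)
  also have "\<dots> \<le> (\<integral>\<^sup>+x\<in>?J. (2 * ennreal ((cmod (U (?t, x) - ?m n))\<^sup>2) + 2 * ennreal ((cmod (U (?t, x) - ?m (n + 1)))\<^sup>2)) \<partial>lborel)"
  proof (intro nn_integral_mono mult_right_mono)
    fix x
    show "ennreal ((cmod (?m (n + 1) - ?m n))\<^sup>2) \<le> 2 * ennreal ((cmod (U (?t, x) - ?m n))\<^sup>2) + 2 * ennreal ((cmod (U (?t, x) - ?m (n + 1)))\<^sup>2)"
      using ennreal_cmod_add_sq[of "U (?t, x) - ?m n" "- (U (?t, x) - ?m (n + 1))"]
      by (simp only: norm_minus_cancel) simp
  qed simp
  also have "\<dots> = 2 * (\<integral>\<^sup>+x\<in>?J. ennreal ((cmod (U (?t, x) - ?m n))\<^sup>2) \<partial>lborel) + 2 * (\<integral>\<^sup>+x\<in>?J. ennreal ((cmod (U (?t, x) - ?m (n + 1)))\<^sup>2) \<partial>lborel)"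
    by (simp add: distrib_right mult.assoc nn_integral_add nn_integral_cmult)
  also have "\<dots> \<le> 2 * (ennreal (8 * pi\<^sup>2) * energy (cell n)) + 2 * (ennreal (8 * pi\<^sup>2) * energy (cell (n + 1)))"
    by (intro add_mono mult_left_mono cell_slice) auto
  also have "\<dots> = ennreal (2 * pi) * (ennreal (8 * pi) * (energy (cell n) + energy (cell (n + 1))))"
  proof -
    have e: "2 * ennreal (8 * pi\<^sup>2) = ennreal (2 * pi) * ennreal (8 * pi)"
    proof -
      have "2 * ennreal (8 * pi\<^sup>2) = ennreal 2 * ennreal (8 * pi\<^sup>2)" by simp
      also have "\<dots> = ennreal (2 * (8 * pi\<^sup>2))" by (rule ennreal_mult[symmetric]) auto
      also have "2 * (8 * pi\<^sup>2) = 2 * pi * (8 * pi)" by (simp add: power2_eq_square)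
      also have "ennreal (2 * pi * (8 * pi)) = ennreal (2 * pi) * ennreal (8 * pi)" by (rule ennreal_mult) auto
      finally show ?thesis .
    qed
    show ?thesis unfolding mult.assoc[symmetric] e by (simp only: mult.assoc distrib_left)
  qed
  finally show ?thesis
    by (subst (asm) ennreal_mult_le_mult_iff) (auto simp: ennreal_eq_0_iff not_le)
qed

lemma cell_mean_bound:
  "ennreal ((cmod (box_mean (cell n) U))\<^sup>2) \<le> (\<integral>\<^sup>+z\<in>cell n. ennreal ((cmod (U z))\<^sup>2) \<partial>lborel)"
proof -
  let ?m = "box_mean (cell n) U"
  have "ennreal ((cmod (of_real (2 * pi) * ?m))\<^sup>2) \<le> emeasure lborel (cell n) * (\<integral>\<^sup>+z\<in>cell n. ennreal ((cmod (U z))\<^sup>2) \<partial>lborel)"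
    unfolding cell_integral[symmetric] by (rule set_integral_Cauchy_Schwarz) simp_all
  also have "ennreal ((cmod (of_real (2 * pi) * ?m))\<^sup>2) = ennreal (2 * pi) * ennreal (2 * pi * (cmod ?m)\<^sup>2)"
    by (subst ennreal_mult[symmetric]) (auto simp: norm_mult power_mult_distrib power2_eq_square)
  finally have "ennreal (2 * pi * (cmod ?m)\<^sup>2) \<le> (\<integral>\<^sup>+z\<in>cell n. ennreal ((cmod (U z))\<^sup>2) \<partial>lborel)"
    unfolding emeasure_cell by (subst (asm) ennreal_mult_le_mult_iff) (auto simp: ennreal_eq_0_iff not_le)
  moreover have "(cmod ?m)\<^sup>2 \<le> 2 * pi * (cmod ?m)\<^sup>2"
    using mult_right_mono[of 1 "2 * pi" "(cmod ?m)\<^sup>2"] pi_gt3 by simp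
  ultimately show ?thesis by (meson ennreal_leI order_trans)
qed

definition outer_mass :: ennreal where
  "outer_mass = (\<integral>\<^sup>+z\<in>cylinder. (ennreal ((cmod (U z))\<^sup>2) * indicator {0..} (fst z)) \<partial>lborel)"

text \<open>Every cell occurs as a left and as a right neighbour, which doubles 8 pi. For n \<ge> 0
  the squared mean is bounded by the integral of |U|^2 over the cell.\<close>

lemma sum_step_energy:
  "(\<integral>\<^sup>+n. ennreal (step_energy (\<lambda>n. box_mean (cell n) U) n) \<partial>count_space UNIV)
    \<le> ennreal (16 * pi) * energy cylinder + outer_mass"
proof -
  let ?m = "\<lambda>n. box_mean (cell n) U"
  let ?o = "\<lambda>n::int. \<integral>\<^sup>+z\<in>cell n. (ennreal ((cmod (U z))\<^sup>2) * indicator {0..} (fst z)) \<partial>lborel"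
  have pt: "ennreal (step_energy ?m n) \<le> ennreal (8 * pi) * (energy (cell n) + energy (cell (n + 1))) + ?o n" for n
  proof (cases "n < 0")
    case True
    then show ?thesis using cell_mean_step[of n] by (simp add: step_energy_def add_increasing2)
  next
    case False
    have "indicator (cell n) z = (indicator {0..} (fst z) * indicator (cell n) z :: ennreal)" for z
      using False by (auto simp: indicator_def strip_def)
    then have "?o n = (\<integral>\<^sup>+z\<in>cell n. ennreal ((cmod (U z))\<^sup>2) \<partial>lborel)"
      by (metis (no_types, lifting) mult.assoc)
    then show ?thesis using cell_mean_bound[of n] False by (simp add: step_energy_def add_increasing)
  qed
  have E: "(\<integral>\<^sup>+n. energy (cell n) \<partial>count_space UNIV) = energy cylinder"
    unfolding energy_def by (subst nn_integral_cells) auto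
  have E': "(\<integral>\<^sup>+n. energy (cell (n + 1)) \<partial>count_space UNIV) = energy cylinder"
  proof -
    have "bij_betw (\<lambda>n::int. n + 1) UNIV UNIV" by (rule bij_betwI[of _ _ _ "\<lambda>n. n - 1"]) auto
    from nn_integral_bij_count_space[OF this, of "\<lambda>n. energy (cell n)"] show ?thesis by (simp add: E)
  qed
  have "(\<integral>\<^sup>+n. ennreal (step_energy ?m n) \<partial>count_space UNIV)
      \<le> (\<integral>\<^sup>+n. (ennreal (8 * pi) * (energy (cell n) + energy (cell (n + 1))) + ?o n) \<partial>count_space UNIV)"
    by (intro nn_integral_mono pt)
  also have "\<dots> = ennreal (8 * pi) * (energy cylinder + energy cylinder) + (\<integral>\<^sup>+n. ?o n \<partial>count_space UNIV)"
    by (subst nn_integral_add; simp add: nn_integral_cmult)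
      (subst nn_integral_add; simp add: E E'[simplified])
  also have "(\<integral>\<^sup>+n. ?o n \<partial>count_space UNIV) = outer_mass"
    unfolding outer_mass_def by (subst nn_integral_cells) auto
  also have "ennreal (8 * pi) * (energy cylinder + energy cylinder) = ennreal (16 * pi) * energy cylinder"
  proof -
    have "ennreal (8 * pi) + ennreal (8 * pi) = ennreal (16 * pi)" by (subst ennreal_plus[symmetric]) auto
    then show ?thesis by (simp add: distrib_left flip: distrib_right)
  qed
  finally show ?thesis .
qed

end

text \<open>A point of the cell \<open>n\<close> has t < n + 1, so the summand 2, rather than 1,
  makes the weight dominate \<open>rho n\<close> on the whole cell.\<close>

locale cyl_potential = cyl_weight W for W +
  fixes w :: "real \<times> real \<Rightarrow> ennreal" and T :: real
  assumes w_meas [measurable]: "w \<in> borel_measurable borel"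
    and w_le: "AE z in lborel. z \<in> cylinder \<longrightarrow> w z \<le> W (fst z)"
    and w_T: "(\<integral>\<^sup>+z\<in>cylinder. (w z * ennreal (2 + max 0 (- fst z))) \<partial>lborel) \<le> ennreal T"
    and T_nonneg: "0 \<le> T"
begin

text \<open>A light cell serves as its own only box, and comparing it with itself needs no
  functional. Only heavy cells are subdivided, so the number of extra boxes is proportional to the
  mass with no constant per cell.\<close>

lemma cell_boxes:
  assumes c: "0 < c"
  shows "\<exists>Bs. finite Bs \<and> Bs \<subseteq> boxes \<and> controls c (insert (cell n) Bs) (of_int n) 1 \<and>
    real (card Bs) \<le> 6 / c * mass {of_int n..<of_int n + 1}"
proof (cases "mass {of_int n..<of_int n + 1} \<le> c")
  case True
  have "controls c {cell n} (of_int n) 1"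
    using leaf_boxes[of 1 1 "of_int n" c] True by (simp add: strip_def lessThan_Suc)
  then show ?thesis using c by (intro exI[of _ "{}"]) auto
next
  case False
  obtain k where "mass {of_int n..<of_int n + 1} / c < 2 ^ k"
    using real_arch_pow[of 2] by auto
  then have "mass {of_int n..<of_int n + 1} \<le> 2 ^ k * c" using c by (simp add: field_simps)
  then obtain Bs where Bs: "finite Bs" "Bs \<subseteq> boxes" "controls c Bs (of_int n) 1"
    "real (card Bs) + 2 \<le> 6 / c * mass {of_int n..<of_int n + 1}"
    using dyadic_boxes[OF c, of 0 "of_int n" k] False by auto
  moreover have "controls c (insert (cell n) Bs) (of_int n) 1"
    using Bs(3) by (simp add: controls_def)
  ultimately show ?thesis by (intro exI[of _ Bs]) auto
qed

lemma mass_cells: "finite F \<Longrightarrow> (\<Sum>n\<in>F. mass {of_int n..<of_int n + 1}) \<le> mass UNIV"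
proof -
  assume F: "finite F"
  have "ennreal (\<Sum>n\<in>F. mass {of_int n..<of_int n + 1}) = (\<Sum>n\<in>F. \<integral>\<^sup>+t\<in>{of_int n..<of_int n + 1}. W t \<partial>lborel)"
    by (subst sum_ennreal[symmetric]) (auto simp: ennreal_mass)
  also have "\<dots> \<le> (\<integral>\<^sup>+t. W t \<partial>lborel)"
    by (subst nn_integral_unit_intervals[OF W_meas]) (rule sum_le_nn_integral_count_space[OF F])
  also have "\<dots> = ennreal (mass UNIV)" using ennreal_mass[of UNIV] by simp
  finally show ?thesis by (simp add: ennreal_le_iff)
qed

definition cell_mass :: "int \<Rightarrow> real" where
  "cell_mass n = enn2real (\<integral>\<^sup>+z\<in>cell n. w z \<partial>lborel)"

lemma cell_mass_nonneg [simp]: "0 \<le> cell_mass n"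
  by (simp add: cell_mass_def)

lemma weighted_cell_le:
  "(\<integral>\<^sup>+z\<in>cell n. w z \<partial>lborel) * ennreal (rho n) \<le> (\<integral>\<^sup>+z\<in>cell n. (w z * ennreal (2 + max 0 (- fst z))) \<partial>lborel)"
proof -
  have "(\<integral>\<^sup>+z\<in>cell n. w z \<partial>lborel) * ennreal (rho n) = (\<integral>\<^sup>+z. w z * indicator (cell n) z * ennreal (rho n) \<partial>lborel)"
    by (rule nn_integral_multc[symmetric]) measurable
  also have "\<dots> \<le> (\<integral>\<^sup>+z\<in>cell n. (w z * ennreal (2 + max 0 (- fst z))) \<partial>lborel)"
  proof (rule nn_integral_mono)
    fix z
    show "w z * indicator (cell n) z * ennreal (rho n) \<le> w z * ennreal (2 + max 0 (- fst z)) * indicator (cell n) z"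
    proof (cases "z \<in> cell n")
      case True
      then have "rho n \<le> 2 + max 0 (- fst z)" by (auto simp: rho_def strip_def)
      then have "w z * ennreal (rho n) \<le> w z * ennreal (2 + max 0 (- fst z))"
        by (intro mult_left_mono ennreal_leI) auto
      then show ?thesis using True by (simp del: ennreal_plus)
    qed simp
  qed
  finally show ?thesis .
qed

lemma sum_weighted_cells:
  "(\<integral>\<^sup>+n. (\<integral>\<^sup>+z\<in>cell n. (w z * ennreal (2 + max 0 (- fst z))) \<partial>lborel) \<partial>count_space UNIV) \<le> ennreal T"
  using w_T by (subst nn_integral_cells[symmetric]) simp_all

lemma ennreal_cell_mass: "ennreal (cell_mass n) = (\<integral>\<^sup>+z\<in>cell n. w z \<partial>lborel)"
proof -
  have "(\<integral>\<^sup>+z\<in>cell n. w z \<partial>lborel) \<le> (\<integral>\<^sup>+z\<in>cell n. w z \<partial>lborel) * ennreal (rho n)"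
  proof -
    have "1 \<le> ennreal (rho n)" by (simp add: rho_def)
    from mult_left_mono[OF this] show ?thesis by fastforce
  qed
  also have "\<dots> \<le> (\<integral>\<^sup>+z\<in>cell n. (w z * ennreal (2 + max 0 (- fst z))) \<partial>lborel)"
    by (rule weighted_cell_le)
  also have "\<dots> \<le> ennreal T"
    using sum_le_nn_integral_count_space[of "{n}" "\<lambda>n. \<integral>\<^sup>+z\<in>cell n. (w z * ennreal (2 + max 0 (- fst z))) \<partial>lborel"]
      sum_weighted_cells by simp
  finally show ?thesis by (auto simp: cell_mass_def ennreal_enn2real_if top_unique)
qed

text \<open>On each cell w |U|^2 is at most 2 w |U - m|^2 + 2 w |m|^2 with \<open>m\<close> the cell
  mean. The box functionals absorb the first part into half of the energy; the zeros of the cell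
  means absorb the second into the other half and the outer mass.\<close>

theorem finite_codimension_bound:
  "\<exists>L :: ((real \<times> real \<Rightarrow> complex) \<Rightarrow> complex) set.
     finite L \<and> real (card L) \<le> 192 * pi\<^sup>2 * (mass UNIV + T) \<and>
     (\<forall>\<Lambda>\<in>L. (\<forall>U V. continuous_on UNIV U \<longrightarrow> continuous_on UNIV V \<longrightarrow> \<Lambda> (\<lambda>z. U z + V z) = \<Lambda> U + \<Lambda> V)
        \<and> (\<forall>c U. \<Lambda> (\<lambda>z. c * U z) = c * \<Lambda> U)) \<and>
     (\<forall>U Ut Uh. cyl_fun U Ut Uh \<longrightarrow> (\<forall>\<Lambda>\<in>L. \<Lambda> U = 0) \<longrightarrow>
        (\<integral>\<^sup>+z\<in>cylinder. (w z * ennreal ((cmod (U z))\<^sup>2)) \<partial>lborel)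
          \<le> cyl_fun.energy Ut Uh cylinder + cyl_fun.outer_mass U)"
proof -
  \<comment> \<open>Chosen so that 2 * 8 pi^2 * c = 1/2 and 2 * \<epsilon> * 16 pi = 1/2. Then 6 / c
    = 192 pi^2, which also dominates 1 / \<epsilon> = 64 pi.\<close>
  define c where "c = 1 / (32 * pi\<^sup>2)"
  define \<epsilon> where "\<epsilon> = 1 / (64 * pi)"
  have c: "0 < c" and eps: "0 < \<epsilon>" by (simp_all add: c_def \<epsilon>_def)
  obtain Bs where Bs: "\<And>n. finite (Bs n)" "\<And>n. Bs n \<subseteq> boxes"
    "\<And>n. controls c (insert (cell n) (Bs n)) (of_int n) 1"
    "\<And>n. real (card (Bs n)) \<le> 6 / c * mass {of_int n..<of_int n + 1}"
    using cell_boxes[OF c] by metis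
  have card_F: "(\<Sum>n\<in>F. real (card (Bs n))) \<le> 6 / c * mass UNIV" if "finite F" for F
  proof -
    have "(\<Sum>n\<in>F. real (card (Bs n))) \<le> (\<Sum>n\<in>F. 6 / c * mass {of_int n..<of_int n + 1})"
      by (intro sum_mono Bs)
    also have "\<dots> \<le> 6 / c * mass UNIV"
      unfolding sum_distrib_left[symmetric] using c by (intro mult_left_mono mass_cells that) auto
    finally show ?thesis .
  qed
  \<comment> \<open>The cells that need extra boxes. Each contributes at least one box to a sum
    bounded by the total mass, so there are finitely many.\<close>
  define X where "X = {n. Bs n \<noteq> {}}"
  have "finite X"
  proof -
    have "card F \<le> nat \<lceil>6 / c * mass UNIV\<rceil>" if "F \<subseteq> X" "finite F" for F
    proof -
      have "real (card F) = (\<Sum>n\<in>F. 1)" by simp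
      also have "\<dots> \<le> (\<Sum>n\<in>F. real (card (Bs n)))"
        using that Bs(1) by (intro sum_mono) (auto simp: X_def card_gt_0_iff Suc_le_eq subset_iff)
      finally have "real (card F) \<le> 6 / c * mass UNIV" using card_F[OF that(2)] by linarith
      then show ?thesis by linarith
    qed
    then show ?thesis using finite_if_finite_subsets_card_bdd[of X] by blast
  qed
  have "(\<integral>\<^sup>+n. ennreal (cell_mass n * rho n) \<partial>count_space UNIV) \<le> ennreal T"
  proof -
    have "ennreal (cell_mass n * rho n) = (\<integral>\<^sup>+z\<in>cell n. w z \<partial>lborel) * ennreal (rho n)" for n
      by (subst ennreal_mult) (auto simp: ennreal_cell_mass rho_def)
    then show ?thesis
      using nn_integral_mono[OF weighted_cell_le, of "count_space UNIV" "\<lambda>n. n"] sum_weighted_cells by simp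
  qed
  then obtain S where S: "finite S" "real (card S) \<le> T / \<epsilon>" and S_bound: "\<And>m. (\<forall>n\<in>S. m n = 0) \<Longrightarrow>
    (\<integral>\<^sup>+n. ennreal (cell_mass n * (cmod (m n))\<^sup>2) \<partial>count_space UNIV)
      \<le> ennreal \<epsilon> * (\<integral>\<^sup>+n. ennreal (step_energy m n) \<partial>count_space UNIV)"
    using discrete_bargmann[of cell_mass T \<epsilon>] T_nonneg eps by (auto simp: cell_mass_def)
  define P where "P = (SIGMA n:X. Bs n)"
  have P: "finite P" "real (card P) \<le> 6 / c * mass UNIV"
    using \<open>finite X\<close> Bs(1) card_F[OF \<open>finite X\<close>] by (auto simp: P_def card_SigmaI)
  \<comment> \<open>Box means are compared with the cell mean instead of being set to zero, since
    annihilating every cell mean would cost a functional per cell. The cell means themselves are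
    annihilated only at the points of \<open>S\<close>.\<close>
  define L :: "((real \<times> real \<Rightarrow> complex) \<Rightarrow> complex) set" where
    "L = (\<lambda>(n, b) U. box_mean b U - box_mean (cell n) U) ` P \<union> (\<lambda>n U. box_mean (cell n) U) ` S"
  have "finite L" using P S by (simp add: L_def)
  moreover have "real (card L) \<le> 192 * pi\<^sup>2 * (mass UNIV + T)"
  proof -
    have "card L \<le> card P + card S"
      unfolding L_def by (rule order_trans[OF card_Un_le]) (intro add_mono card_image_le P S)
    then have "real (card L) \<le> 6 / c * mass UNIV + T / \<epsilon>" using P S by linarith
    also have "\<dots> = 192 * pi\<^sup>2 * mass UNIV + 64 * pi * T" by (simp add: c_def \<epsilon>_def)
    also have "64 * pi * T \<le> 192 * pi\<^sup>2 * T"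
    proof (rule mult_right_mono)
      show "64 * pi \<le> 192 * pi\<^sup>2" using pi_gt3 by (simp add: power2_eq_square)
    qed (rule T_nonneg)
    finally show ?thesis by (simp add: distrib_left)
  qed
  moreover have "\<Lambda> (\<lambda>z. U z + V z) = \<Lambda> U + \<Lambda> V" if "\<Lambda> \<in> L" "continuous_on UNIV U" "continuous_on UNIV V" for \<Lambda> U V
  proof -
    have add: "box_mean b (\<lambda>z. U z + V z) = box_mean b U + box_mean b V" if "b \<in> boxes" for b
      by (rule box_mean_add) fact+
    have cell: "cell n \<in> boxes" for n by (simp add: strip_in_boxes)
    have "b \<in> boxes" if "(n, b) \<in> P" for n b using that Bs(2) by (auto simp: P_def)
    then show ?thesis using \<open>\<Lambda> \<in> L\<close> unfolding L_def by (auto simp: add cell)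
  qed
  moreover have "\<Lambda> (\<lambda>z. k * U z) = k * \<Lambda> U" if "\<Lambda> \<in> L" for \<Lambda> k U
    using that by (auto simp: L_def box_mean_scale right_diff_distrib)
  moreover have "(\<integral>\<^sup>+z\<in>cylinder. (w z * ennreal ((cmod (U z))\<^sup>2)) \<partial>lborel)
      \<le> cyl_fun.energy Ut Uh cylinder + cyl_fun.outer_mass U"
    if cyl: "cyl_fun U Ut Uh" and zero: "\<forall>\<Lambda>\<in>L. \<Lambda> U = 0" for U Ut Uh
  proof -
    interpret cyl_fun U Ut Uh by (rule cyl)
    define m where "m = (\<lambda>n. box_mean (cell n) U)"
    have mS: "\<forall>n\<in>S. m n = 0" using zero by (auto simp: L_def m_def)
    have mB: "\<forall>b\<in>insert (cell n) (Bs n). box_mean b U = m n" for n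
    proof
      fix b assume "b \<in> insert (cell n) (Bs n)"
      then consider "b = cell n" | "(n, b) \<in> P" by (auto simp: P_def X_def)
      then show "box_mean b U = m n"
      proof cases
        case 2
        then have "(\<lambda>U. box_mean b U - box_mean (cell n) U) \<in> L" unfolding L_def by force
        with zero show ?thesis by (auto simp: m_def)
      qed (simp add: m_def)
    qed
    \<comment> \<open>\<open>W\<close> replaces \<open>w\<close> only in the oscillating part, where
      the weight must depend on \<open>t\<close> alone. The mean part keeps \<open>w\<close>, whose
      weighted integral is bounded by \<open>T\<close>.\<close>
    have cell: "(\<integral>\<^sup>+z\<in>cell n. (w z * ennreal ((cmod (U z))\<^sup>2)) \<partial>lborel)
        \<le> ennreal (1 / 2) * energy (cell n) + 2 * ennreal (cell_mass n * (cmod (m n))\<^sup>2)" for n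
    proof -
      have sub: "cell n \<subseteq> cylinder" by (auto simp: strip_def cylinder_def)
      have "(\<integral>\<^sup>+z\<in>cell n. (w z * ennreal ((cmod (U z))\<^sup>2)) \<partial>lborel)
          \<le> (\<integral>\<^sup>+z. (2 * (W (fst z) * ennreal ((cmod (U z - m n))\<^sup>2) * indicator (cell n) z)
              + w z * indicator (cell n) z * (2 * ennreal ((cmod (m n))\<^sup>2))) \<partial>lborel)"
      proof (rule nn_integral_mono_AE)
        show "AE z in lborel. w z * ennreal ((cmod (U z))\<^sup>2) * indicator (cell n) z
            \<le> 2 * (W (fst z) * ennreal ((cmod (U z - m n))\<^sup>2) * indicator (cell n) z)
              + w z * indicator (cell n) z * (2 * ennreal ((cmod (m n))\<^sup>2))"
          using w_le
        proof eventually_elim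
          case (elim z)
          show ?case
          proof (cases "z \<in> cell n")
            case True
            then have le: "w z \<le> W (fst z)" using elim sub by auto
            have "w z * ennreal ((cmod (U z))\<^sup>2) \<le> w z * (2 * ennreal ((cmod (U z - m n))\<^sup>2) + 2 * ennreal ((cmod (m n))\<^sup>2))"
              using ennreal_cmod_add_sq[of "U z - m n" "m n"] by (intro mult_left_mono) auto
            also have "\<dots> = w z * (2 * ennreal ((cmod (U z - m n))\<^sup>2)) + w z * (2 * ennreal ((cmod (m n))\<^sup>2))"
              by (rule distrib_left)
            also have "\<dots> \<le> W (fst z) * (2 * ennreal ((cmod (U z - m n))\<^sup>2)) + w z * (2 * ennreal ((cmod (m n))\<^sup>2))"
              by (intro add_right_mono mult_right_mono le) simp
            finally show ?thesis using True by (simp add: ac_simps)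
          qed simp
        qed
      qed
      also have "\<dots> = 2 * (\<integral>\<^sup>+z\<in>cell n. (W (fst z) * ennreal ((cmod (U z - m n))\<^sup>2)) \<partial>lborel)
          + (\<integral>\<^sup>+z\<in>cell n. w z \<partial>lborel) * (2 * ennreal ((cmod (m n))\<^sup>2))"
        by (subst nn_integral_add) (simp_all add: nn_integral_cmult nn_integral_multc)
      also have "(\<integral>\<^sup>+z\<in>cell n. (W (fst z) * ennreal ((cmod (U z - m n))\<^sup>2)) \<partial>lborel) \<le> ennreal (8 * pi\<^sup>2 * c) * energy (cell n)"
        using Bs(3)[of n, unfolded controls_def] cyl mB by blast
      also have "2 * (ennreal (8 * pi\<^sup>2 * c) * energy (cell n)) = ennreal (1 / 2) * energy (cell n)"
      proof -
        have "2 * ennreal (8 * pi\<^sup>2 * c) = ennreal (1 / 2)"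
        proof -
          have "2 * ennreal (8 * pi\<^sup>2 * c) = ennreal 2 * ennreal (8 * pi\<^sup>2 * c)" by simp
          also have "\<dots> = ennreal (2 * (8 * pi\<^sup>2 * c))" using c by (intro ennreal_mult[symmetric]) auto
          also have "2 * (8 * pi\<^sup>2 * c) = 1 / 2" by (simp add: c_def)
          finally show ?thesis .
        qed
        then show ?thesis by (simp only: mult.assoc[symmetric])
      qed
      also have "(\<integral>\<^sup>+z\<in>cell n. w z \<partial>lborel) * (2 * ennreal ((cmod (m n))\<^sup>2)) = 2 * ennreal (cell_mass n * (cmod (m n))\<^sup>2)"
        by (subst ennreal_mult) (auto simp: ennreal_cell_mass ac_simps)
      finally show ?thesis by (simp add: mult_left_mono)
    qed
    have "(\<integral>\<^sup>+z\<in>cylinder. (w z * ennreal ((cmod (U z))\<^sup>2)) \<partial>lborel)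
        = (\<integral>\<^sup>+n. (\<integral>\<^sup>+z\<in>cell n. (w z * ennreal ((cmod (U z))\<^sup>2)) \<partial>lborel) \<partial>count_space UNIV)"
      by (rule nn_integral_cells) measurable
    also have "\<dots> \<le> (\<integral>\<^sup>+n. (ennreal (1 / 2) * energy (cell n) + 2 * ennreal (cell_mass n * (cmod (m n))\<^sup>2)) \<partial>count_space UNIV)"
      by (intro nn_integral_mono cell)
    also have "\<dots> = ennreal (1 / 2) * (\<integral>\<^sup>+n. energy (cell n) \<partial>count_space UNIV)
        + 2 * (\<integral>\<^sup>+n. ennreal (cell_mass n * (cmod (m n))\<^sup>2) \<partial>count_space UNIV)"
      by (subst nn_integral_add) (simp_all add: nn_integral_cmult)
    also have "(\<integral>\<^sup>+n. energy (cell n) \<partial>count_space UNIV) = energy cylinder"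
      unfolding energy_def by (subst nn_integral_cells) auto
    also have "2 * (\<integral>\<^sup>+n. ennreal (cell_mass n * (cmod (m n))\<^sup>2) \<partial>count_space UNIV)
        \<le> 2 * (ennreal \<epsilon> * (ennreal (16 * pi) * energy cylinder + outer_mass))"
      by (intro mult_left_mono order_trans[OF S_bound[OF mS] mult_left_mono[OF sum_step_energy[folded m_def]]]) auto
    also have "2 * (ennreal \<epsilon> * (ennreal (16 * pi) * energy cylinder + outer_mass)) \<le> ennreal (1 / 2) * energy cylinder + outer_mass"
    proof -
      have 1: "2 * ennreal \<epsilon> = ennreal (1 / (32 * pi))"
        by (simp add: \<epsilon>_def flip: ennreal_numeral ennreal_mult)
      have 2: "ennreal (1 / (32 * pi)) * ennreal (16 * pi) = ennreal (1 / 2)"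
        by (subst ennreal_mult[symmetric]) auto
      have 3: "ennreal (1 / (32 * pi)) * outer_mass \<le> 1 * outer_mass"
        using pi_gt3 by (intro mult_right_mono) auto
      show ?thesis
        unfolding mult.assoc[symmetric] 1 distrib_left 2 using 3 by (simp add: add_left_mono)
    qed
    also have "ennreal (1 / 2) * energy cylinder + (ennreal (1 / 2) * energy cylinder + outer_mass) = energy cylinder + outer_mass"
    proof -
      have "ennreal (1 / 2) + ennreal (1 / 2) = 1" by (subst ennreal_plus[symmetric]) auto
      then show ?thesis by (metis add.assoc distrib_right mult_1)
    qed
    finally show ?thesis by (simp add: add_left_mono)
  qed
  ultimately show ?thesis by blast
qed

end

section \<open>Logarithmic polar coordinates\<close>

definition pol :: "real \<times> real \<Rightarrow> real^2" where
  "pol z = vector [exp (fst z) * cos (snd z), exp (fst z) * sin (snd z)]"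

lemma vector_2_axis: "(vector [a, b] :: real^2) = a *\<^sub>R axis 1 1 + b *\<^sub>R axis 2 1"
  by (simp add: vec_eq_iff forall_2 axis_def)

lemma pol_axis: "pol z = (exp (fst z) * cos (snd z)) *\<^sub>R axis 1 1 + (exp (fst z) * sin (snd z)) *\<^sub>R axis 2 1"
  by (simp add: pol_def vector_2_axis)

lemma continuous_on_pol: "continuous_on UNIV pol"
  unfolding pol_axis[abs_def] by (intro continuous_intros)

lemma measurable_pol [measurable]: "pol \<in> borel_measurable borel"
  by (rule borel_measurable_continuous_onI[OF continuous_on_pol])

lemma norm_vector_2: "norm (vector [a, b] :: real^2) = sqrt (a\<^sup>2 + b\<^sup>2)"
  by (simp add: norm_vec_def L2_set_def sum_2)

lemma norm_pol [simp]: "norm (pol z) = exp (fst z)"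
proof -
  have "(exp (fst z) * cos (snd z))\<^sup>2 + (exp (fst z) * sin (snd z))\<^sup>2 = (exp (fst z))\<^sup>2 * ((sin (snd z))\<^sup>2 + (cos (snd z))\<^sup>2)"
    by (simp only: power_mult_distrib distrib_left add.commute)
  then show ?thesis by (simp add: pol_def norm_vector_2)
qed

lemma pol_inj_on: "inj_on pol cylinder"
proof (rule inj_onI)
  fix z z' assume z: "z \<in> cylinder" "z' \<in> cylinder" and eq: "pol z = pol z'"
  have f: "fst z = fst z'" using norm_pol[of z] norm_pol[of z'] eq by simp
  have "cos (snd z) = cos (snd z')" "sin (snd z) = sin (snd z')"
    using eq f by (auto simp: pol_def vec_eq_iff forall_2)
  then obtain n :: int where n: "snd z = snd z' + 2 * pi * of_int n" using sin_cos_eq_iff[of "snd z" "snd z'"] by auto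
  have "\<bar>2 * pi * of_int n\<bar> < 2 * pi" using z n by (auto simp: cylinder_def mem_Times_iff)
  then have "n = 0" by (simp add: abs_mult)
  then show "z = z'" using n f by (simp add: prod_eq_iff)
qed

lemma pol_surj: "x \<noteq> 0 \<Longrightarrow> \<exists>z\<in>cylinder. pol z = x"
proof -
  assume x: "x \<noteq> 0"
  then have n: "norm x > 0" by simp
  have "(norm x)\<^sup>2 = (x$1)\<^sup>2 + (x$2)\<^sup>2" by (simp add: norm_vec_def L2_set_def sum_2)
  then have "(x$1 / norm x)\<^sup>2 + (x$2 / norm x)\<^sup>2 = (norm x)\<^sup>2 / (norm x)\<^sup>2"
    by (simp only: power_divide add_divide_distrib)
  also have "\<dots> = 1" using n by simp
  finally have "(x$1 / norm x)\<^sup>2 + (x$2 / norm x)\<^sup>2 = 1" .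
  then obtain t where t: "0 \<le> t" "t < 2 * pi" "x$1 / norm x = cos t" "x$2 / norm x = sin t"
    using sincos_total_2pi by blast
  have "pol (ln (norm x), t) = x"
    using n t(3,4) by (simp add: pol_def vec_eq_iff forall_2 field_simps flip: t(3,4))
  then show ?thesis using t by (intro bexI[of _ "(ln (norm x), t)"]) (auto simp: cylinder_def)
qed

text \<open>Iterated integrals are taken on the product type, Jacobian determinants on the vector
  type; this carries the measure from one to the other.\<close>

lemma lborel_vector_2: "distr (lborel :: (real \<times> real) measure) borel (\<lambda>p. vector [fst p, snd p]) = (lborel :: (real^2) measure)"
proof (rule lborel_eqI[symmetric])
  let ?h = "\<lambda>p :: real \<times> real. vector [fst p, snd p] :: real^2"
  have h: "?h \<in> borel_measurable borel"
    unfolding vector_2_axis by (intro borel_measurable_continuous_onI continuous_intros)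
  fix l u :: "real^2" assume lu: "\<And>b. b \<in> Basis \<Longrightarrow> l \<bullet> b \<le> u \<bullet> b"
  have le: "l $ i \<le> u $ i" for i using lu[of "axis i 1"] by (simp add: inner_axis axis_in_Basis_iff)
  have "emeasure (distr lborel borel ?h) (box l u) = emeasure lborel ({l$1<..<u$1} \<times> {l$2<..<u$2})"
    using h by (subst emeasure_distr) (auto intro!: arg_cong[where f="emeasure lborel"] simp: mem_box_cart forall_2)
  also have "\<dots> = ennreal ((u$1 - l$1) * (u$2 - l$2))"
    using le by (subst lborel_prod[symmetric]) (simp add: lborel.emeasure_pair_measure_Times ennreal_mult)
  also have "(u$1 - l$1) * (u$2 - l$2) = (\<Prod>b\<in>Basis. (u - l) \<bullet> b)"
  proof -
    have B: "(Basis :: (real^2) set) = {axis 1 1, axis 2 1}"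
      by (auto simp: Basis_vec_def UNIV_2)
    have ne: "axis 1 1 \<noteq> (axis 2 1 :: real^2)" by (simp add: axis_eq_axis)
    have "(\<Prod>b\<in>Basis. (u - l) \<bullet> b) = ((u - l) \<bullet> axis 1 1) * ((u - l) \<bullet> axis 2 1)"
      unfolding B using ne by simp
    then show ?thesis by (simp add: inner_axis)
  qed
  finally show "emeasure (distr lborel borel ?h) (box l u) = ennreal (\<Prod>b\<in>Basis. (u - l) \<bullet> b)" .
qed simp

definition polv :: "real^2 \<Rightarrow> real^2" where "polv y = pol (y$1, y$2)"

lemma polv_derivative:
  "(polv has_derivative (\<lambda>h. (exp (y$1) * cos (y$2) * h$1 - exp (y$1) * sin (y$2) * h$2) *\<^sub>R axis 1 1
      + (exp (y$1) * sin (y$2) * h$1 + exp (y$1) * cos (y$2) * h$2) *\<^sub>R axis 2 1)) (at y within S)"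
proof -
  have c: "((\<lambda>x::real^2. x $ i) has_derivative (\<lambda>h. h $ i)) F" for i F
    by (rule bounded_linear_imp_has_derivative[OF bounded_linear_vec_nth])
  show ?thesis
    unfolding polv_def pol_axis fst_conv snd_conv
    by (rule derivative_eq_intros c refl)+ (simp add: algebra_simps)
qed

lemma polv_det:
  fixes y :: "real^2"
  shows "det (matrix (\<lambda>h::real^2. (exp (y$1) * cos (y$2) * h$1 - exp (y$1) * sin (y$2) * h$2) *\<^sub>R axis 1 1
      + (exp (y$1) * sin (y$2) * h$1 + exp (y$1) * cos (y$2) * h$2) *\<^sub>R axis 2 1 :: real^2)) = exp (2 * y$1)"
proof -
  have "e * c * (e * c) + e * s * (e * s) = e * e * (s\<^sup>2 + c\<^sup>2)" for e c s :: real
    by (simp add: power2_eq_square algebra_simps)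
  then have "exp (y$1) * cos (y$2) * (exp (y$1) * cos (y$2)) + exp (y$1) * sin (y$2) * (exp (y$1) * sin (y$2))
      = exp (y$1) * exp (y$1) * ((sin (y$2))\<^sup>2 + (cos (y$2))\<^sup>2)" .
  also have "\<dots> = exp (2 * y$1)" by (simp add: exp_add[symmetric])
  finally show ?thesis by (simp add: det_2 matrix_def axis_def)
qed

text \<open>A measure with the right values on boxes is Lebesgue measure. Up to the origin, a box is
  the injective image under \<open>polv\<close> of a part of the cylinder, and the Jacobian is exp
  (2 t).\<close>

lemma lborel_polar:
  "(lborel :: (real^2) measure) = distr (density lborel (\<lambda>z. ennreal (exp (2 * fst z)) * indicator cylinder z)) borel pol"
proof (rule lborel_eqI)
  let ?N = "distr (density lborel (\<lambda>z. ennreal (exp (2 * fst z)) * indicator cylinder z)) borel pol"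
  fix l u :: "real^2" assume lu: "\<And>b. b \<in> Basis \<Longrightarrow> l \<bullet> b \<le> u \<bullet> b"
  let ?A = "box l u"
  define S where "S = {y. polv y \<in> ?A \<and> (y$1, y$2) \<in> cylinder}"
  have polv_cont: "continuous_on UNIV polv"
    by (rule has_derivative_continuous_on[OF polv_derivative])
  then have m1: "polv \<in> borel_measurable borel" by (rule borel_measurable_continuous_onI)
  have m2: "(\<lambda>y::real^2. (y$1, y$2)) \<in> borel_measurable borel"
    by (intro borel_measurable_continuous_onI continuous_intros)
  have "{y \<in> space borel. polv y \<in> ?A} \<in> sets borel" "{y \<in> space borel. (y$1, y$2) \<in> cylinder} \<in> sets (borel :: (real^2) measure)"
    using measurable_sets[OF m1, of ?A] measurable_sets[OF m2, of cylinder] by (auto simp: vimage_def)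
  then have Sb [measurable]: "S \<in> sets borel" by (auto simp: S_def Collect_conj_eq)
  \<comment> \<open>The origin is never attained since |pol z| = exp t; as a null set it does not
    affect the measure of the box.\<close>
  have img: "polv ` S = ?A - {0}"
  proof safe
    fix x assume x: "x \<in> ?A" "x \<notin> polv ` S"
    show "x = 0"
    proof (rule ccontr)
      assume "x \<noteq> 0"
      then obtain z where z: "z \<in> cylinder" "pol z = x" using pol_surj by blast
      then have "x = polv (vector [fst z, snd z])" by (simp add: polv_def)
      moreover from z x this have "vector [fst z, snd z] \<in> S" by (simp add: S_def polv_def)
      ultimately show False using x by blast
    qed
  next
    fix y assume y: "y \<in> S" "polv y = 0"
    then show False using norm_pol[of "(y$1, y$2)"] by (simp add: polv_def)
  qed (auto simp: S_def)
  have inj: "inj_on polv S"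
  proof (rule inj_onI)
    fix x y assume "x \<in> S" "y \<in> S" "polv x = polv y"
    then have "(x$1, x$2) = (y$1, y$2)" using pol_inj_on by (auto simp: S_def polv_def dest: inj_onD)
    then show "x = y" by (simp add: vec_eq_iff forall_2)
  qed
  have "?A - {0} \<in> lmeasurable"
    by (intro fmeasurable_Diff) auto
  then have "((\<lambda>y. \<bar>exp (2 * y$1)\<bar>) has_integral measure lebesgue (?A - {0})) S"
    using has_measure_differentiable_image[OF _ polv_derivative inj, of "measure lebesgue (?A - {0})"] Sb
    by (simp add: img polv_det)
  then have "(\<integral>\<^sup>+y. ennreal (exp (2 * y$1)) * indicator S y \<partial>lborel) = ennreal (measure lebesgue (?A - {0}))"
    by (intro nn_integral_has_integral_lebesgue') auto
  also have "\<dots> = ennreal (measure lebesgue ?A)"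
    by (subst measure_Diff_null_set) auto
  also have "\<dots> = emeasure lborel ?A" using emeasure_eq_ennreal_measure[of lborel ?A] emeasure_lborel_box_finite[of l u] by (simp add: less_top)
  also have "\<dots> = ennreal (\<Prod>b\<in>Basis. (u - l) \<bullet> b)" using lu by (rule emeasure_lborel_box)
  finally have "ennreal (\<Prod>b\<in>Basis. (u - l) \<bullet> b) = (\<integral>\<^sup>+y. ennreal (exp (2 * y$1)) * indicator S y \<partial>lborel)" ..
  also have "\<dots> = (\<integral>\<^sup>+z. ennreal (exp (2 * fst z)) * indicator S (vector [fst z, snd z]) \<partial>lborel)"
  proof -
    have h: "(\<lambda>p::real\<times>real. vector [fst p, snd p] :: real^2) \<in> measurable lborel borel"
    proof -
      have "(\<lambda>p::real\<times>real. vector [fst p, snd p] :: real^2) \<in> borel_measurable borel"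
        unfolding vector_2_axis by (intro borel_measurable_continuous_onI continuous_intros)
      then show ?thesis by simp
    qed
    have m: "(\<lambda>y::real^2. ennreal (exp (2 * y$1))) \<in> borel_measurable borel"
      by (intro measurable_compose[OF _ measurable_ennreal] borel_measurable_continuous_onI continuous_intros)
    show ?thesis
      using m by (subst lborel_vector_2[symmetric], subst nn_integral_distr[OF h]) auto
  qed
  also have "\<dots> = (\<integral>\<^sup>+z. ennreal (exp (2 * fst z)) * indicator cylinder z * indicator (pol -` ?A) z \<partial>lborel)"
    by (intro nn_integral_cong) (auto simp: S_def polv_def indicator_def)
  also have "\<dots> = emeasure ?N ?A"
    using measurable_sets[OF measurable_pol, of ?A]
    by (subst emeasure_distr) (auto simp: emeasure_density)
  finally show "emeasure ?N ?A = ennreal (\<Prod>b\<in>Basis. (u - l) \<bullet> b)" ..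
qed simp

lemma nn_integral_polar:
  assumes [measurable]: "f \<in> borel_measurable borel"
  shows "(\<integral>\<^sup>+x. f x \<partial>lborel) = (\<integral>\<^sup>+z\<in>cylinder. (f (pol z) * ennreal (exp (2 * fst z))) \<partial>lborel)"
  by (subst lborel_polar) (auto simp: nn_integral_distr nn_integral_density ac_simps intro!: nn_integral_cong)

text \<open>The density exp (2 t) is positive on the cylinder, so planar null sets pull back to null
  sets.\<close>

lemma AE_polar:
  assumes "AE x in lborel. P x"
  shows "AE z in lborel. z \<in> cylinder \<longrightarrow> P (pol z)"
proof -
  obtain N where N: "{x. \<not> P x} \<subseteq> N" "N \<in> sets borel" "emeasure lborel N = 0"
    using assms by (auto elim!: AE_E)
  have [measurable]: "N \<in> sets borel" by fact
  have "(\<integral>\<^sup>+x. indicator N x \<partial>lborel) = (\<integral>\<^sup>+z\<in>cylinder. (indicator N (pol z) * ennreal (exp (2 * fst z))) \<partial>lborel)"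
    by (rule nn_integral_polar) measurable
  then have "(\<integral>\<^sup>+z\<in>cylinder. (indicator N (pol z) * ennreal (exp (2 * fst z))) \<partial>lborel) = 0"
    using N by simp
  then have "AE z in lborel. indicator N (pol z) * ennreal (exp (2 * fst z)) * indicator cylinder z = 0"
    by (subst (asm) nn_integral_0_iff_AE) auto
  then show ?thesis
    by eventually_elim (use N(1) in \<open>auto simp: indicator_def split: if_splits\<close>)
qed

text \<open>Substitution on compact intervals, followed by monotone convergence along an exhaustion
  of the line and of the half-line.\<close>

lemma nn_integral_exp_substitution:
  fixes f :: "real \<Rightarrow> ennreal"
  assumes [measurable]: "f \<in> borel_measurable borel"
  shows "(\<integral>\<^sup>+r\<in>{0<..}. f r \<partial>lborel) = (\<integral>\<^sup>+t. f (exp t) * ennreal (exp t) \<partial>lborel)"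
proof -
  let ?I = "\<lambda>n::nat. {- real (Suc n)..real (Suc n)}" and ?J = "\<lambda>n::nat. {exp (- real (Suc n))..exp (real (Suc n))}"
  have eq: "(\<integral>\<^sup>+r\<in>?J n. f r \<partial>lborel) = (\<integral>\<^sup>+t\<in>?I n. (f (exp t) * ennreal (exp t)) \<partial>lborel)" for n
    by (rule nn_integral_substitution_aux) (auto intro!: derivative_eq_intros continuous_intros)
  have sup_ind: "(SUP n. indicator (A n) x :: ennreal) = indicator (\<Union>n. A n) x" for A :: "nat \<Rightarrow> real set" and x
  proof (cases "x \<in> (\<Union>n. A n)")
    case True
    then obtain n where "x \<in> A n" by auto
    then have "1 \<le> (SUP n. indicator (A n) x :: ennreal)" by (intro SUP_upper2[of n]) auto
    moreover have "(SUP n. indicator (A n) x :: ennreal) \<le> 1" by (intro SUP_least) (simp add: indicator_def)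
    ultimately show ?thesis using True by simp
  qed auto
  have lim: "(SUP n. \<integral>\<^sup>+x\<in>A n. g x \<partial>lborel) = (\<integral>\<^sup>+x\<in>(\<Union>n. A n). g x \<partial>lborel)"
    if [measurable]: "g \<in> borel_measurable borel" "\<And>n. A n \<in> sets borel" and inc: "\<And>n. A n \<subseteq> A (Suc n)"
    for g :: "real \<Rightarrow> ennreal" and A :: "nat \<Rightarrow> real set"
  proof -
    have "(\<integral>\<^sup>+x. (SUP n. g x * indicator (A n) x) \<partial>lborel) = (SUP n. \<integral>\<^sup>+x\<in>A n. g x \<partial>lborel)"
      using inc by (intro nn_integral_monotone_convergence_SUP incseq_SucI le_funI) (auto simp: indicator_def)
    moreover have "(SUP n. g x * indicator (A n) x) = g x * indicator (\<Union>n. A n) x" for x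
      by (subst SUP_mult_left_ennreal[symmetric]) (simp only: sup_ind)
    ultimately show ?thesis by simp
  qed
  have "(\<Union>n. ?I n) = UNIV"
  proof -
    have "\<exists>n. x \<in> ?I n" for x :: real
    proof -
      obtain n where "\<bar>x\<bar> < real n" using reals_Archimedean2 by blast
      then show ?thesis by (intro exI[of _ n]) auto
    qed
    then show ?thesis by blast
  qed
  moreover have "(\<Union>n. ?J n) = {0<..}"
  proof -
    have "\<exists>n. x \<in> ?J n" if "0 < x" for x :: real
    proof -
      obtain n where n: "\<bar>ln x\<bar> < real n" using reals_Archimedean2 by blast
      then have "exp (- real (Suc n)) \<le> exp (ln x)" "exp (ln x) \<le> exp (real (Suc n))"
        by (simp_all del: exp_ln)
      then show ?thesis using that by auto
    qed
    moreover have "0 < x" if "x \<in> ?J n" for x :: real and n using that exp_gt_zero[of "- real (Suc n)"] by (simp del: exp_gt_zero)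
    ultimately show ?thesis by blast
  qed
  moreover have "(SUP n. \<integral>\<^sup>+x\<in>?J n. f x \<partial>lborel) = (\<integral>\<^sup>+x\<in>(\<Union>n. ?J n). f x \<partial>lborel)"
    by (rule lim) auto
  moreover have "(SUP n. \<integral>\<^sup>+x\<in>?I n. (f (exp x) * ennreal (exp x)) \<partial>lborel) = (\<integral>\<^sup>+x\<in>(\<Union>n. ?I n). (f (exp x) * ennreal (exp x)) \<partial>lborel)"
    by (rule lim) auto
  ultimately show ?thesis using eq by simp
qed

lemma AE_exp:
  assumes "AE t in lborel. P (exp t)"
  shows "AE r in lborel. 0 < r \<longrightarrow> P (r::real)"
proof -
  obtain N where N: "{t. \<not> P (exp t)} \<subseteq> N" "N \<in> sets borel" "emeasure lborel N = 0"
    using assms by (auto elim!: AE_E)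
  have [measurable]: "N \<in> sets borel" by fact
  have "(\<integral>\<^sup>+r\<in>{0<..}. indicator N (ln r) \<partial>lborel) = (\<integral>\<^sup>+t. indicator N (ln (exp t)) * ennreal (exp t) \<partial>lborel)"
    by (rule nn_integral_exp_substitution) measurable
  also have "\<dots> = 0"
    using N by (subst nn_integral_0_iff_AE) (auto simp: AE_iff_null_sets[of N lborel] indicator_def null_sets_def intro: AE_mp[OF AE_not_in[of N]])
  finally have "AE r in lborel. indicator N (ln r) * indicator {0<..} r = (0::ennreal)"
    by (subst (asm) nn_integral_0_iff_AE) auto
  then show ?thesis
  proof eventually_elim
    case (elim r)
    show ?case
    proof
      assume r: "0 < r"
      then have "ln r \<notin> N" using elim by (auto simp: indicator_def split: if_splits)
      then have "P (exp (ln r))" using N(1) by auto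
      then show "P r" using r by simp
    qed
  qed
qed

section \<open>The angular supremum and the mixed norm\<close>

definition angular_sup :: "(real^2 \<Rightarrow> real) \<Rightarrow> real \<Rightarrow> ennreal" where
  "angular_sup V r = esssup (lebesgue_on {0..2*pi}) (\<lambda>t. ennreal \<bar>V (vector [r * cos t, r * sin t])\<bar>)"

lemma mixed_norm_angular_sup: "mixed_norm V = (\<integral>\<^sup>+r\<in>{0<..}. (angular_sup V r * ennreal r) \<partial>lebesgue)"
  by (simp add: mixed_norm_def angular_sup_def)

lemma vector_polar_measurable:
  "(\<lambda>z::real\<times>real. vector [fst z * cos (snd z), fst z * sin (snd z)] :: real^2) \<in> borel_measurable borel"
  unfolding vector_2_axis by (intro borel_measurable_continuous_onI continuous_intros)

lemma circle_measurable: "(\<lambda>t. vector [r * cos t, r * sin t] :: real^2) \<in> borel_measurable borel"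
  unfolding vector_2_axis by (intro borel_measurable_continuous_onI continuous_intros)

lemma borel_measurable_lebesgue_on:
  "f \<in> borel_measurable borel \<Longrightarrow> f \<in> borel_measurable (lebesgue_on S)" for f :: "real \<Rightarrow> ennreal"
  by (intro measurable_restrict_space1 measurable_completion) simp

lemma AE_lebesgue_on_interval:
  "(AE t in lebesgue_on {0..2*pi}. P t) \<longleftrightarrow> (AE t in lborel. t \<in> {0..2*pi} \<longrightarrow> P t)"
  by (subst AE_restrict_space_iff) (auto simp: AE_completion_iff)

lemma angular_sup_le_iff:
  assumes [measurable]: "V \<in> borel_measurable borel"
  shows "angular_sup V r \<le> c \<longleftrightarrow> (AE t in lborel. t \<in> {0..2*pi} \<longrightarrow> ennreal \<bar>V (vector [r * cos t, r * sin t])\<bar> \<le> c)"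
proof -
  let ?f = "\<lambda>t. ennreal \<bar>V (vector [r * cos t, r * sin t])\<bar>"
  have [measurable]: "(\<lambda>t. vector [r * cos t, r * sin t] :: real^2) \<in> borel_measurable borel"
    by (rule circle_measurable)
  have f: "?f \<in> borel_measurable (lebesgue_on {0..2*pi})"
    by (rule borel_measurable_lebesgue_on) measurable
  have "angular_sup V r \<le> c \<longleftrightarrow> (AE t in lebesgue_on {0..2*pi}. ?f t \<le> c)"
  proof
    assume "angular_sup V r \<le> c"
    with esssup_AE[of ?f "lebesgue_on {0..2*pi}"] show "AE t in lebesgue_on {0..2*pi}. ?f t \<le> c"
      unfolding angular_sup_def by (auto elim: eventually_mono)
  qed (use f in \<open>auto simp: angular_sup_def\<close>)
  then show ?thesis by (simp only: AE_lebesgue_on_interval)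
qed

text \<open>The essential supremum exceeds \<open>y\<close> exactly when the angles with value above
  \<open>y\<close> have positive measure, and the measure of sections of a Borel set is a measurable
  function of the radius.\<close>

lemma angular_sup_measurable [measurable]:
  assumes [measurable]: "V \<in> borel_measurable borel"
  shows "angular_sup V \<in> borel_measurable borel"
proof (rule borel_measurableI_greater)
  fix y
  let ?A = "{z :: real \<times> real. snd z \<in> {0..2*pi} \<and> y < ennreal \<bar>V (vector [fst z * cos (snd z), fst z * sin (snd z)])\<bar>}"
  note [measurable] = vector_polar_measurable
  have "?A \<in> sets borel" by measurable
  moreover have "sets (borel \<Otimes>\<^sub>M lborel) = sets (borel :: (real \<times> real) measure)"
    by (metis borel_prod sets_lborel sets_pair_measure_cong)
  ultimately have A: "?A \<in> sets (borel \<Otimes>\<^sub>M lborel)" by blast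
  have "y < angular_sup V r \<longleftrightarrow> emeasure lborel (Pair r -` ?A) \<noteq> 0" for r
  proof -
    have *: "Pair r -` ?A \<in> sets lborel" using sets_Pair1[OF A, of r] by simp
    have "\<not> y < angular_sup V r \<longleftrightarrow> (AE t in lborel. t \<notin> Pair r -` ?A)"
      unfolding not_less angular_sup_le_iff[OF assms] by (rule AE_cong) (auto simp: not_less)
    also have "\<dots> \<longleftrightarrow> emeasure lborel (Pair r -` ?A) = 0"
      unfolding AE_iff_null_sets[OF *, symmetric] null_sets_def using * by blast
    finally show ?thesis by blast
  qed
  then have eq: "{r \<in> space borel. y < angular_sup V r} = (\<lambda>r. emeasure lborel (Pair r -` ?A)) -` (- {0}) \<inter> space borel"
    by blast
  have "(\<lambda>r. emeasure lborel (Pair r -` ?A)) \<in> borel_measurable borel"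
    by (rule lborel.measurable_emeasure_Pair[OF A])
  then show "{r \<in> space borel. y < angular_sup V r} \<in> sets borel"
    unfolding eq by (rule measurable_sets) simp
qed

lemma mixed_norm_cylinder:
  assumes [measurable]: "V \<in> borel_measurable borel"
  shows "mixed_norm V = (\<integral>\<^sup>+t. angular_sup V (exp t) * ennreal (exp (2 * t)) \<partial>lborel)"
proof -
  have "mixed_norm V = (\<integral>\<^sup>+r\<in>{0<..}. (angular_sup V r * ennreal r) \<partial>lborel)"
    by (simp add: mixed_norm_angular_sup nn_integral_completion)
  also have "\<dots> = (\<integral>\<^sup>+t. angular_sup V (exp t) * ennreal (exp t) * ennreal (exp t) \<partial>lborel)"
    by (rule nn_integral_exp_substitution) measurable
  also have "\<dots> = (\<integral>\<^sup>+t. angular_sup V (exp t) * ennreal (exp (2 * t)) \<partial>lborel)"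
    by (intro nn_integral_cong) (simp add: mult.assoc flip: ennreal_mult exp_add)
  finally show ?thesis .
qed

lemma pol_circle: "pol (t, x) = vector [exp t * cos x, exp t * sin x]"
  by (simp add: pol_def)

text \<open>On each circle the bound fails on a null set of angles that depends on the circle;
  Fubini makes the union of these sets a null set of the cylinder.\<close>

lemma AE_le_angular_sup:
  assumes [measurable]: "V \<in> borel_measurable borel"
  shows "AE z in lborel. z \<in> cylinder \<longrightarrow> ennreal \<bar>V (pol z)\<bar> \<le> angular_sup V (exp (fst z))"
proof -
  let ?P = "\<lambda>z. z \<in> cylinder \<longrightarrow> ennreal \<bar>V (pol z)\<bar> \<le> angular_sup V (exp (fst z))"
  have "AE z in lborel \<Otimes>\<^sub>M lborel. ?P z"
  proof (rule lborel_pair.AE_pair_measure)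
    have "{z. ?P z} \<in> sets (borel :: (real \<times> real) measure)" by measurable
    then show "{z \<in> space (lborel \<Otimes>\<^sub>M lborel). ?P z} \<in> sets (lborel \<Otimes>\<^sub>M lborel)"
      unfolding lborel_prod by simp
    show "AE t in lborel. AE x in lborel. ?P (t, x)"
    proof (rule AE_I2)
      fix t :: real
      have "AE x in lborel. x \<in> {0..2*pi} \<longrightarrow> ennreal \<bar>V (vector [exp t * cos x, exp t * sin x])\<bar> \<le> angular_sup V (exp t)"
        using angular_sup_le_iff[OF assms, of "exp t" "angular_sup V (exp t)"] by simp
      then show "AE x in lborel. ?P (t, x)"
        by eventually_elim (auto simp: cylinder_def pol_circle)
    qed
  qed
  then show ?thesis unfolding lborel_prod .
qed

text \<open>The potential is only Lebesgue measurable, so its restriction to a given circle may fail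
  to be measurable. All work on the cylinder is done with a Borel version, kept nonnegative
  everywhere by the maximum with 0.\<close>

lemma ex_borel_version:
  fixes V :: "real^2 \<Rightarrow> real"
  assumes "V \<in> borel_measurable lebesgue" "\<And>x. 0 \<le> V x"
  shows "\<exists>V'. V' \<in> borel_measurable borel \<and> (\<forall>x. 0 \<le> V' x) \<and> (AE x in lebesgue. V x = V' x)"
proof -
  obtain g where g: "g \<in> borel_measurable lborel" "AE x in lborel. V x = g x"
    using completion_ex_borel_measurable_real[OF assms(1)] by blast
  have "(\<lambda>x. max 0 (g x)) \<in> borel_measurable borel" using g(1) by simp
  moreover have "AE x in lebesgue. V x = max 0 (g x)"
    unfolding AE_completion_iff using g(2) by eventually_elim (metis assms(2) max.absorb2)
  ultimately show ?thesis by (intro exI[of _ "\<lambda>x. max 0 (g x)"]) auto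
qed

lemma AE_angular_sections:
  fixes V V' :: "real^2 \<Rightarrow> real"
  assumes "AE x in lebesgue. V x = V' x"
  shows "AE t in lborel. AE x in lborel. x \<in> {0..2*pi} \<longrightarrow> V (pol (t, x)) = V' (pol (t, x))"
proof -
  have "AE z in lborel. z \<in> cylinder \<longrightarrow> V (pol z) = V' (pol z)"
    using assms unfolding AE_completion_iff by (rule AE_polar)
  then have "AE z in lborel \<Otimes>\<^sub>M lborel. z \<in> cylinder \<longrightarrow> V (pol z) = V' (pol z)"
    unfolding lborel_prod .
  then have "AE t in lborel. AE x in lborel. (t, x) \<in> cylinder \<longrightarrow> V (pol (t, x)) = V' (pol (t, x))"
    by (rule lborel_pair.AE_pair)
  then show ?thesis
  proof eventually_elim
    case (elim t)
    with AE_lborel_singleton[of "2 * pi"] show ?case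
      by eventually_elim (auto simp: cylinder_def)
  qed
qed

lemma angular_sup_AE_eq:
  fixes V V' :: "real^2 \<Rightarrow> real"
  assumes V': "V' \<in> borel_measurable borel" and eq: "AE x in lebesgue. V x = V' x"
  shows "AE t in lborel. angular_sup V (exp t) = angular_sup V' (exp t)"
  using AE_angular_sections[OF eq]
proof eventually_elim
  case (elim t)
  let ?f = "\<lambda>W x. ennreal \<bar>W (vector [exp t * cos x, exp t * sin x] :: real^2)\<bar>"
  have [measurable]: "(\<lambda>x. V' (vector [exp t * cos x, exp t * sin x])) \<in> borel_measurable borel"
    by (rule measurable_compose[OF circle_measurable V'])
  let ?L = "lebesgue_on {0..2*pi}"
  have m: "?f V' \<in> borel_measurable ?L"
    by (rule borel_measurable_lebesgue_on) measurable
  have AE: "AE x in ?L. ?f V' x = ?f V x"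
    unfolding AE_lebesgue_on_interval using elim by eventually_elim (auto simp: pol_circle)
  \<comment> \<open>Needed to compare essential suprema. On almost every circle the section of
    \<open>V\<close> agrees almost everywhere with a Borel section, and Lebesgue measure is
    complete.\<close>
  have "?f V \<in> borel_measurable ?L"
  proof -
    let ?g = "\<lambda>W x. W (vector [exp t * cos x, exp t * sin x] :: real^2) * indicator {0..2*pi} x :: real"
    have "?g V' \<in> borel_measurable lborel"
      by measurable
    then have "?g V' \<in> borel_measurable lebesgue" by (rule measurable_completion)
    moreover have "AE x in lebesgue. ?g V' x = ?g V x"
      unfolding AE_completion_iff using elim by eventually_elim (auto simp: pol_circle indicator_def)
    ultimately have "?g V \<in> borel_measurable lebesgue" by (rule borel_measurable_AE)
    then have "(\<lambda>x. ennreal \<bar>?g V x\<bar>) \<in> borel_measurable ?L"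
      by (intro measurable_restrict_space1 measurable_compose[OF _ measurable_ennreal] borel_measurable_abs)
    moreover have "(\<lambda>x. ennreal \<bar>?g V x\<bar>) \<in> borel_measurable ?L \<longleftrightarrow> ?f V \<in> borel_measurable ?L"
      by (intro measurable_cong) (simp add: space_restrict_space)
    ultimately show ?thesis by simp
  qed
  then show ?case unfolding angular_sup_def using esssup_AE_cong[OF m _ AE] by simp
qed

lemma mixed_norm_AE_eq:
  fixes V V' :: "real^2 \<Rightarrow> real"
  assumes "V' \<in> borel_measurable borel" "AE x in lebesgue. V x = V' x"
  shows "mixed_norm V = mixed_norm V'"
proof -
  have "AE r in lborel. 0 < r \<longrightarrow> angular_sup V r = angular_sup V' r"
    using angular_sup_AE_eq[OF assms] by (rule AE_exp)
  then show ?thesis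
    unfolding mixed_norm_angular_sup nn_integral_completion
    by (intro nn_integral_cong_AE) (auto simp: indicator_def)
qed

lemma log_norm_AE_eq: "AE x in lebesgue. V x = V' x \<Longrightarrow> log_norm_unit_disc V = log_norm_unit_disc V'"
  unfolding log_norm_unit_disc_def by (intro nn_integral_cong_AE) auto

lemma L1_norm_AE_eq: "AE x in lebesgue. V x = V' x \<Longrightarrow> L1_norm V = L1_norm V'"
  unfolding L1_norm_def by (intro nn_integral_cong_AE) auto

lemma L1_norm_cylinder:
  assumes [measurable]: "V \<in> borel_measurable borel"
  shows "L1_norm V = (\<integral>\<^sup>+t. (\<integral>\<^sup>+x\<in>{0..<2*pi}. (ennreal \<bar>V (pol (t, x))\<bar> * ennreal (exp (2 * t))) \<partial>lborel) \<partial>lborel)"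
proof -
  have "L1_norm V = (\<integral>\<^sup>+z\<in>UNIV \<times> {0..<2*pi}. (ennreal \<bar>V (pol z)\<bar> * ennreal (exp (2 * fst z))) \<partial>lborel)"
    unfolding L1_norm_def nn_integral_completion by (subst nn_integral_polar) (auto simp: cylinder_def)
  also have "\<dots> = (\<integral>\<^sup>+t. (\<integral>\<^sup>+x\<in>{0..<2*pi}. (ennreal \<bar>V (pol (t, x))\<bar> * ennreal (exp (2 * t))) \<partial>lborel) \<partial>lborel)"
    by (subst nn_integral_box(1)) simp_all
  finally show ?thesis .
qed

lemma L1_norm_le_mixed_norm:
  assumes [measurable]: "V \<in> borel_measurable borel"
  shows "L1_norm V \<le> ennreal (2 * pi) * mixed_norm V"
proof -
  have "(\<integral>\<^sup>+x\<in>{0..<2*pi}. (ennreal \<bar>V (pol (t, x))\<bar> * ennreal (exp (2 * t))) \<partial>lborel)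
      \<le> ennreal (2 * pi) * (angular_sup V (exp t) * ennreal (exp (2 * t)))" for t
  proof -
    have "AE x in lborel. x \<in> {0..2*pi} \<longrightarrow> ennreal \<bar>V (pol (t, x))\<bar> \<le> angular_sup V (exp t)"
      using angular_sup_le_iff[OF assms, of "exp t" "angular_sup V (exp t)"] by (simp add: pol_circle)
    then have "(\<integral>\<^sup>+x\<in>{0..<2*pi}. (ennreal \<bar>V (pol (t, x))\<bar> * ennreal (exp (2 * t))) \<partial>lborel)
      \<le> (\<integral>\<^sup>+x\<in>{0..<2*pi}. (angular_sup V (exp t) * ennreal (exp (2 * t))) \<partial>lborel)"
      by (intro nn_integral_mono_AE) (auto elim!: eventually_mono simp: indicator_def mult_right_mono)
    also have "\<dots> = ennreal (2 * pi) * (angular_sup V (exp t) * ennreal (exp (2 * t)))"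
      by (subst nn_integral_cmult_indicator) (simp_all add: mult.commute)
    finally show ?thesis .
  qed
  then have "L1_norm V \<le> (\<integral>\<^sup>+t. ennreal (2 * pi) * (angular_sup V (exp t) * ennreal (exp (2 * t))) \<partial>lborel)"
    unfolding L1_norm_cylinder[OF assms] by (intro nn_integral_mono)
  also have "\<dots> = ennreal (2 * pi) * mixed_norm V"
    by (simp add: mixed_norm_cylinder nn_integral_cmult)
  finally show ?thesis .
qed

text \<open>The Borel version need not be radial, but on almost every circle it is almost everywhere
  constant. Its supremum there is at most this constant and its angular integral is 2 pi times the
  constant, so 1 \<le> 2 pi gives the claim.\<close>

lemma mixed_norm_radial_le:
  fixes V :: "real^2 \<Rightarrow> real"
  assumes V: "V \<in> borel_measurable lebesgue" "\<And>x. 0 \<le> V x" and radial: "\<And>x. V x = v (norm x)"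
  shows "mixed_norm V \<le> L1_norm V"
proof -
  obtain V' where V' [measurable]: "V' \<in> borel_measurable borel" and eq: "AE x in lebesgue. V x = V' x"
    using ex_borel_version[OF V] by blast
  have "L1_norm V = L1_norm V'" by (rule L1_norm_AE_eq[OF eq])
  also have "mixed_norm V = mixed_norm V'" by (rule mixed_norm_AE_eq[OF V' eq])
  moreover have "mixed_norm V' \<le> L1_norm V'"
    unfolding mixed_norm_cylinder[OF V'] L1_norm_cylinder[OF V']
  proof (rule nn_integral_mono_AE)
    show "AE t in lborel. angular_sup V' (exp t) * ennreal (exp (2 * t))
      \<le> (\<integral>\<^sup>+x\<in>{0..<2*pi}. (ennreal \<bar>V' (pol (t, x))\<bar> * ennreal (exp (2 * t))) \<partial>lborel)"
      using AE_angular_sections[OF eq]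
    proof eventually_elim
      case (elim t)
      let ?c = "ennreal \<bar>v (exp t)\<bar>"
      have ae: "AE x in lborel. x \<in> {0..2*pi} \<longrightarrow> ennreal \<bar>V' (pol (t, x))\<bar> = ?c"
        using elim by eventually_elim (auto simp: radial)
      then have le: "angular_sup V' (exp t) \<le> ?c"
        unfolding angular_sup_le_iff[OF V'] by eventually_elim (auto simp: pol_circle)
      from ae have int: "(\<integral>\<^sup>+x\<in>{0..<2*pi}. (ennreal \<bar>V' (pol (t, x))\<bar> * ennreal (exp (2 * t))) \<partial>lborel)
          = (\<integral>\<^sup>+x\<in>{0..<2*pi}. (?c * ennreal (exp (2 * t))) \<partial>lborel)"
        by (intro nn_integral_cong_AE) (auto elim!: eventually_mono simp: indicator_def)
      have "angular_sup V' (exp t) * ennreal (exp (2 * t)) \<le> ?c * ennreal (exp (2 * t))"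
        by (intro mult_right_mono le) simp
      also have "\<dots> \<le> ?c * ennreal (exp (2 * t)) * ennreal (2 * pi)"
      proof -
        have "1 \<le> ennreal (2 * pi)" using pi_gt3 by simp
        from mult_left_mono[OF this] show ?thesis by fastforce
      qed
      also have "\<dots> = (\<integral>\<^sup>+x\<in>{0..<2*pi}. (?c * ennreal (exp (2 * t))) \<partial>lborel)"
        by (subst nn_integral_cmult_indicator) simp_all
      finally show ?case unfolding int .
    qed
  qed
  ultimately show ?thesis by simp
qed

text \<open>In the plane the weight reads 2 + max 0 (- log |x|), and the logarithmic part lives in
  the unit disc.\<close>

lemma weighted_cylinder_integral:
  assumes [measurable]: "V \<in> borel_measurable borel" and nn: "\<And>x. 0 \<le> V x"
  shows "(\<integral>\<^sup>+z\<in>cylinder. (ennreal (V (pol z)) * ennreal (exp (2 * fst z)) * ennreal (2 + max 0 (- fst z))) \<partial>lborel)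
    = 2 * L1_norm V + log_norm_unit_disc V"
proof -
  let ?f = "\<lambda>x. ennreal (V x) * ennreal (2 + max 0 (- ln (norm x)))"
  have [measurable]: "ball (0 :: real^2) 1 \<in> sets borel" by simp
  have "(\<integral>\<^sup>+x. ?f x \<partial>lborel) = (\<integral>\<^sup>+z\<in>cylinder. (?f (pol z) * ennreal (exp (2 * fst z))) \<partial>lborel)"
    by (rule nn_integral_polar) measurable
  moreover have "(\<integral>\<^sup>+x. ?f x \<partial>lborel) = (\<integral>\<^sup>+x. (2 * ennreal \<bar>V x\<bar> + ennreal \<bar>V x * ln (norm x)\<bar> * indicator (ball 0 1) x) \<partial>lborel)"
  proof (rule nn_integral_cong)
    fix x :: "real^2"
    have "V x * max 0 (- ln (norm x)) = \<bar>V x * ln (norm x)\<bar> * indicator (ball 0 1) x"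
      using nn[of x] by (cases "norm x = 0") (auto simp: indicator_def abs_mult max_def not_le not_less)
    then have "V x * (2 + max 0 (- ln (norm x))) = 2 * \<bar>V x\<bar> + \<bar>V x * ln (norm x)\<bar> * indicator (ball 0 1) x"
      using nn[of x] by (simp add: distrib_left)
    then have "?f x = ennreal (2 * \<bar>V x\<bar> + \<bar>V x * ln (norm x)\<bar> * indicator (ball 0 1) x)"
      using nn[of x] by (simp only: flip: ennreal_mult)
    also have "\<dots> = 2 * ennreal \<bar>V x\<bar> + ennreal \<bar>V x * ln (norm x)\<bar> * indicator (ball 0 1) x"
      by (subst ennreal_plus) (auto simp: ennreal_mult indicator_def)
    finally show "?f x = 2 * ennreal \<bar>V x\<bar> + ennreal \<bar>V x * ln (norm x)\<bar> * indicator (ball 0 1) x" .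
  qed
  moreover have "(\<integral>\<^sup>+x. (2 * ennreal \<bar>V x\<bar> + ennreal \<bar>V x * ln (norm x)\<bar> * indicator (ball 0 1) x) \<partial>lborel) = 2 * L1_norm V + log_norm_unit_disc V"
    unfolding L1_norm_def log_norm_unit_disc_def nn_integral_completion
    by (subst nn_integral_add) (auto simp: nn_integral_cmult)
  ultimately show ?thesis by (simp add: ac_simps)
qed

section \<open>The magnetic Hardy inequality\<close>

text \<open>The gauge \<open>g = e f\<close> turns the magnetic derivative into \<open>g'\<close> and periodicity into
  \<open>g (2\<pi>) = \<lambda> g 0\<close> with \<open>\<lambda> \<noteq> 1\<close>.\<close>

lemma circle_hardy:
  fixes f f' :: "real \<Rightarrow> complex"
  assumes der: "\<And>x. (f has_vector_derivative f' x) (at x)" and cont: "continuous_on UNIV f'"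
    and per: "f (2 * pi) = f 0" and kappa: "0 < \<kappa>" "\<kappa> \<le> cmod (1 - exp (- 2 * pi * \<i> * of_real \<alpha>))"
    and x: "x \<in> {0..2 * pi}"
  shows "ennreal ((cmod (f x))\<^sup>2) \<le> ennreal (4 * pi / \<kappa>\<^sup>2 + 4 * pi) *
    (\<integral>\<^sup>+y\<in>{0..<2 * pi}. ennreal ((cmod (f' y - \<i> * of_real \<alpha> * f y))\<^sup>2) \<partial>lborel)"
proof -
  define e where "e = (\<lambda>y::real. exp (- \<i> * of_real \<alpha> * of_real y))"
  define g where "g = (\<lambda>y. e y * f y)"
  define g' where "g' = (\<lambda>y. e y * (f' y - \<i> * of_real \<alpha> * f y))"
  have contf: "continuous_on UNIV f"
    using der by (intro continuous_at_imp_continuous_on ballI) (auto intro: has_vector_derivative_continuous)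
  have e_der: "(e has_vector_derivative (- \<i> * of_real \<alpha> * e y)) (at y)" for y
  proof -
    have "((\<lambda>w. exp (- \<i> * of_real \<alpha> * w)) has_field_derivative (- \<i> * of_real \<alpha> * e y)) (at (of_real y))"
      unfolding e_def by (auto intro!: derivative_eq_intros)
    then show ?thesis
      unfolding e_def by (rule has_vector_derivative_real_field)
  qed
  have g_der: "(g has_vector_derivative g' y) (at y)" for y
    unfolding g_def g'_def using has_vector_derivative_mult[OF e_der[of y] der[of y]]
    by (simp add: algebra_simps)
  have g'_cont: "continuous_on UNIV g'"
    unfolding g'_def e_def by (intro continuous_intros cont contf)
  have norm_e: "cmod (e y) = 1" for y by (simp add: e_def norm_exp_eq_Re)
  let ?D = "\<integral>\<^sup>+y\<in>{0..<2 * pi}. ennreal ((cmod (f' y - \<i> * of_real \<alpha> * f y))\<^sup>2) \<partial>lborel"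
  have D: "(\<integral>\<^sup>+y\<in>{0..<2 * pi}. ennreal ((cmod (g' y))\<^sup>2) \<partial>lborel) = ?D"
    by (simp add: g'_def norm_mult norm_e)
  have diff: "ennreal ((cmod (g y - g x))\<^sup>2) \<le> ennreal (2 * pi) * ?D" if "x \<in> {0..2*pi}" "y \<in> {0..2*pi}" for x y
    using diff_sq_le_integral_deriv[OF g_der g'_cont that] by (simp add: D)
  have "g 0 = f 0" "g (2 * pi) = exp (- 2 * pi * \<i> * of_real \<alpha>) * f 0"
  proof -
    have "exp (- 2 * pi * \<i> * of_real \<alpha>) = e (2 * pi)" unfolding e_def by (simp add: mult_ac)
    then show "g (2 * pi) = exp (- 2 * pi * \<i> * of_real \<alpha>) * f 0" by (simp add: g_def per)
  qed (simp add: g_def e_def)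
  \<comment> \<open>The increment of \<open>g\<close> over a full turn is a nonzero multiple of
    \<open>f 0\<close>, so the derivative of \<open>g\<close> bounds \<open>f 0\<close> itself and,
    by another increment, \<open>f\<close> on the whole circle.\<close>
  then have g0: "g 0 - g (2 * pi) = (1 - exp (- 2 * pi * \<i> * of_real \<alpha>)) * f 0"
    by (simp add: algebra_simps)
  have "\<kappa>\<^sup>2 * (cmod (f 0))\<^sup>2 \<le> (cmod (g 0 - g (2 * pi)))\<^sup>2"
    unfolding g0 norm_mult power_mult_distrib using kappa by (intro mult_right_mono power_mono) auto
  then have "ennreal (\<kappa>\<^sup>2 * (cmod (f 0))\<^sup>2) \<le> ennreal (2 * pi) * ?D"
    using diff[of "2 * pi" 0] by (meson ennreal_leI order_trans atLeastAtMost_iff order_refl pi_ge_zero mult_nonneg_nonneg zero_le_numeral)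
  then have "ennreal (1 / \<kappa>\<^sup>2) * ennreal (\<kappa>\<^sup>2 * (cmod (f 0))\<^sup>2) \<le> ennreal (1 / \<kappa>\<^sup>2) * (ennreal (2 * pi) * ?D)"
    by (rule mult_left_mono) simp
  also have "ennreal (1 / \<kappa>\<^sup>2) * ennreal (\<kappa>\<^sup>2 * (cmod (f 0))\<^sup>2) = ennreal ((cmod (f 0))\<^sup>2)"
    using kappa by (subst ennreal_mult[symmetric]) auto
  also have "ennreal (1 / \<kappa>\<^sup>2) * (ennreal (2 * pi) * ?D) = ennreal (2 * pi / \<kappa>\<^sup>2) * ?D"
    unfolding mult.assoc[symmetric] by (subst ennreal_mult[symmetric]) auto
  finally have f0: "ennreal ((cmod (f 0))\<^sup>2) \<le> ennreal (2 * pi / \<kappa>\<^sup>2) * ?D" .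
  have "cmod (f x) = cmod (g x)" by (simp add: g_def norm_mult norm_e)
  then have "ennreal ((cmod (f x))\<^sup>2) = ennreal ((cmod (g 0 + (g x - g 0)))\<^sup>2)" by simp
  also have "\<dots> \<le> 2 * ennreal ((cmod (g 0))\<^sup>2) + 2 * ennreal ((cmod (g x - g 0))\<^sup>2)"
    by (rule ennreal_cmod_add_sq)
  also have "\<dots> \<le> 2 * (ennreal (2 * pi / \<kappa>\<^sup>2) * ?D) + 2 * (ennreal (2 * pi) * ?D)"
    using f0 diff[of 0 x] x by (intro add_mono mult_left_mono) (auto simp: \<open>g 0 = f 0\<close>)
  also have "\<dots> = ennreal (4 * pi / \<kappa>\<^sup>2 + 4 * pi) * ?D"
  proof -
    have "2 * ennreal (2 * pi / \<kappa>\<^sup>2) = ennreal (4 * pi / \<kappa>\<^sup>2)" "2 * ennreal (2 * pi) = ennreal (4 * pi)"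
      by (simp_all flip: ennreal_numeral ennreal_mult)
    then show ?thesis by (subst ennreal_plus) (simp_all add: distrib_right flip: mult.assoc)
  qed
  finally show ?thesis .
qed

lemma add_two_mult_le: "x \<le> 2 * n + 2 * m \<Longrightarrow> 0 \<le> t \<Longrightarrow> t + x \<le> 2 * (t + n) + 2 * m" for x n m t :: real
  by simp

text \<open>\<open>P t\<close> is the flux through the disc of radius exp t. Towards t = - infinity
  it approaches the integer 0, where no gap can hold; the bound by M exp t makes the field
  negligible there.\<close>

locale magnetic_cylinder =
  fixes P :: "real \<Rightarrow> real" and M T\<^sub>0 \<kappa> :: real
  assumes P_meas [measurable]: "P \<in> borel_measurable borel"
    and P_bound: "\<bar>P t\<bar> \<le> M" "\<bar>P t\<bar> \<le> M * exp t"
    and kappa_pos: "0 < \<kappa>"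
    and P_gap: "T\<^sub>0 \<le> t \<Longrightarrow> \<kappa> \<le> cmod (1 - exp (- 2 * pi * \<i> * of_real (P t)))"
begin

definition magnetic_energy :: "(real \<times> real \<Rightarrow> complex) \<Rightarrow> (real \<times> real \<Rightarrow> complex) \<Rightarrow> (real \<times> real \<Rightarrow> complex) \<Rightarrow> ennreal" where
  "magnetic_energy U Ut Uh =
    (\<integral>\<^sup>+z\<in>cylinder. ennreal ((cmod (Ut z))\<^sup>2 + (cmod (Uh z - \<i> * of_real (P (fst z)) * U z))\<^sup>2) \<partial>lborel)"

text \<open>\<open>C\<^sub>1\<close> is the circle estimate integrated over the angle.
  \<open>C\<^sub>2\<close> bounds exp t times the loss in transporting values inwards to
  \<open>t\<close> below \<open>T\<^sub>0\<close>. \<open>C\<^sub>3\<close> adds the two regions,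
  where the integral of exp t below \<open>T\<^sub>0\<close> is
  \<open>exp T\<^sub>0\<close>.\<close>

definition C\<^sub>1 :: real where "C\<^sub>1 = 2 * pi * (4 * pi / \<kappa>\<^sup>2 + 4 * pi)"
definition C\<^sub>2 :: real where "C\<^sub>2 = exp T\<^sub>0 * (2 * C\<^sub>1 + 2)"
definition C\<^sub>3 :: real where "C\<^sub>3 = C\<^sub>2 * exp T\<^sub>0 + C\<^sub>1"

lemma C_nonneg: "0 \<le> C\<^sub>1" "0 \<le> C\<^sub>2" "0 \<le> C\<^sub>3"
  using kappa_pos by (simp_all add: C\<^sub>1_def C\<^sub>2_def C\<^sub>3_def)

text \<open>From \<open>T\<^sub>0\<close> on, \<open>circle_hardy\<close> acts on every circle.
  Further in there is no gap, so values are transported inwards from the ring between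
  \<open>T\<^sub>0\<close> and \<open>T\<^sub>0 + 1\<close> by integrating the \<open>t\<close>
  derivative. The loss grows linearly in - t and is absorbed by exp (2 t), a weight still large
  enough to dominate the square of the flux.\<close>

lemma magnetic_hardy:
  assumes cyl: "cyl_fun U Ut Uh" and per: "\<And>t. U (t, 2 * pi) = U (t, 0)"
  shows "(\<integral>\<^sup>+z\<in>cylinder. (ennreal (if fst z < T\<^sub>0 then exp (2 * fst z) else 1) * ennreal ((cmod (U z))\<^sup>2)) \<partial>lborel)
    \<le> ennreal C\<^sub>3 * magnetic_energy U Ut Uh"
proof -
  interpret cyl_fun U Ut Uh by (rule cyl)
  define Q where "Q = magnetic_energy U Ut Uh"
  let ?J = "{0..<2 * pi}"
  define S where "S = (\<lambda>t. \<integral>\<^sup>+x\<in>?J. ennreal ((cmod (U (t, x)))\<^sup>2) \<partial>lborel)"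
  define N where "N = (\<lambda>t. \<integral>\<^sup>+x\<in>?J. ennreal ((cmod (Uh (t, x) - \<i> * of_real (P t) * U (t, x)))\<^sup>2) \<partial>lborel)"
  have [measurable]: "S \<in> borel_measurable borel" unfolding S_def by measurable
  have [measurable]: "N \<in> borel_measurable borel" unfolding N_def by measurable
  have Ut_Q: "(\<integral>\<^sup>+z\<in>UNIV \<times> ?J. ennreal ((cmod (Ut z))\<^sup>2) \<partial>lborel) \<le> Q"
    unfolding Q_def magnetic_energy_def cylinder_def
    by (intro nn_integral_mono mult_right_mono ennreal_leI) auto
  have N_Q: "(\<integral>\<^sup>+t. N t \<partial>lborel) \<le> Q"
  proof -
    have "(\<integral>\<^sup>+z\<in>UNIV \<times> ?J. ennreal ((cmod (Uh z - \<i> * of_real (P (fst z)) * U z))\<^sup>2) \<partial>lborel) = (\<integral>\<^sup>+t. N t \<partial>lborel)"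
      unfolding N_def by (subst nn_integral_box(1)) simp_all
    moreover have "(\<integral>\<^sup>+z\<in>UNIV \<times> ?J. ennreal ((cmod (Uh z - \<i> * of_real (P (fst z)) * U z))\<^sup>2) \<partial>lborel) \<le> Q"
      unfolding Q_def magnetic_energy_def cylinder_def
      by (intro nn_integral_mono mult_right_mono ennreal_leI) auto
    ultimately show ?thesis by simp
  qed
  have S_N: "S t \<le> ennreal C\<^sub>1 * N t" if t: "T\<^sub>0 \<le> t" for t
  proof -
    have "S t \<le> (\<integral>\<^sup>+x\<in>?J. (ennreal (4 * pi / \<kappa>\<^sup>2 + 4 * pi) * N t) \<partial>lborel)"
      unfolding S_def
    proof (rule nn_integral_mono)
      fix x
      show "ennreal ((cmod (U (t, x)))\<^sup>2) * indicator ?J x \<le> ennreal (4 * pi / \<kappa>\<^sup>2 + 4 * pi) * N t * indicator ?J x"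
      proof (cases "x \<in> ?J")
        case True
        then show ?thesis
          using circle_hardy[OF deriv_h cont_sections(2) per kappa_pos P_gap[OF t], of x t] by (simp add: N_def)
      qed simp
    qed
    also have "\<dots> = ennreal (4 * pi / \<kappa>\<^sup>2 + 4 * pi) * N t * ennreal (2 * pi)"
      by (subst nn_integral_cmult_indicator) simp_all
    also have "\<dots> = ennreal (2 * pi) * ennreal (4 * pi / \<kappa>\<^sup>2 + 4 * pi) * N t"
      by (simp only: ac_simps)
    also have "ennreal (2 * pi) * ennreal (4 * pi / \<kappa>\<^sup>2 + 4 * pi) = ennreal C\<^sub>1"
      unfolding C\<^sub>1_def by (rule ennreal_mult[symmetric]) auto
    finally show ?thesis .
  qed
  have S_ring: "(\<integral>\<^sup>+s\<in>{T\<^sub>0..<T\<^sub>0 + 1}. S s \<partial>lborel) \<le> ennreal C\<^sub>1 * Q"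
  proof -
    have "(\<integral>\<^sup>+s\<in>{T\<^sub>0..<T\<^sub>0 + 1}. S s \<partial>lborel) \<le> (\<integral>\<^sup>+s. ennreal C\<^sub>1 * N s \<partial>lborel)"
      by (intro nn_integral_mono) (auto simp: indicator_def S_N)
    also have "\<dots> = ennreal C\<^sub>1 * (\<integral>\<^sup>+s. N s \<partial>lborel)" by (simp add: nn_integral_cmult)
    also have "\<dots> \<le> ennreal C\<^sub>1 * Q" by (intro mult_left_mono N_Q) simp
    finally show ?thesis .
  qed
  have S_inner: "S t \<le> ennreal (2 * C\<^sub>1 + 2 * (T\<^sub>0 + 1 - t)) * Q" if t: "t < T\<^sub>0" for t
  proof -
    let ?I = "{T\<^sub>0..<T\<^sub>0 + 1}" and ?G = "\<lambda>x. \<integral>\<^sup>+s. ennreal ((cmod (Ut (s, x)))\<^sup>2) \<partial>lborel"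
    have pt: "ennreal ((cmod (U (t, x)))\<^sup>2) \<le> 2 * ennreal ((cmod (U (s, x)))\<^sup>2) + 2 * (ennreal (T\<^sub>0 + 1 - t) * ?G x)" if s: "s \<in> ?I" for s x
    proof -
      have "ennreal ((cmod (U (t, x)))\<^sup>2) = ennreal ((cmod (U (s, x) + (U (t, x) - U (s, x))))\<^sup>2)" by simp
      also have "\<dots> \<le> 2 * ennreal ((cmod (U (s, x)))\<^sup>2) + 2 * ennreal ((cmod (U (t, x) - U (s, x)))\<^sup>2)"
        by (rule ennreal_cmod_add_sq)
      also have "ennreal ((cmod (U (t, x) - U (s, x)))\<^sup>2)
          \<le> ennreal (T\<^sub>0 + 1 - t) * (\<integral>\<^sup>+s\<in>{t..<T\<^sub>0 + 1}. ennreal ((cmod (Ut (s, x)))\<^sup>2) \<partial>lborel)"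
        by (rule diff_sq_le_integral_deriv[OF deriv_t cont_sections(1)]) (use s t in auto)
      also have "\<dots> \<le> ennreal (T\<^sub>0 + 1 - t) * ?G x"
        by (intro mult_left_mono nn_integral_mono) (auto simp: indicator_def)
      finally show ?thesis by (simp add: add_left_mono mult_left_mono)
    qed
    have G_meas [measurable]: "?G \<in> borel_measurable borel" by measurable
    \<comment> \<open>The ring has length one, so averaging over it leaves \<open>S t\<close>
      unchanged and requires only the integral of \<open>S\<close> over the ring.\<close>
    have "S t = (\<integral>\<^sup>+s\<in>?I. S t \<partial>lborel)"
      by (subst nn_integral_cmult_indicator) simp_all
    also have "\<dots> \<le> (\<integral>\<^sup>+s\<in>?I. (2 * S s + 2 * (ennreal (T\<^sub>0 + 1 - t) * (\<integral>\<^sup>+x\<in>?J. ?G x \<partial>lborel))) \<partial>lborel)"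
    proof (rule nn_integral_mono)
      fix s
      have "S t \<le> 2 * S s + 2 * (ennreal (T\<^sub>0 + 1 - t) * (\<integral>\<^sup>+x\<in>?J. ?G x \<partial>lborel))" if s: "s \<in> ?I"
      proof -
        have "S t \<le> (\<integral>\<^sup>+x\<in>?J. (2 * ennreal ((cmod (U (s, x)))\<^sup>2) + 2 * (ennreal (T\<^sub>0 + 1 - t) * ?G x)) \<partial>lborel)"
          unfolding S_def by (intro nn_integral_mono mult_right_mono pt s) simp
        also have "\<dots> = 2 * S s + 2 * (ennreal (T\<^sub>0 + 1 - t) * (\<integral>\<^sup>+x\<in>?J. ?G x \<partial>lborel))"
          unfolding S_def by (simp add: distrib_right nn_integral_add nn_integral_cmult mult.assoc)
        finally show ?thesis .
      qed
      then show "S t * indicator ?I s \<le> (2 * S s + 2 * (ennreal (T\<^sub>0 + 1 - t) * (\<integral>\<^sup>+x\<in>?J. ?G x \<partial>lborel))) * indicator ?I s"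
        by (simp add: indicator_def)
    qed
    also have "\<dots> = 2 * (\<integral>\<^sup>+s\<in>?I. S s \<partial>lborel) + 2 * (ennreal (T\<^sub>0 + 1 - t) * (\<integral>\<^sup>+x\<in>?J. ?G x \<partial>lborel))"
    proof -
      have "(\<integral>\<^sup>+s\<in>?I. c \<partial>lborel) = c" for c by (subst nn_integral_cmult_indicator) simp_all
      then show ?thesis by (simp add: distrib_right nn_integral_add nn_integral_cmult mult.assoc)
    qed
    also have "(\<integral>\<^sup>+x\<in>?J. ?G x \<partial>lborel) = (\<integral>\<^sup>+z\<in>UNIV \<times> ?J. ennreal ((cmod (Ut z))\<^sup>2) \<partial>lborel)"
      by (subst nn_integral_box(2)) simp_all
    also have "2 * (\<integral>\<^sup>+s\<in>?I. S s \<partial>lborel) + 2 * (ennreal (T\<^sub>0 + 1 - t) * (\<integral>\<^sup>+z\<in>UNIV \<times> ?J. ennreal ((cmod (Ut z))\<^sup>2) \<partial>lborel))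
        \<le> 2 * (ennreal C\<^sub>1 * Q) + 2 * (ennreal (T\<^sub>0 + 1 - t) * Q)"
      by (intro add_mono mult_left_mono S_ring Ut_Q) auto
    also have "\<dots> = ennreal (2 * C\<^sub>1 + 2 * (T\<^sub>0 + 1 - t)) * Q"
    proof -
      have "2 * ennreal C\<^sub>1 = ennreal (2 * C\<^sub>1)" "2 * ennreal (T\<^sub>0 + 1 - t) = ennreal (2 * (T\<^sub>0 + 1 - t))"
        using t C_nonneg by (simp_all only: ennreal_mult ennreal_numeral zero_le_numeral)
      then show ?thesis using t C_nonneg
        unfolding mult.assoc[symmetric] by (simp only: distrib_right[symmetric]) (subst ennreal_plus; simp)
    qed
    finally show ?thesis .
  qed
  \<comment> \<open>One factor exp t absorbs the linear loss, because 1 + y \<le> exp y; the other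
    keeps the integral over \<open>t\<close> below \<open>T\<^sub>0\<close> finite.\<close>
  have weight: "exp (2 * t) * (2 * C\<^sub>1 + 2 * (T\<^sub>0 + 1 - t)) \<le> C\<^sub>2 * exp t" if t: "t < T\<^sub>0" for t
  proof -
    have 1: "exp t * (T\<^sub>0 + 1 - t) \<le> exp T\<^sub>0"
    proof -
      have "T\<^sub>0 + 1 - t \<le> exp (T\<^sub>0 - t)" using exp_ge_add_one_self[of "T\<^sub>0 - t"] by linarith
      then have "exp t * (T\<^sub>0 + 1 - t) \<le> exp t * exp (T\<^sub>0 - t)" by (intro mult_left_mono) auto
      then show ?thesis by (simp flip: exp_add)
    qed
    have "exp t * (2 * C\<^sub>1 + 2 * (T\<^sub>0 + 1 - t)) = 2 * C\<^sub>1 * exp t + 2 * (exp t * (T\<^sub>0 + 1 - t))"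
      by (simp add: algebra_simps)
    also have "\<dots> \<le> 2 * C\<^sub>1 * exp T\<^sub>0 + 2 * exp T\<^sub>0"
      using t C_nonneg 1 by (intro add_mono mult_left_mono) auto
    also have "\<dots> = C\<^sub>2" by (simp add: C\<^sub>2_def algebra_simps)
    finally have "exp t * (exp t * (2 * C\<^sub>1 + 2 * (T\<^sub>0 + 1 - t))) \<le> exp t * C\<^sub>2" by (intro mult_left_mono) auto
    then show ?thesis by (simp add: mult.assoc[symmetric] exp_add[symmetric] mult.commute)
  qed
  let ?w = "\<lambda>t. ennreal (if t < T\<^sub>0 then exp (2 * t) else 1)"
  have "(\<integral>\<^sup>+z\<in>cylinder. (?w (fst z) * ennreal ((cmod (U z))\<^sup>2)) \<partial>lborel) = (\<integral>\<^sup>+t. ?w t * S t \<partial>lborel)"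
    unfolding cylinder_def S_def
    by (subst nn_integral_box(1)) (simp_all add: mult.assoc nn_integral_cmult cong: if_cong)
  \<comment> \<open>The cutoff is written in terms of exp t so that the substitution r = exp t
    evaluates the integral as the length of an interval.\<close>
  also have "\<dots> \<le> (\<integral>\<^sup>+t. (indicator {..exp T\<^sub>0} (exp t) * ennreal (exp t) * (ennreal C\<^sub>2 * Q) + ennreal C\<^sub>1 * N t) \<partial>lborel)"
  proof (rule nn_integral_mono)
    fix t
    show "?w t * S t \<le> indicator {..exp T\<^sub>0} (exp t) * ennreal (exp t) * (ennreal C\<^sub>2 * Q) + ennreal C\<^sub>1 * N t"
    proof (cases "t < T\<^sub>0")
      case True
      have "ennreal (exp (2 * t)) * S t \<le> ennreal (exp (2 * t)) * (ennreal (2 * C\<^sub>1 + 2 * (T\<^sub>0 + 1 - t)) * Q)"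
        by (intro mult_left_mono S_inner True) simp
      also have "\<dots> = ennreal (exp (2 * t) * (2 * C\<^sub>1 + 2 * (T\<^sub>0 + 1 - t))) * Q"
        using True C_nonneg by (simp add: ennreal_mult mult.assoc)
      also have "\<dots> \<le> ennreal (C\<^sub>2 * exp t) * Q"
        by (intro mult_right_mono ennreal_leI weight True) simp
      also have "\<dots> = ennreal (exp t) * (ennreal C\<^sub>2 * Q)"
        using C_nonneg by (simp add: ennreal_mult ac_simps)
      finally show ?thesis using True by (simp add: add_increasing2)
    next
      case False
      then show ?thesis using S_N[of t] by (simp add: add_increasing)
    qed
  qed
  also have "\<dots> = (\<integral>\<^sup>+t. indicator {..exp T\<^sub>0} (exp t) * ennreal (exp t) \<partial>lborel) * (ennreal C\<^sub>2 * Q) + ennreal C\<^sub>1 * (\<integral>\<^sup>+t. N t \<partial>lborel)"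
    by (subst nn_integral_add) (simp_all add: nn_integral_cmult nn_integral_multc)
  also have "(\<integral>\<^sup>+t. indicator {..exp T\<^sub>0} (exp t) * ennreal (exp t) \<partial>lborel) = ennreal (exp T\<^sub>0)"
  proof -
    have "(\<integral>\<^sup>+t. indicator {..exp T\<^sub>0} (exp t) * ennreal (exp t) \<partial>lborel) = (\<integral>\<^sup>+r\<in>{0<..}. indicator {..exp T\<^sub>0} r \<partial>lborel)"
      by (rule nn_integral_exp_substitution[symmetric]) measurable
    also have "\<dots> = (\<integral>\<^sup>+r. indicator {0<..exp T\<^sub>0} r \<partial>lborel)"
      by (intro nn_integral_cong) (auto simp: indicator_def)
    finally show ?thesis by simp
  qed
  also have "ennreal (exp T\<^sub>0) * (ennreal C\<^sub>2 * Q) + ennreal C\<^sub>1 * (\<integral>\<^sup>+t. N t \<partial>lborel)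
      \<le> ennreal (exp T\<^sub>0) * (ennreal C\<^sub>2 * Q) + ennreal C\<^sub>1 * Q"
    by (intro add_left_mono mult_left_mono N_Q) simp
  also have "\<dots> = ennreal C\<^sub>3 * Q"
    using C_nonneg unfolding C\<^sub>3_def by (subst ennreal_plus) (simp_all add: distrib_right distrib_left ennreal_mult ac_simps)
  finally show ?thesis unfolding Q_def .
qed

definition C\<^sub>4 :: real where "C\<^sub>4 = 2 + 2 * M\<^sup>2 * C\<^sub>3 + C\<^sub>3"

lemma C\<^sub>4_pos: "0 < C\<^sub>4"
  using C_nonneg by (auto simp: C\<^sub>4_def intro!: add_pos_nonneg)

text \<open>Removing the field costs 2 P^2 |U|^2, and P^2 is at most M^2 times the Hardy weight in
  both regions. The outer mass is bounded by the same weighted integral.\<close>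

theorem energy_le_magnetic_energy:
  assumes cyl: "cyl_fun U Ut Uh" and per: "\<And>t. U (t, 2 * pi) = U (t, 0)"
  shows "cyl_fun.energy Ut Uh cylinder + cyl_fun.outer_mass U \<le> ennreal C\<^sub>4 * magnetic_energy U Ut Uh"
proof -
  interpret cyl_fun U Ut Uh by (rule cyl)
  define Q where "Q = magnetic_energy U Ut Uh"
  let ?w = "\<lambda>t. ennreal (if t < T\<^sub>0 then exp (2 * t) else 1)"
  define Y where "Y = (\<integral>\<^sup>+z\<in>cylinder. (?w (fst z) * ennreal ((cmod (U z))\<^sup>2)) \<partial>lborel)"
  have Y: "Y \<le> ennreal C\<^sub>3 * Q" unfolding Y_def Q_def by (rule magnetic_hardy[OF assms])
  have "outer_mass \<le> Y"
    unfolding outer_mass_def Y_def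
  proof (intro nn_integral_mono mult_right_mono)
    fix z :: "real \<times> real"
    show "ennreal ((cmod (U z))\<^sup>2) * indicator {0..} (fst z) \<le> ?w (fst z) * ennreal ((cmod (U z))\<^sup>2)"
    proof (cases "0 \<le> fst z")
      case True
      \<comment> \<open>For t between 0 and \<open>T\<^sub>0\<close> the weight is exp (2 t), which
        is still at least 1.\<close>
      have "1 \<le> ?w (fst z)" using True by auto
      from mult_right_mono[OF this, of "ennreal ((cmod (U z))\<^sup>2)"] show ?thesis using True by simp
    qed simp
  qed simp
  then have outer: "outer_mass \<le> ennreal C\<^sub>3 * Q" using Y by simp
  have "energy cylinder \<le> (\<integral>\<^sup>+z. (2 * (ennreal ((cmod (Ut z))\<^sup>2 + (cmod (Uh z - \<i> * of_real (P (fst z)) * U z))\<^sup>2) * indicator cylinder z)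
      + ennreal (2 * M\<^sup>2) * (?w (fst z) * ennreal ((cmod (U z))\<^sup>2) * indicator cylinder z)) \<partial>lborel)"
    unfolding energy_def
  proof (rule nn_integral_mono)
    fix z :: "real \<times> real"
    let ?p = "P (fst z)" and ?W = "if fst z < T\<^sub>0 then exp (2 * fst z) else 1"
    have "(cmod (Uh z))\<^sup>2 \<le> 2 * (cmod (Uh z - \<i> * of_real ?p * U z))\<^sup>2 + 2 * (cmod (\<i> * of_real ?p * U z))\<^sup>2"
      using cmod_add_sq[of "Uh z - \<i> * of_real ?p * U z" "\<i> * of_real ?p * U z"] by simp
    also have "(cmod (\<i> * of_real ?p * U z))\<^sup>2 = ?p\<^sup>2 * (cmod (U z))\<^sup>2"
      by (simp add: norm_mult power_mult_distrib)
    also have "?p\<^sup>2 \<le> M\<^sup>2 * ?W"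
    proof (cases "fst z < T\<^sub>0")
      case True
      have "?p\<^sup>2 \<le> (M * exp (fst z))\<^sup>2" using P_bound(2)[of "fst z"] by (metis abs_ge_zero power2_abs power_mono)
      then show ?thesis using True by (simp add: power_mult_distrib flip: exp_of_nat_mult)
    next
      case False
      have "?p\<^sup>2 \<le> M\<^sup>2" using P_bound(1)[of "fst z"] by (metis abs_ge_zero power2_abs power_mono)
      then show ?thesis using False by simp
    qed
    finally have "(cmod (Uh z))\<^sup>2 \<le> 2 * (cmod (Uh z - \<i> * of_real ?p * U z))\<^sup>2 + 2 * (M\<^sup>2 * ?W * (cmod (U z))\<^sup>2)"
      by (simp add: mult_right_mono)
    then have "(cmod (Ut z))\<^sup>2 + (cmod (Uh z))\<^sup>2 \<le> 2 * ((cmod (Ut z))\<^sup>2 + (cmod (Uh z - \<i> * of_real ?p * U z))\<^sup>2) + 2 * M\<^sup>2 * (?W * (cmod (U z))\<^sup>2)"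
      unfolding mult.assoc by (intro add_two_mult_le zero_le_power2)
    then have "ennreal ((cmod (Ut z))\<^sup>2 + (cmod (Uh z))\<^sup>2)
        \<le> ennreal (2 * ((cmod (Ut z))\<^sup>2 + (cmod (Uh z - \<i> * of_real ?p * U z))\<^sup>2) + 2 * M\<^sup>2 * (?W * (cmod (U z))\<^sup>2))"
      by (rule ennreal_leI)
    also have "\<dots> = 2 * ennreal ((cmod (Ut z))\<^sup>2 + (cmod (Uh z - \<i> * of_real ?p * U z))\<^sup>2) + ennreal (2 * M\<^sup>2) * (ennreal ?W * ennreal ((cmod (U z))\<^sup>2))"
      by (simp add: ennreal_plus ennreal_mult del: ennreal_plus[symmetric])
    finally show "ennreal ((cmod (Ut z))\<^sup>2 + (cmod (Uh z))\<^sup>2) * indicator cylinder z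
      \<le> 2 * (ennreal ((cmod (Ut z))\<^sup>2 + (cmod (Uh z - \<i> * of_real ?p * U z))\<^sup>2) * indicator cylinder z)
        + ennreal (2 * M\<^sup>2) * (?w (fst z) * ennreal ((cmod (U z))\<^sup>2) * indicator cylinder z)"
      by (cases "z \<in> cylinder") (simp_all split del: if_split)
  qed
  also have "\<dots> = 2 * Q + ennreal (2 * M\<^sup>2) * Y"
    unfolding Q_def magnetic_energy_def Y_def by (subst nn_integral_add) (simp_all add: nn_integral_cmult)
  also have "\<dots> \<le> 2 * Q + ennreal (2 * M\<^sup>2) * (ennreal C\<^sub>3 * Q)"
    by (intro add_left_mono mult_left_mono Y) simp
  finally have "energy cylinder + outer_mass \<le> 2 * Q + ennreal (2 * M\<^sup>2) * (ennreal C\<^sub>3 * Q) + ennreal C\<^sub>3 * Q"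
    by (intro add_mono outer)
  also have "\<dots> = ennreal C\<^sub>4 * Q"
    using C_nonneg by (simp add: C\<^sub>4_def ennreal_plus ennreal_mult distrib_right mult.assoc)
  finally show ?thesis unfolding Q_def .
qed

end

section \<open>Test functions and the flux\<close>

lemma frechet_derivative_coordinates:
  fixes u :: "real^2 \<Rightarrow> complex"
  assumes "u differentiable (at x)"
  shows "frechet_derivative u (at x) h = of_real (h$1) * partial_deriv 1 u x + of_real (h$2) * partial_deriv 2 u x"
proof -
  interpret linear "frechet_derivative u (at x)" by (rule linear_frechet_derivative[OF assms])
  have "h = h$1 *\<^sub>R axis 1 1 + h$2 *\<^sub>R axis 2 1"
    by (simp add: vec_eq_iff forall_2 axis_def)
  then have "frechet_derivative u (at x) h = frechet_derivative u (at x) (h$1 *\<^sub>R axis 1 1 + h$2 *\<^sub>R axis 2 1)"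
    by simp
  then show ?thesis by (simp add: add scale partial_deriv_def) (simp add: scaleR_conv_of_real)
qed

lemma partial_deriv_eqI:
  "(u has_derivative u') (at x) \<Longrightarrow> partial_deriv j u x = u' (axis j 1)"
  unfolding partial_deriv_def using frechet_derivative_at by metis

lemma has_derivative_partial:
  "u differentiable (at x) \<Longrightarrow> (u has_derivative frechet_derivative u (at x)) (at x)"
  using frechet_derivative_works by blast

lemma partial_deriv_lincomb:
  assumes "u differentiable (at x)" "v differentiable (at x)"
  shows "partial_deriv j (\<lambda>x. u x + c * v x) x = partial_deriv j u x + c * partial_deriv j v x"
proof -
  have "((\<lambda>x. u x + c * v x) has_derivative (\<lambda>h. frechet_derivative u (at x) h + c * frechet_derivative v (at x) h)) (at x)"
    by (intro derivative_intros has_derivative_partial assms)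
  then show ?thesis by (subst partial_deriv_eqI) (auto simp: partial_deriv_def)
qed

lemma Ck_lincomb: "Ck k u \<Longrightarrow> Ck k v \<Longrightarrow> Ck k (\<lambda>x. u x + c * v x)"
proof (induction k arbitrary: u v)
  case 0
  then show ?case by (auto intro!: continuous_intros)
next
  case (Suc k)
  have "partial_deriv j (\<lambda>x. u x + c * v x) = (\<lambda>x. partial_deriv j u x + c * partial_deriv j v x)" for j
    using Suc.prems by (simp add: fun_eq_iff partial_deriv_lincomb)
  with Suc show ?case by (auto intro!: derivative_intros)
qed

lemma Ck_zero: "Ck k (\<lambda>_. 0)"
proof (induction k)
  case (Suc k)
  have "partial_deriv j (\<lambda>_. 0) = (\<lambda>_. 0)" for j by (simp add: partial_deriv_def fun_eq_iff)
  with Suc show ?case by simp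
qed simp

lemma test_zero: "(\<lambda>_. 0) \<in> test_functions"
  by (simp add: test_functions_def Ck_zero)

lemma test_support: "u \<in> test_functions \<Longrightarrow> compact (closure {x. u x \<noteq> 0})"
  by (simp add: test_functions_def)

lemma compact_support_subset:
  fixes u :: "'a::t2_space \<Rightarrow> complex"
  assumes "compact K" "\<And>x. x \<notin> K \<Longrightarrow> u x = 0"
  shows "compact (closure {x. u x \<noteq> 0})"
proof -
  have "closure {x. u x \<noteq> 0} \<subseteq> K"
    using assms by (intro closure_minimal) (auto intro: compact_imp_closed)
  then have "closure {x. u x \<noteq> 0} = K \<inter> closure {x. u x \<noteq> 0}" by blast
  then show ?thesis by (metis assms(1) closed_closure compact_Int_closed)
qed

lemma outside_support: "x \<notin> closure {x. u x \<noteq> 0} \<Longrightarrow> u x = 0"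
  using closure_subset[of "{x. u x \<noteq> 0}"] by auto

lemma test_lincomb:
  assumes "u \<in> test_functions" "v \<in> test_functions"
  shows "(\<lambda>x. u x + c * v x) \<in> test_functions"
proof -
  have "compact (closure {x. u x + c * v x \<noteq> 0})"
  proof (rule compact_support_subset)
    show "compact (closure {x. u x \<noteq> 0} \<union> closure {x. v x \<noteq> 0})"
      using assms by (intro compact_Un test_support)
    fix x assume "x \<notin> closure {x. u x \<noteq> 0} \<union> closure {x. v x \<noteq> 0}"
    then have "u x = 0" "v x = 0" using outside_support[of x u] outside_support[of x v] by auto
    then show "u x + c * v x = 0" by simp
  qed
  then show ?thesis using assms by (auto simp: test_functions_def intro: Ck_lincomb)
qed

lemma test_add: "u \<in> test_functions \<Longrightarrow> v \<in> test_functions \<Longrightarrow> (\<lambda>x. u x + v x) \<in> test_functions"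
  using test_lincomb[of u v 1] by simp

lemma test_scale: "u \<in> test_functions \<Longrightarrow> (\<lambda>x. c * u x) \<in> test_functions"
  using test_lincomb[of "\<lambda>_. 0" u c] test_zero by simp

lemma test_diff: "u \<in> test_functions \<Longrightarrow> v \<in> test_functions \<Longrightarrow> (\<lambda>x. u x - v x) \<in> test_functions"
  using test_lincomb[of u v "-1"] by simp

lemma test_differentiable: "u \<in> test_functions \<Longrightarrow> u differentiable (at x)"
  unfolding test_functions_def by (auto dest: spec[of _ "Suc 0"])

lemma test_continuous: "u \<in> test_functions \<Longrightarrow> continuous_on UNIV u"
  unfolding test_functions_def by (auto dest: spec[of _ 0])

lemma partial_deriv_outside:
  assumes "x \<notin> closure {x. u x \<noteq> 0}"
  shows "partial_deriv j u x = 0"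
proof -
  have "(u has_derivative (\<lambda>_. 0)) (at x)"
  proof (rule has_derivative_transform_within_open)
    show "((\<lambda>_. 0) has_derivative (\<lambda>_. 0)) (at x)" by (rule has_derivative_const)
    show "open (- closure {x. u x \<noteq> 0})" by (intro open_Compl closed_closure)
    show "x \<in> - closure {x. u x \<noteq> 0}" using assms by simp
    show "0 = u y" if "y \<in> - closure {x. u x \<noteq> 0}" for y using outside_support[of y u] that by simp
  qed
  then show ?thesis by (simp add: partial_deriv_eqI)
qed

lemma test_partial: "u \<in> test_functions \<Longrightarrow> partial_deriv j u \<in> test_functions"
proof -
  assume u: "u \<in> test_functions"
  have "Ck k (partial_deriv j u)" for k
    using u unfolding test_functions_def by (auto dest: spec[of _ "Suc k"])
  moreover have "compact (closure {x. partial_deriv j u x \<noteq> 0})"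
    by (rule compact_support_subset[OF test_support[OF u] partial_deriv_outside])
  ultimately show ?thesis by (simp add: test_functions_def)
qed

lemma test_partial_lincomb:
  "u \<in> test_functions \<Longrightarrow> v \<in> test_functions \<Longrightarrow>
    partial_deriv j (\<lambda>x. u x + c * v x) x = partial_deriv j u x + c * partial_deriv j v x"
  by (intro partial_deriv_lincomb test_differentiable)

lemma test_measurable [measurable_dest]: "u \<in> test_functions \<Longrightarrow> u \<in> borel_measurable borel"
  by (intro borel_measurable_continuous_onI test_continuous)

lemma test_measurable_lebesgue: "u \<in> test_functions \<Longrightarrow> u \<in> borel_measurable lebesgue"
  by (intro measurable_completion) (simp add: test_measurable)

lemma test_bounded: "u \<in> test_functions \<Longrightarrow> \<exists>C>0. \<forall>x. cmod (u x) \<le> C"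
proof -
  assume u: "u \<in> test_functions"
  have "bounded (u ` closure {x. u x \<noteq> 0})"
    by (intro compact_imp_bounded compact_continuous_image continuous_on_subset[OF test_continuous[OF u]] test_support[OF u]) simp
  then obtain C where C: "C > 0" "\<And>x. x \<in> closure {x. u x \<noteq> 0} \<Longrightarrow> cmod (u x) \<le> C"
    by (auto simp: bounded_pos)
  have "cmod (u x) \<le> C" for x
    using C outside_support[of x u] by (cases "x \<in> closure {x. u x \<noteq> 0}") auto
  with C show ?thesis by blast
qed

text \<open>Serves both for the components of the vector potential, which are bounded, and for the
  constant 1.\<close>

lemma bounded_mult_test_L2:
  assumes g: "g \<in> borel_measurable lebesgue" "\<And>x. cmod (g x) \<le> C" and u: "u \<in> test_functions"
  shows "(\<lambda>x. g x * u x) \<in> L2 lebesgue"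
proof -
  obtain C' where C': "C' > 0" "\<And>x. cmod (u x) \<le> C'" using test_bounded[OF u] by blast
  let ?K = "closure {x. u x \<noteq> 0}"
  have m: "(\<lambda>x. g x * u x) \<in> borel_measurable lebesgue"
    using g test_measurable_lebesgue[OF u] by measurable
  have "integrable lebesgue (\<lambda>x. (cmod (g x * u x))\<^sup>2)"
  proof (rule Bochner_Integration.integrable_bound)
    have "emeasure lebesgue ?K < \<infinity>"
      using lmeasurable_compact[OF test_support[OF u]] by (simp add: fmeasurable_def)
    then show "integrable lebesgue (\<lambda>x. (C * C')\<^sup>2 * indicator ?K x :: real)"
      using lmeasurable_compact[OF test_support[OF u]] by (intro integrable_mult_right) (auto simp: fmeasurable_def)
    show "(\<lambda>x. (cmod (g x * u x))\<^sup>2) \<in> borel_measurable lebesgue" using m by measurable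
    have "(cmod (g x * u x))\<^sup>2 \<le> (C * C')\<^sup>2 * indicator ?K x" for x
    proof (cases "x \<in> ?K")
      case True
      have "cmod (g x * u x) \<le> C * C'"
        unfolding norm_mult using g(2)[of x] C'(2)[of x] order_trans[OF norm_ge_zero g(2)[of x]] by (intro mult_mono) auto
      then show ?thesis using True by (simp add: power_mono)
    next
      case False
      then show ?thesis using outside_support[of x u] by simp
    qed
    then show "AE x in lebesgue. norm ((cmod (g x * u x))\<^sup>2) \<le> norm ((C * C')\<^sup>2 * indicator ?K x :: real)"
      by simp
  qed
  with m show ?thesis by (simp add: L2_def)
qed

lemma test_L2: "u \<in> test_functions \<Longrightarrow> u \<in> L2 lebesgue"
  using bounded_mult_test_L2[of "\<lambda>_. 1" 1 u] by simp

text \<open>By translation invariance every difference quotient has integral 0; dominated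
  convergence passes to the derivative.\<close>

lemma integral_directional_derivative_zero:
  fixes f p :: "real^2 \<Rightarrow> complex"
  assumes der: "\<And>x t. ((\<lambda>t. f (x + t *\<^sub>R e)) has_vector_derivative p (x + t *\<^sub>R e)) (at t)"
    and contf: "continuous_on UNIV f" and contp: "continuous_on UNIV p"
    and K: "compact K" "\<And>x. x \<notin> K \<Longrightarrow> f x = 0" "\<And>x. x \<notin> K \<Longrightarrow> p x = 0"
  shows "(LINT x|lborel. p x) = 0"
proof -
  have [measurable]: "f \<in> borel_measurable borel" "p \<in> borel_measurable borel"
    using contf contp by (auto intro: borel_measurable_continuous_onI)
  define h where "h = (\<lambda>n. 1 / real (Suc n))"
  have h: "0 < h n" "h n \<le> 1" for n by (auto simp: h_def)
  have hlim: "h \<longlonglongrightarrow> 0" unfolding h_def by (rule LIMSEQ_Suc[OF lim_1_over_n])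
  have "bounded (p ` K)"
    by (intro compact_imp_bounded compact_continuous_image continuous_on_subset[OF contp] K(1)) simp
  then obtain C where C: "C > 0" "\<And>x. x \<in> K \<Longrightarrow> cmod (p x) \<le> C" by (auto simp: bounded_pos)
  have pC: "cmod (p x) \<le> C" for x using C K(3)[of x] by (cases "x \<in> K") auto
  \<comment> \<open>The points that reach \<open>K\<close> by a step of length at most 1 along
    \<open>e\<close>: a compact set supporting all difference quotients.\<close>
  define K' where "K' = (\<lambda>(y, s). y - s *\<^sub>R e) ` (K \<times> {0..1::real})"
  have "compact K'"
    unfolding K'_def using K(1) by (intro compact_continuous_image compact_Times) (auto intro!: continuous_intros simp: split_beta)
  have finf: "integrable lborel f"
  proof -
    have "integrable lborel (\<lambda>x. indicator K x *\<^sub>R f x)"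
      by (intro borel_integrable_compact continuous_on_subset[OF contf] K(1)) simp
    moreover have "(\<lambda>x. indicator K x *\<^sub>R f x) = f" using K(2) by (auto simp: indicator_def fun_eq_iff)
    ultimately show ?thesis by simp
  qed
  define d where "d = (\<lambda>n x. (f (x + h n *\<^sub>R e) - f x) /\<^sub>R h n)"
  have trans: "integrable lborel (\<lambda>x. f (x + c))" "(LINT x|lborel. f (x + c)) = (LINT x|lborel. f x)" for c
  proof -
    have D: "distr lborel borel ((+) c) = (lborel :: (real^2) measure)" by (rule lborel_distr_plus)
    have "integrable (distr lborel borel ((+) c)) f" unfolding D by (rule finf)
    then show "integrable lborel (\<lambda>x. f (x + c))"
      by (subst (asm) integrable_distr_eq) (auto simp: add.commute)
    have "(LINT x|distr lborel borel ((+) c). f x) = (LINT x|lborel. f (c + x))"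
      by (intro integral_distr) auto
    then show "(LINT x|lborel. f (x + c)) = (LINT x|lborel. f x)" unfolding D by (simp add: add.commute)
  qed
  have d0: "(LINT x|lborel. d n x) = 0" for n
    unfolding d_def using trans finf by simp
  have "(\<lambda>n. LINT x|lborel. d n x) \<longlonglongrightarrow> (LINT x|lborel. p x)"
  proof (rule integral_dominated_convergence[where w="\<lambda>x. indicator K' x *\<^sub>R C"])
    show "p \<in> borel_measurable lborel" by simp
    show "d n \<in> borel_measurable lborel" for n unfolding d_def by measurable
    show "integrable lborel (\<lambda>x. indicator K' x *\<^sub>R C)"
      by (rule borel_integrable_compact[OF \<open>compact K'\<close>]) (auto intro!: continuous_intros)
    show "AE x in lborel. (\<lambda>n. d n x) \<longlonglongrightarrow> p x"
    proof (rule AE_I2)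
      fix x
      have "((\<lambda>t. f (x + t *\<^sub>R e)) has_derivative (\<lambda>s. s *\<^sub>R p x)) (at 0)"
        using der[of x 0] by (simp add: has_vector_derivative_def)
      then have L: "((\<lambda>s. norm (f (x + s *\<^sub>R e) - f x - s *\<^sub>R p x) / norm s) \<longlongrightarrow> 0) (at 0)"
        unfolding has_derivative_at by simp
      have "filterlim h (at 0) sequentially"
        unfolding filterlim_at using h(1) hlim by (auto intro!: always_eventually simp: less_le)
      from filterlim_compose[OF L this]
      have "(\<lambda>n. norm (f (x + h n *\<^sub>R e) - f x - h n *\<^sub>R p x) / norm (h n)) \<longlonglongrightarrow> 0" .
      moreover have "norm (f (x + h n *\<^sub>R e) - f x - h n *\<^sub>R p x) / norm (h n) = norm (d n x - p x)" for n
      proof -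
        have "f (x + h n *\<^sub>R e) - f x - h n *\<^sub>R p x = h n *\<^sub>R (d n x - p x)"
          using h(1)[of n] by (simp add: d_def scaleR_diff_right)
        then show ?thesis using h(1)[of n] by simp
      qed
      ultimately have "(\<lambda>n. norm (d n x - p x)) \<longlonglongrightarrow> 0" by simp
      then show "(\<lambda>n. d n x) \<longlonglongrightarrow> p x"
        by (simp add: tendsto_norm_zero_iff LIM_zero_iff)
    qed
    show "AE x in lborel. cmod (d n x) \<le> indicator K' x *\<^sub>R C" for n
    proof (rule AE_I2)
      fix x
      show "cmod (d n x) \<le> indicator K' x *\<^sub>R C"
      proof (cases "x \<in> K'")
        case True
        have "cmod (f (x + h n *\<^sub>R e) - f (x + 0 *\<^sub>R e)) \<le> C * norm (h n - 0)"
        proof (rule differentiable_bound[where S="{0..h n}" and f'="\<lambda>t s. s *\<^sub>R p (x + t *\<^sub>R e)"])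
          show "((\<lambda>t. f (x + t *\<^sub>R e)) has_derivative (\<lambda>s. s *\<^sub>R p (x + t *\<^sub>R e))) (at t within {0..h n})" for t
            using der[of x t] unfolding has_vector_derivative_def by (rule has_derivative_at_withinI)
          show "onorm (\<lambda>s. s *\<^sub>R p (x + t *\<^sub>R e)) \<le> C" for t
          proof (rule onorm_le)
            fix s :: real
            have "\<bar>s\<bar> * cmod (p (x + t *\<^sub>R e)) \<le> \<bar>s\<bar> * C" by (intro mult_left_mono pC) simp
            then show "norm (s *\<^sub>R p (x + t *\<^sub>R e)) \<le> C * norm s" by (simp add: mult.commute)
          qed
        qed (use h[of n] in auto)
        moreover have "cmod (d n x) = cmod (f (x + h n *\<^sub>R e) - f x) / h n"
          using h(1)[of n] by (simp add: d_def divide_inverse mult.commute)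
        ultimately show ?thesis using True h[of n] by (simp add: pos_divide_le_eq)
      next
        case False
        have "x + s *\<^sub>R e \<notin> K" if "s \<in> {0..1}" for s
        proof
          assume "x + s *\<^sub>R e \<in> K"
          then have "(\<lambda>(y, s). y - s *\<^sub>R e) (x + s *\<^sub>R e, s) \<in> K'" unfolding K'_def using that by blast
          then show False using False by simp
        qed
        from this[of 0] this[of "h n"] have "f x = 0" "f (x + h n *\<^sub>R e) = 0"
          using h[of n] K(2) by auto
        then show ?thesis using False by (simp add: d_def)
      qed
    qed
  qed
  then show ?thesis using d0 LIMSEQ_unique[OF _ tendsto_const] by simp
qed

text \<open>The derivative of \<open>u\<close> times the conjugate of the derivative of
  \<open>v\<close> has integral 0. Both derivatives thereby fall on \<open>v\<close>, and L^2
  smallness of \<open>u\<close> alone makes the inner product small.\<close>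

lemma integration_by_parts:
  assumes u: "u \<in> test_functions" and v: "v \<in> test_functions"
  shows "l2_inner lebesgue (partial_deriv j u) (partial_deriv j v) = - l2_inner lebesgue u (partial_deriv j (partial_deriv j v))"
proof -
  define g where "g = partial_deriv j v"
  have g: "g \<in> test_functions" unfolding g_def by (rule test_partial[OF v])
  define p where "p = (\<lambda>x. partial_deriv j u x * cnj (g x) + u x * cnj (partial_deriv j g x))"
  have der1: "((\<lambda>t. w (x + t *\<^sub>R axis j 1)) has_vector_derivative partial_deriv j w (x + t *\<^sub>R axis j 1)) (at t)"
    if w: "w \<in> test_functions" for w x t
  proof -
    have "((\<lambda>t. x + t *\<^sub>R axis j 1) has_derivative (\<lambda>s. s *\<^sub>R axis j 1)) (at t)"
      by (auto intro!: derivative_eq_intros)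
    from has_derivative_compose[OF this has_derivative_partial[OF test_differentiable[OF w]]]
    show ?thesis
      unfolding has_vector_derivative_def partial_deriv_def
      by (simp add: linear_cmul[OF linear_frechet_derivative[OF test_differentiable[OF w]]])
  qed
  have "(LINT x|lborel. p x) = 0"
  proof (rule integral_directional_derivative_zero[where f="\<lambda>x. u x * cnj (g x)" and e="axis j 1" and K="closure {x. u x \<noteq> 0}"])
    fix x t
    show "((\<lambda>t. u (x + t *\<^sub>R axis j 1) * cnj (g (x + t *\<^sub>R axis j 1))) has_vector_derivative p (x + t *\<^sub>R axis j 1)) (at t)"
      unfolding p_def
      using has_vector_derivative_mult[OF der1[OF u, of x t] has_vector_derivative_cnj[OF der1[OF g, of x t]]]
      by (simp add: algebra_simps)
  next
    show "continuous_on UNIV (\<lambda>x. u x * cnj (g x))"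
      by (intro continuous_intros test_continuous u g)
    show "continuous_on UNIV p" unfolding p_def
      by (intro continuous_intros test_continuous test_partial u g)
    show "compact (closure {x. u x \<noteq> 0})" by (rule test_support[OF u])
    fix x assume x: "x \<notin> closure {x. u x \<noteq> 0}"
    show "u x * cnj (g x) = 0" using outside_support[OF x] by simp
    show "p x = 0" using outside_support[OF x] partial_deriv_outside[OF x] by (simp add: p_def)
  qed
  moreover have "(LINT x|lborel. p x) = (LINT x|lebesgue. p x)"
    by (rule integral_completion[symmetric]) (use u g in \<open>simp add: p_def, intro borel_measurable_add borel_measurable_times borel_measurable_cnj test_measurable test_partial\<close>)
  moreover have "(LINT x|lebesgue. p x) = l2_inner lebesgue (partial_deriv j u) g + l2_inner lebesgue u (partial_deriv j g)"
    unfolding p_def l2_inner_def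
    by (intro Bochner_Integration.integral_add L2_integrable_mult test_L2 test_partial u g)
  ultimately show ?thesis by (simp add: g_def eq_neg_iff_add_eq_0)
qed

section \<open>Pullback of test functions to the cylinder\<close>

definition polar_pullback :: "(real^2 \<Rightarrow> complex) \<Rightarrow> real \<times> real \<Rightarrow> complex" where
  "polar_pullback u z = u (pol z)"

text \<open>The chain rule along rays and circles: r times the radial derivative here, the angular
  derivative in \<open>pullback_h\<close>.\<close>

definition pullback_t :: "(real^2 \<Rightarrow> complex) \<Rightarrow> real \<times> real \<Rightarrow> complex" where
  "pullback_t u z = of_real (exp (fst z)) *
     (of_real (cos (snd z)) * partial_deriv 1 u (pol z) + of_real (sin (snd z)) * partial_deriv 2 u (pol z))"

definition pullback_h :: "(real^2 \<Rightarrow> complex) \<Rightarrow> real \<times> real \<Rightarrow> complex" where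
  "pullback_h u z = of_real (exp (fst z)) *
     (of_real (cos (snd z)) * partial_deriv 2 u (pol z) - of_real (sin (snd z)) * partial_deriv 1 u (pol z))"

lemma cyl_fun_pullback:
  assumes u: "u \<in> test_functions"
  shows "cyl_fun (polar_pullback u) (pullback_t u) (pullback_h u)"
proof
  note d = test_differentiable[OF u]
  fix t x :: real
  have chain: "((\<lambda>s. u (\<gamma> s)) has_vector_derivative of_real (v$1) * partial_deriv 1 u (\<gamma> s) + of_real (v$2) * partial_deriv 2 u (\<gamma> s)) (at s)"
    if "(\<gamma> has_derivative (\<lambda>r. r *\<^sub>R v)) (at s)" for \<gamma> s v
    using has_derivative_compose[OF that has_derivative_partial[OF d]]
    unfolding has_vector_derivative_def
    by (simp add: linear_cmul[OF linear_frechet_derivative[OF d]] frechet_derivative_coordinates[OF d])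
      (simp add: scaleR_conv_of_real algebra_simps)
  have "((\<lambda>t. pol (t, x)) has_derivative (\<lambda>r. r *\<^sub>R vector [exp t * cos x, exp t * sin x])) (at t)"
    unfolding pol_axis vector_2_axis fst_conv snd_conv
    by (auto intro!: derivative_eq_intros simp: algebra_simps)
  from chain[OF this] show "((\<lambda>t. polar_pullback u (t, x)) has_vector_derivative pullback_t u (t, x)) (at t)"
    by (simp add: polar_pullback_def pullback_t_def algebra_simps)
  have "((\<lambda>x. pol (t, x)) has_derivative (\<lambda>r. r *\<^sub>R vector [- exp t * sin x, exp t * cos x])) (at x)"
    unfolding pol_axis vector_2_axis fst_conv snd_conv
    by (auto intro!: derivative_eq_intros simp: algebra_simps)
  from chain[OF this] show "((\<lambda>x. polar_pullback u (t, x)) has_vector_derivative pullback_h u (t, x)) (at x)"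
    by (simp add: polar_pullback_def pullback_h_def algebra_simps)
next
  have c: "continuous_on UNIV (\<lambda>z. w (pol z))" if "w \<in> test_functions" for w
    by (rule continuous_on_compose2[OF test_continuous[OF that] continuous_on_pol]) simp
  show "continuous_on UNIV (polar_pullback u)"
    unfolding polar_pullback_def[abs_def] by (rule c[OF u])
  show "continuous_on UNIV (pullback_t u)" "continuous_on UNIV (pullback_h u)"
    unfolding pullback_t_def[abs_def] pullback_h_def[abs_def]
    by (intro continuous_intros c test_partial u)+
qed

lemma pullback_periodic: "polar_pullback u (t, 2 * pi) = polar_pullback u (t, 0)"
  by (simp add: polar_pullback_def pol_def)

section \<open>Bounds and limit of the flux\<close>

lemma AE_exp_pullback:
  assumes "AE r in lborel. 0 < r \<longrightarrow> P (r::real)"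
  shows "AE t in lborel. P (exp t)"
proof -
  obtain N where N: "{r. \<not> (0 < r \<longrightarrow> P r)} \<subseteq> N" "N \<in> sets borel" "emeasure lborel N = 0"
    using assms by (auto elim!: AE_E)
  have [measurable]: "N \<in> sets borel" by fact
  have "(\<integral>\<^sup>+r\<in>{0<..}. indicator N r \<partial>lborel) \<le> (\<integral>\<^sup>+r. indicator N r \<partial>lborel)"
    by (intro nn_integral_mono) (simp add: indicator_def)
  then have "(\<integral>\<^sup>+r\<in>{0<..}. indicator N r \<partial>lborel) = 0" using N by simp
  then have "(\<integral>\<^sup>+t. indicator N (exp t) * ennreal (exp t) \<partial>lborel) = 0"
    by (subst (asm) nn_integral_exp_substitution) auto
  then have "AE t in lborel. indicator N (exp t) * ennreal (exp t) = 0"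
    by (subst (asm) nn_integral_0_iff_AE) auto
  then show ?thesis
  proof eventually_elim
    case (elim t)
    then have "exp t \<notin> N" by (auto simp: indicator_def split: if_splits)
    then show "P (exp t)" using N(1) exp_gt_zero[of t] by blast
  qed
qed

locale radial_field =
  fixes B :: "real^2 \<Rightarrow> real" and b :: "real \<Rightarrow> real"
  assumes radial: "\<And>x. B x = b (norm x)"
    and integrable_profile: "set_integrable lebesgue {0<..} (\<lambda>r. b r * (1 + r))"
    and flux_not_integer: "total_flux B \<notin> \<int>"
begin

text \<open>A non-integrable field would have the Bochner integral \<open>0\<close>, hence an integral total flux.\<close>

lemma B_integrable: "integrable lebesgue B"
proof (rule ccontr)
  assume "\<not> integrable lebesgue B"
  then have "total_flux B = 0" by (simp add: total_flux_def not_integrable_integral_eq)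
  with flux_not_integer show False by simp
qed

lemma B_meas [measurable]: "B \<in> borel_measurable lebesgue"
  using B_integrable by simp

lemma ball_eq: "{x :: real^2. norm x \<le> r} = cball 0 r"
  by (auto simp: dist_norm)

lemma cball_lebesgue [measurable, simp]: "cball (0 :: real^2) r \<in> sets lebesgue"
  by simp

lemma flux_le_nn_integral:
  "ennreal (2 * pi * \<bar>flux B r\<bar>) \<le> (\<integral>\<^sup>+x\<in>cball 0 r. ennreal \<bar>B x\<bar> \<partial>lebesgue)"
proof -
  have "integrable lebesgue (\<lambda>x. indicator (cball 0 r) x *\<^sub>R B x)"
    by (intro integrable_mult_indicator B_integrable) simp
  then have "ennreal (norm (LINT x|lebesgue. indicator (cball 0 r) x *\<^sub>R B x))
      \<le> (\<integral>\<^sup>+x. ennreal (norm (indicator (cball 0 r) x *\<^sub>R B x)) \<partial>lebesgue)"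
    by (rule integral_norm_bound_ennreal)
  moreover have "2 * pi * \<bar>flux B r\<bar> = norm (LINT x|lebesgue. indicator (cball 0 r) x *\<^sub>R B x)"
    by (simp add: flux_def set_lebesgue_integral_def ball_eq)
  moreover have "(\<integral>\<^sup>+x. ennreal (norm (indicator (cball 0 r) x *\<^sub>R B x)) \<partial>lebesgue) = (\<integral>\<^sup>+x\<in>cball 0 r. ennreal \<bar>B x\<bar> \<partial>lebesgue)"
    by (intro nn_integral_cong) (simp add: indicator_def)
  ultimately show ?thesis by simp
qed

lemma flux_bounded: "\<exists>M\<ge>0. \<forall>r. \<bar>flux B r\<bar> \<le> M"
proof -
  define I where "I = (LINT x|lebesgue. \<bar>B x\<bar>)"
  have I: "(\<integral>\<^sup>+x. ennreal \<bar>B x\<bar> \<partial>lebesgue) = ennreal I"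
    unfolding I_def by (rule nn_integral_eq_integral) (use B_integrable in auto)
  have I0: "0 \<le> I" by (simp add: I_def)
  have "\<bar>flux B r\<bar> \<le> I" for r
  proof -
    have "ennreal (2 * pi * \<bar>flux B r\<bar>) \<le> (\<integral>\<^sup>+x. ennreal \<bar>B x\<bar> \<partial>lebesgue)"
      by (rule order_trans[OF flux_le_nn_integral]) (intro nn_integral_mono, simp add: indicator_def)
    then have "2 * pi * \<bar>flux B r\<bar> \<le> I" using I0 by (simp add: I)
    moreover have "1 * \<bar>flux B r\<bar> \<le> 2 * pi * \<bar>flux B r\<bar>" using pi_gt3 by (intro mult_right_mono) auto
    ultimately show ?thesis by simp
  qed
  with I0 show ?thesis by blast
qed

text \<open>In polar coordinates the flux is the integral of b s times s ds up to \<open>r\<close>.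
  Bounding s by \<open>r\<close> leaves the L^1 norm of the profile with respect to dr, which the
  summand 1 in the weight 1 + r provides.\<close>

lemma flux_linear_bound: "\<exists>M\<ge>0. \<forall>r>0. \<bar>flux B r\<bar> \<le> M * r"
proof -
  have fi: "integrable lebesgue (\<lambda>r. indicator {0<..} r *\<^sub>R (b r * (1 + r)))"
    using integrable_profile by (simp add: set_integrable_def)
  then obtain g0 where g0: "g0 \<in> borel_measurable lborel" "AE r in lborel. indicator {0<..} r *\<^sub>R (b r * (1 + r)) = g0 r"
    using completion_ex_borel_measurable_real[OF borel_measurable_integrable[OF fi]] by blast
  \<comment> \<open>A Borel function dominating |b| almost everywhere; it comes from the product of
    \<open>b\<close> with 1 + r, since measurability is known for that product.\<close>
  define g where "g = (\<lambda>r. \<bar>g0 r\<bar>)"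
  have [measurable]: "g \<in> borel_measurable borel" using g0(1) by (simp add: g_def)
  have g: "AE r in lborel. 0 < r \<longrightarrow> \<bar>b r\<bar> \<le> g r"
    using g0(2)
  proof eventually_elim
    case (elim r)
    show ?case
    proof
      assume r: "0 < r"
      then have "g r = \<bar>b r\<bar> * (1 + r)" using elim by (simp add: g_def abs_mult flip: elim)
      also have "\<dots> \<ge> \<bar>b r\<bar> * 1" using r by (intro mult_left_mono) auto
      finally show "\<bar>b r\<bar> \<le> g r" by simp
    qed
  qed
  have "integrable lebesgue g0"
    using fi by (subst integrable_cong_AE[of _ _ "\<lambda>r. indicator {0<..} r *\<^sub>R (b r * (1 + r))"])
      (use g0 fi in \<open>auto simp: AE_completion_iff intro: measurable_completion\<close>)
  then have "integrable lebesgue g" unfolding g_def by simp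
  then have Gfin: "(\<integral>\<^sup>+r. ennreal (g r) \<partial>lborel) < \<infinity>"
    by (auto simp: integrable_iff_bounded nn_integral_completion g_def)
  define G where "G = enn2real (\<integral>\<^sup>+r. ennreal (g r) \<partial>lborel)"
  have G: "(\<integral>\<^sup>+r. ennreal (g r) \<partial>lborel) = ennreal G" "0 \<le> G"
    using Gfin by (simp_all add: G_def less_top)
  have abs_meas: "(\<lambda>x. \<bar>B x\<bar>) \<in> borel_measurable lebesgue" by measurable
  obtain V where V [measurable]: "V \<in> borel_measurable borel" and V0: "\<And>x. 0 \<le> V x" and BV: "AE x in lebesgue. \<bar>B x\<bar> = V x"
    using ex_borel_version[OF abs_meas] by auto
  have "\<bar>flux B r\<bar> \<le> G * r" if r: "0 < r" for r
  proof -
    have cb [measurable]: "cball (0::real^2) r \<in> sets borel" by simp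
    have "ennreal (2 * pi * \<bar>flux B r\<bar>) \<le> (\<integral>\<^sup>+x\<in>cball 0 r. ennreal \<bar>B x\<bar> \<partial>lebesgue)"
      by (rule flux_le_nn_integral)
    also have "\<dots> = (\<integral>\<^sup>+x\<in>cball 0 r. ennreal (V x) \<partial>lebesgue)"
      using BV by (intro nn_integral_cong_AE) auto
    also have "\<dots> = (\<integral>\<^sup>+z\<in>UNIV \<times> {0..<2*pi}. (ennreal (V (pol z)) * indicator (cball 0 r) (pol z) * ennreal (exp (2 * fst z))) \<partial>lborel)"
      unfolding nn_integral_completion by (subst nn_integral_polar) (auto simp: cylinder_def)
    also have "\<dots> = (\<integral>\<^sup>+t. (\<integral>\<^sup>+x\<in>{0..<2*pi}. (ennreal (V (pol (t, x))) * indicator (cball 0 r) (pol (t, x)) * ennreal (exp (2 * t))) \<partial>lborel) \<partial>lborel)"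
      by (subst nn_integral_box(1)) simp_all
    also have "\<dots> \<le> (\<integral>\<^sup>+t. ennreal (2 * pi * r) * (ennreal (g (exp t)) * ennreal (exp t)) \<partial>lborel)"
    proof (rule nn_integral_mono_AE)
      show "AE t in lborel. (\<integral>\<^sup>+x\<in>{0..<2*pi}. (ennreal (V (pol (t, x))) * indicator (cball 0 r) (pol (t, x)) * ennreal (exp (2 * t))) \<partial>lborel)
          \<le> ennreal (2 * pi * r) * (ennreal (g (exp t)) * ennreal (exp t))"
        using AE_angular_sections[OF BV] AE_exp_pullback[OF g]
      proof eventually_elim
        case (elim t)
        have "(\<integral>\<^sup>+x\<in>{0..<2*pi}. (ennreal (V (pol (t, x))) * indicator (cball 0 r) (pol (t, x)) * ennreal (exp (2 * t))) \<partial>lborel)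
            \<le> (\<integral>\<^sup>+x\<in>{0..<2*pi}. (ennreal (r * (g (exp t) * exp t))) \<partial>lborel)"
        proof (rule nn_integral_mono_AE)
          show "AE x in lborel. ennreal (V (pol (t, x))) * indicator (cball 0 r) (pol (t, x)) * ennreal (exp (2 * t)) * indicator {0..<2*pi} x
              \<le> ennreal (r * (g (exp t) * exp t)) * indicator {0..<2*pi} x"
            using elim(1)
          proof eventually_elim
            case (elim x)
            show ?case
            proof (cases "x \<in> {0..<2*pi} \<and> exp t \<le> r")
              case True
              then have "V (pol (t, x)) = \<bar>b (exp t)\<bar>" using elim by (simp add: radial)
              then have "V (pol (t, x)) \<le> g (exp t)" using \<open>\<bar>b (exp t)\<bar> \<le> g (exp t)\<close> by simp
              \<comment> \<open>Of the two factors exp t of the area element, one is bounded by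
                \<open>r\<close>; the other turns dt into dr.\<close>
              then have "V (pol (t, x)) * (exp t * exp t) \<le> g (exp t) * (r * exp t)"
                using True r V0 by (intro mult_mono) (auto simp: g_def)
              then have "V (pol (t, x)) * exp (2 * t) \<le> r * (g (exp t) * exp t)"
                by (simp add: ac_simps flip: exp_add)
              then have "ennreal (V (pol (t, x)) * exp (2 * t)) \<le> ennreal (r * (g (exp t) * exp t))"
                by (rule ennreal_leI)
              then show ?thesis using True V0 by (simp add: ennreal_mult)
            qed (auto simp: indicator_def)
          qed
        qed
        also have "\<dots> = ennreal (r * (g (exp t) * exp t)) * ennreal (2 * pi)"
          by (subst nn_integral_cmult_indicator) simp_all
        also have "\<dots> = ennreal (2 * pi * r) * (ennreal (g (exp t)) * ennreal (exp t))"
          using r by (simp add: ennreal_mult g_def ac_simps)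
        finally show ?case .
      qed
    qed
    also have "\<dots> = ennreal (2 * pi * r) * (\<integral>\<^sup>+t. ennreal (g (exp t)) * ennreal (exp t) \<partial>lborel)"
      by (rule nn_integral_cmult) measurable
    also have "(\<integral>\<^sup>+t. ennreal (g (exp t)) * ennreal (exp t) \<partial>lborel) = (\<integral>\<^sup>+r\<in>{0<..}. ennreal (g r) \<partial>lborel)"
      by (rule nn_integral_exp_substitution[symmetric]) measurable
    also have "\<dots> \<le> ennreal G"
      unfolding G(1)[symmetric] by (intro nn_integral_mono) (simp add: indicator_def)
    finally have "ennreal (2 * pi * \<bar>flux B r\<bar>) \<le> ennreal (2 * pi * r) * ennreal G"
      by (simp add: mult_left_mono)
    also have "\<dots> = ennreal (2 * pi * r * G)" using r G(2) by (simp add: ennreal_mult)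
    finally have "2 * pi * \<bar>flux B r\<bar> \<le> 2 * pi * r * G" using r G(2) by (subst (asm) ennreal_le_iff) auto
    then show ?thesis by (simp add: mult.commute)
  qed
  with G(2) show ?thesis by blast
qed

text \<open>The fluxes of the positive and the negative part of \<open>B\<close> are monotone in the
  radius.\<close>

lemma flux_measurable [measurable]: "flux B \<in> borel_measurable borel"
proof -
  have m: "mono (\<lambda>r. LINT x:cball 0 r|lebesgue. max 0 (f x))" if f: "integrable lebesgue f" for f :: "real^2 \<Rightarrow> real"
  proof (rule monoI)
    fix r s :: real assume "r \<le> s"
    then have sub: "cball (0::real^2) r \<subseteq> cball 0 s" by (rule subset_cball)
    have i: "integrable lebesgue (\<lambda>x. max 0 (f x))" using f by simp
    show "(LINT x:cball 0 r|lebesgue. max 0 (f x)) \<le> (LINT x:cball 0 s|lebesgue. max 0 (f x))"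
      unfolding set_lebesgue_integral_def
    proof (rule integral_mono)
      show "indicator (cball 0 r) x *\<^sub>R max 0 (f x) \<le> indicator (cball 0 s) x *\<^sub>R max 0 (f x)" for x
        using sub by (auto simp: indicator_def)
    qed (intro integrable_mult_indicator i; simp)+
  qed
  have "flux B r = ((LINT x:cball 0 r|lebesgue. max 0 (B x)) - (LINT x:cball 0 r|lebesgue. max 0 (- B x))) / (2 * pi)" for r
  proof -
    have "(LINT x:cball 0 r|lebesgue. max 0 (B x) - max 0 (- B x)) = (LINT x:cball 0 r|lebesgue. max 0 (B x)) - (LINT x:cball 0 r|lebesgue. max 0 (- B x))"
    proof (rule set_integral_diff)
      have "integrable lebesgue (\<lambda>x. max 0 (B x))" "integrable lebesgue (\<lambda>x. max 0 (- B x))"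
        using B_integrable by simp_all
      then show "set_integrable lebesgue (cball 0 r) (\<lambda>x. max 0 (B x))" "set_integrable lebesgue (cball 0 r) (\<lambda>x. max 0 (- B x))"
        unfolding set_integrable_def by (intro integrable_mult_indicator cball_lebesgue; simp)+
    qed
    moreover have "max 0 (B x) - max 0 (- B x) = B x" for x by (simp add: max_def)
    ultimately show ?thesis by (simp add: flux_def ball_eq)
  qed
  then have eq: "flux B = (\<lambda>r. ((LINT x:cball 0 r|lebesgue. max 0 (B x)) - (LINT x:cball 0 r|lebesgue. max 0 (- B x))) / (2 * pi))"
    by blast
  show ?thesis
    unfolding eq using B_integrable
    by (intro borel_measurable_divide borel_measurable_const borel_measurable_diff borel_measurable_mono m) auto
qed

lemma flux_tendsto: "(flux B \<longlongrightarrow> total_flux B) at_top"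
proof -
  have "((\<lambda>r. LINT x|lebesgue. indicator (cball 0 r) x *\<^sub>R B x) \<longlongrightarrow> (LINT x|lebesgue. B x)) at_top"
  proof (rule integral_dominated_convergence_at_top[where w="\<lambda>x. \<bar>B x\<bar>"])
    show "AE x in lebesgue. ((\<lambda>r. indicator (cball 0 r) x *\<^sub>R B x) \<longlongrightarrow> B x) at_top"
    proof (rule AE_I2)
      fix x :: "real^2"
      have "eventually (\<lambda>r. indicator (cball 0 r) x *\<^sub>R B x = B x) at_top"
        using eventually_ge_at_top[of "norm x"] by eventually_elim simp
      then show "((\<lambda>r. indicator (cball 0 r) x *\<^sub>R B x) \<longlongrightarrow> B x) at_top"
        by (rule tendsto_eventually)
    qed
    show "(\<lambda>x. indicator (cball 0 r) x *\<^sub>R B x) \<in> borel_measurable lebesgue" for r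
      using integrable_mult_indicator[OF cball_lebesgue B_integrable, of r] by simp
  qed (use B_integrable in \<open>auto simp: indicator_def\<close>)
  then have "((\<lambda>r. (LINT x|lebesgue. indicator (cball 0 r) x *\<^sub>R B x) / (2 * pi)) \<longlongrightarrow> (LINT x|lebesgue. B x) / (2 * pi)) at_top"
    by (intro tendsto_intros) auto
  then show ?thesis
    by (simp add: flux_def[abs_def] total_flux_def set_lebesgue_integral_def ball_eq)
qed

text \<open>The distance of s from the integers is measured by |1 - exp (-2 pi i s)|, which is
  continuous and nonzero at the total flux. Half of this value is a lower bound for all large radii,
  and \<open>max 1 R\<close> keeps the logarithm within its domain.\<close>

lemma ex_magnetic_cylinder: "\<exists>M T\<^sub>0 \<kappa>. magnetic_cylinder (\<lambda>t. flux B (exp t)) M T\<^sub>0 \<kappa> \<and> 0 \<le> M \<and> (\<forall>r>0. \<bar>flux B r\<bar> \<le> M * r)"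
proof -
  obtain M1 where M1: "0 \<le> M1" "\<And>r. \<bar>flux B r\<bar> \<le> M1" using flux_bounded by blast
  obtain M2 where M2: "0 \<le> M2" "\<And>r. 0 < r \<Longrightarrow> \<bar>flux B r\<bar> \<le> M2 * r" using flux_linear_bound by blast
  let ?e = "\<lambda>s::real. cmod (1 - exp (- 2 * pi * \<i> * of_real s))"
  have ne: "exp (- 2 * pi * \<i> * of_real (total_flux B)) \<noteq> 1"
  proof
    assume "exp (- 2 * pi * \<i> * of_real (total_flux B)) = 1"
    then obtain n :: int where "- 2 * pi * total_flux B = of_int (2 * n) * pi"
      unfolding exp_eq_1 by auto
    then have "pi * (total_flux B + of_int n) = 0" by (simp add: algebra_simps)
    then have "total_flux B = of_int (- n)" by simp
    with flux_not_integer show False by (metis Ints_of_int)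
  qed
  then have pos: "0 < ?e (total_flux B)" by simp
  have "((\<lambda>r. ?e (flux B r)) \<longlongrightarrow> ?e (total_flux B)) at_top"
    by (intro tendsto_intros flux_tendsto)
  then have "eventually (\<lambda>r. ?e (total_flux B) / 2 < ?e (flux B r)) at_top"
    using pos by (intro order_tendstoD) auto
  then obtain R where R: "\<And>r. R \<le> r \<Longrightarrow> ?e (total_flux B) / 2 < ?e (flux B r)"
    by (auto simp: eventually_at_top_linorder)
  define M where "M = max M1 M2"
  have lin: "\<bar>flux B r\<bar> \<le> M * r" if "0 < r" for r
  proof -
    have "M2 * r \<le> M * r" using that by (intro mult_right_mono) (auto simp: M_def)
    then show ?thesis using M2(2)[OF that] by linarith
  qed
  have "magnetic_cylinder (\<lambda>t. flux B (exp t)) M (ln (max 1 R)) (?e (total_flux B) / 2)"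
  proof
    show "(\<lambda>t. flux B (exp t)) \<in> borel_measurable borel" by measurable
    show "\<bar>flux B (exp t)\<bar> \<le> M" for t using M1(2)[of "exp t"] by (simp add: M_def)
    show "\<bar>flux B (exp t)\<bar> \<le> M * exp t" for t by (rule lin) simp
    show "0 < ?e (total_flux B) / 2" using pos by simp
    fix t assume "ln (max 1 R) \<le> t"
    then have "exp (ln (max 1 R)) \<le> exp t" by (simp only: exp_le_cancel_iff)
    then have "R \<le> exp t" by simp
    then show "?e (total_flux B) / 2 \<le> ?e (flux B (exp t))" using R by (intro less_imp_le) auto
  qed
  with lin M1(1) show ?thesis by (intro exI[of _ M] exI) (auto simp: M_def)
qed

end

section \<open>The magnetic form\<close>

lemma rotation_sq:
  fixes X Y :: complex and c s :: real
  assumes "s\<^sup>2 + c\<^sup>2 = 1"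
  shows "(cmod (of_real c * X + of_real s * Y))\<^sup>2 + (cmod (of_real c * Y - of_real s * X))\<^sup>2 = (cmod X)\<^sup>2 + (cmod Y)\<^sup>2"
proof -
  have "(cmod (of_real c * X + of_real s * Y))\<^sup>2 + (cmod (of_real c * Y - of_real s * X))\<^sup>2
      = (s\<^sup>2 + c\<^sup>2) * ((cmod X)\<^sup>2 + (cmod Y)\<^sup>2)"
    unfolding cmod_power2 by (simp add: power2_eq_square algebra_simps)
  then show ?thesis by (simp add: assms)
qed

locale magnetic_field = radial_field B b + mc: magnetic_cylinder "\<lambda>t. flux B (exp t)" M T\<^sub>0 \<kappa>
  for B b M T\<^sub>0 \<kappa> +
  assumes M_nonneg: "0 \<le> M" and flux_linear: "0 < r \<Longrightarrow> \<bar>flux B r\<bar> \<le> M * r"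
begin

abbreviation A :: "2 \<Rightarrow> real^2 \<Rightarrow> real" where "A j x \<equiv> vector_potential B x $ j"

definition mder :: "2 \<Rightarrow> (real^2 \<Rightarrow> complex) \<Rightarrow> real^2 \<Rightarrow> complex" where
  "mder j u x = \<i> * partial_deriv j u x + of_real (A j x) * u x"

lemma A_components:
  "A 1 x = flux B (norm x) / norm x * (- (x $ 2) / norm x)"
  "A 2 x = flux B (norm x) / norm x * (x $ 1 / norm x)"
  by (simp_all add: vector_potential_def)

lemma A_measurable [measurable]: "A j \<in> borel_measurable borel"
proof -
  have [measurable]: "(\<lambda>x::real^2. x $ i) \<in> borel_measurable borel" for i
    by (intro borel_measurable_continuous_onI continuous_intros)
  have "A 1 \<in> borel_measurable borel" "A 2 \<in> borel_measurable borel"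
    unfolding A_components[abs_def] by measurable
  then show ?thesis by (metis exhaust_2)
qed

text \<open>The linear bound on the flux cancels the factor 1 / |x|, so the vector potential is
  bounded up to the origin.\<close>

lemma A_bound: "\<bar>A j x\<bar> \<le> M"
proof (cases "x = 0")
  case True
  then show ?thesis using M_nonneg exhaust_2[of j] by (auto simp: A_components)
next
  case False
  then have n: "0 < norm x" by simp
  have 1: "\<bar>flux B (norm x) / norm x\<bar> \<le> M"
    using flux_linear[OF n] n by (simp add: abs_div pos_divide_le_eq)
  have 2: "\<bar>x $ i / norm x\<bar> \<le> 1" for i
    using component_le_norm_cart[of x i] n by (simp add: abs_div pos_divide_le_eq)
  have 3: "\<bar>p * q\<bar> \<le> M" if "\<bar>p\<bar> \<le> M" "\<bar>q\<bar> \<le> 1" for p q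
    using mult_mono[OF that] M_nonneg by (simp add: abs_mult)
  show ?thesis using exhaust_2[of j] 3[OF 1 2] 3[OF 1, of "- (x $ 2) / norm x"] 2[of 2]
    by (auto simp: A_components)
qed

lemma A_test_L2: "u \<in> test_functions \<Longrightarrow> (\<lambda>x. of_real (A j x) * u x) \<in> L2 lebesgue"
  by (rule bounded_mult_test_L2[where C=M])
    (auto simp: A_bound intro!: measurable_completion borel_measurable_of_real)

lemma A_test_norm:
  assumes u: "u \<in> test_functions"
  shows "l2_norm lebesgue (\<lambda>x. of_real (A j x) * u x) \<le> M * l2_norm lebesgue u"
proof (rule power2_le_imp_le)
  have i1: "integrable lebesgue (\<lambda>x. (cmod (of_real (A j x) * u x))\<^sup>2)" using A_test_L2[OF u] by (simp add: L2_def)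
  have i2: "integrable lebesgue (\<lambda>x. M\<^sup>2 * (cmod (u x))\<^sup>2)" using test_L2[OF u] by (simp add: L2_def)
  have "(LINT x|lebesgue. (cmod (of_real (A j x) * u x))\<^sup>2) \<le> (LINT x|lebesgue. M\<^sup>2 * (cmod (u x))\<^sup>2)"
  proof (rule integral_mono[OF i1 i2])
    fix x
    have "(cmod (of_real (A j x) * u x))\<^sup>2 = \<bar>A j x\<bar>\<^sup>2 * (cmod (u x))\<^sup>2"
      by (simp add: norm_mult power_mult_distrib)
    also have "\<dots> \<le> M\<^sup>2 * (cmod (u x))\<^sup>2"
      using A_bound[of x j] by (intro mult_right_mono power_mono) auto
    finally show "(cmod (of_real (A j x) * u x))\<^sup>2 \<le> M\<^sup>2 * (cmod (u x))\<^sup>2" .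
  qed
  then show "(l2_norm lebesgue (\<lambda>x. of_real (A j x) * u x))\<^sup>2 \<le> (M * l2_norm lebesgue u)\<^sup>2"
    by (simp add: l2_norm_sq_integral power_mult_distrib)
qed (use M_nonneg in simp)

lemma mder_L2: "u \<in> test_functions \<Longrightarrow> mder j u \<in> L2 lebesgue"
  unfolding mder_def[abs_def] by (intro L2_add L2_scale test_L2 test_partial A_test_L2)

lemma mder_lincomb:
  "u \<in> test_functions \<Longrightarrow> v \<in> test_functions \<Longrightarrow> mder j (\<lambda>x. u x + c * v x) = (\<lambda>x. mder j u x + c * mder j v x)"
  by (simp add: fun_eq_iff mder_def test_partial_lincomb algebra_simps)

lemma mder_norm_le:
  assumes u: "u \<in> test_functions"
  shows "l2_norm lebesgue (mder j u) \<le> l2_norm lebesgue (partial_deriv j u) + M * l2_norm lebesgue u"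
proof -
  have "l2_norm lebesgue (mder j u) \<le> l2_norm lebesgue (\<lambda>x. \<i> * partial_deriv j u x) + l2_norm lebesgue (\<lambda>x. of_real (A j x) * u x)"
    unfolding mder_def[abs_def] by (intro l2_norm_add_le L2_scale test_L2 test_partial A_test_L2 u)
  then show ?thesis using A_test_norm[OF u, of j] by (simp add: l2_norm_cmult test_L2 test_partial u)
qed

lemma partial_norm_le:
  assumes u: "u \<in> test_functions"
  shows "l2_norm lebesgue (partial_deriv j u) \<le> l2_norm lebesgue (mder j u) + M * l2_norm lebesgue u"
proof -
  have eq: "partial_deriv j u = (\<lambda>x. (- \<i>) * mder j u x + \<i> * (of_real (A j x) * u x))"
    by (simp add: fun_eq_iff mder_def algebra_simps)
  from eq have "l2_norm lebesgue (partial_deriv j u) = l2_norm lebesgue (\<lambda>x. (- \<i>) * mder j u x + \<i> * (of_real (A j x) * u x))"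
    by (rule arg_cong)
  also have "\<dots>
      \<le> l2_norm lebesgue (\<lambda>x. (- \<i>) * mder j u x) + l2_norm lebesgue (\<lambda>x. \<i> * (of_real (A j x) * u x))"
    by (intro l2_norm_add_le L2_scale mder_L2 A_test_L2 u)
  also have "\<dots> = l2_norm lebesgue (mder j u) + l2_norm lebesgue (\<lambda>x. of_real (A j x) * u x)"
    using l2_norm_cmult[OF mder_L2[OF u], of "- \<i>" j] l2_norm_cmult[OF A_test_L2[OF u], of \<i> j] by simp
  finally show ?thesis using A_test_norm[OF u, of j] by simp
qed

definition kin :: "(real^2 \<Rightarrow> complex) \<Rightarrow> real" where
  "kin u = (\<Sum>j\<in>UNIV. (l2_norm lebesgue (mder j u))\<^sup>2)"

lemma kin_nonneg [simp]: "0 \<le> kin u"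
  by (simp add: kin_def sum_nonneg)

lemma kin_integral:
  assumes u: "u \<in> test_functions"
  shows "integrable lebesgue (\<lambda>x. \<Sum>j\<in>UNIV. (cmod (mder j u x))\<^sup>2)"
    and "kin u = (LINT x|lebesgue. (\<Sum>j\<in>UNIV. (cmod (mder j u x))\<^sup>2))"
  using mder_L2[OF u] by (auto simp: kin_def L2_def l2_norm_sq_integral)

text \<open>Rotating the two components by the polar angle separates the radial from the tangential
  derivative. The vector potential is tangential of size flux / r, so it enters the second one only,
  and the factor exp t turns it into the flux.\<close>

lemma mder_polar:
  "exp (2 * fst z) * (\<Sum>j\<in>UNIV. (cmod (mder j u (pol z)))\<^sup>2) =
    (cmod (pullback_t u z))\<^sup>2 + (cmod (pullback_h u z - \<i> * of_real (flux B (exp (fst z))) * polar_pullback u z))\<^sup>2"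
proof -
  obtain t x where z: "z = (t, x)" by fastforce
  define p q w F where "p = partial_deriv 1 u (pol z)" and "q = partial_deriv 2 u (pol z)"
    and "w = u (pol z)" and "F = flux B (exp t)"
  define X where "X = mder 1 u (pol z)"
  define Y where "Y = mder 2 u (pol z)"
  have A1: "A 1 (pol z) = - F / exp t * sin x" and A2: "A 2 (pol z) = F / exp t * cos x"
    by (simp_all only: A_components norm_pol) (simp_all add: z pol_def F_def)
  have X: "X = \<i> * p - of_real (F / exp t * sin x) * w" and Y: "Y = \<i> * q + of_real (F / exp t * cos x) * w"
    unfolding X_def Y_def mder_def A1 A2 by (simp_all add: p_def q_def w_def)
  have sc: "(of_real (sin x) :: complex)\<^sup>2 + (of_real (cos x))\<^sup>2 = 1"
    by (metis of_real_1 of_real_add of_real_power sin_cos_squared_add)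
  have 1: "of_real (cos x) * X + of_real (sin x) * Y = \<i> * (of_real (cos x) * p + of_real (sin x) * q)"
    by (simp add: X Y algebra_simps)
  have "of_real (cos x) * Y - of_real (sin x) * X
      = \<i> * (of_real (cos x) * q - of_real (sin x) * p) + of_real (F / exp t) * w * ((of_real (sin x))\<^sup>2 + (of_real (cos x))\<^sup>2)"
    by (simp add: X Y algebra_simps power2_eq_square)
  then have 2: "of_real (cos x) * Y - of_real (sin x) * X = \<i> * (of_real (cos x) * q - of_real (sin x) * p) + of_real (F / exp t) * w"
    by (simp add: sc)
  have t1: "exp t * cmod (of_real (cos x) * X + of_real (sin x) * Y) = cmod (pullback_t u z)"
    unfolding 1 by (simp add: pullback_t_def z norm_mult p_def q_def)
  have t2: "exp t * cmod (of_real (cos x) * Y - of_real (sin x) * X) = cmod (pullback_h u z - \<i> * of_real F * w)"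
  proof -
    have "pullback_h u z - \<i> * of_real F * w = - \<i> * (of_real (exp t) * (\<i> * (of_real (cos x) * q - of_real (sin x) * p) + of_real (F / exp t) * w))"
      by (simp add: pullback_h_def z p_def q_def algebra_simps)
    then show ?thesis unfolding 2 by (simp add: norm_mult)
  qed
  have "exp (2 * t) * ((cmod X)\<^sup>2 + (cmod Y)\<^sup>2)
      = (exp t)\<^sup>2 * ((cmod (of_real (cos x) * X + of_real (sin x) * Y))\<^sup>2 + (cmod (of_real (cos x) * Y - of_real (sin x) * X))\<^sup>2)"
    by (subst rotation_sq) (simp_all flip: exp_of_nat_mult)
  also have "\<dots> = (cmod (pullback_t u z))\<^sup>2 + (cmod (pullback_h u z - \<i> * of_real F * w))\<^sup>2"
    by (simp add: distrib_left flip: power_mult_distrib t1 t2)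
  finally show ?thesis
    by (simp add: UNIV_2 X_def Y_def F_def w_def polar_pullback_def z)
qed

text \<open>Conformal invariance in two dimensions: the area element exp (2 t) is exactly the square
  of the factor by which logarithmic coordinates scale derivatives.\<close>

lemma kin_magnetic_energy:
  assumes u: "u \<in> test_functions"
  shows "ennreal (kin u) = mc.magnetic_energy (polar_pullback u) (pullback_t u) (pullback_h u)"
proof -
  let ?f = "\<lambda>x. \<Sum>j\<in>UNIV. (cmod (mder j u x))\<^sup>2"
  have [measurable]: "mder j u \<in> borel_measurable borel" for j
    unfolding mder_def[abs_def] using test_measurable[OF u] test_measurable[OF test_partial[OF u]]
    by (intro borel_measurable_add borel_measurable_times borel_measurable_const measurable_compose[OF A_measurable borel_measurable_of_real])
  have m: "?f \<in> borel_measurable borel" by measurable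
  have "ennreal (kin u) = (\<integral>\<^sup>+x. ennreal (?f x) \<partial>lebesgue)"
    unfolding kin_integral(2)[OF u]
    by (rule nn_integral_eq_integral[symmetric]) (auto simp: kin_integral(1)[OF u] sum_nonneg)
  also have "\<dots> = (\<integral>\<^sup>+z\<in>cylinder. (ennreal (?f (pol z)) * ennreal (exp (2 * fst z))) \<partial>lborel)"
    unfolding nn_integral_completion using m by (intro nn_integral_polar) measurable
  also have "\<dots> = mc.magnetic_energy (polar_pullback u) (pullback_t u) (pullback_h u)"
    unfolding mc.magnetic_energy_def
  proof (intro nn_integral_cong arg_cong2[where f="(*)"] refl)
    fix z
    have "ennreal (?f (pol z)) * ennreal (exp (2 * fst z)) = ennreal (exp (2 * fst z) * ?f (pol z))"
      by (simp add: ennreal_mult sum_nonneg mult.commute)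
    then show "ennreal (?f (pol z)) * ennreal (exp (2 * fst z)) = ennreal ((cmod (pullback_t u z))\<^sup>2 +
        (cmod (pullback_h u z - \<i> * of_real (flux B (exp (fst z))) * polar_pullback u z))\<^sup>2)"
      by (simp only: mder_polar)
  qed
  finally show ?thesis .
qed

section \<open>Hardy inequality and form bound in the plane\<close>

definition C\<^sub>5 :: real where "C\<^sub>5 = 192 * pi\<^sup>2 * (1 + 4 * pi)"

lemma C\<^sub>5_pos: "0 < C\<^sub>5"
proof -
  have "0 < 1 + 4 * pi" using pi_gt_zero by linarith
  then show ?thesis by (simp add: C\<^sub>5_def)
qed

text \<open>The coupling \<open>s\<close> scales the potential and with it the number of
  functionals. The value \<open>mc.C\<^sub>4\<close> gives the eigenvalue bound, twice this value
  the relative form bound 1/2.\<close>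

lemma finite_codimension:
  fixes V :: "real^2 \<Rightarrow> real"
  assumes V [measurable]: "V \<in> borel_measurable borel" and V0: "\<And>x. 0 \<le> V x"
    and mixed: "mixed_norm V < \<infinity>" and log: "log_norm_unit_disc V < \<infinity>" and s: "0 \<le> s"
  shows "\<exists>L :: ((real^2 \<Rightarrow> complex) \<Rightarrow> complex) set. finite L \<and>
    real (card L) \<le> C\<^sub>5 * s * (enn2real (mixed_norm V) + enn2real (log_norm_unit_disc V)) \<and>
    (\<forall>\<Lambda>\<in>L. (\<forall>u\<in>test_functions. \<forall>v\<in>test_functions. \<Lambda> (\<lambda>x. u x + v x) = \<Lambda> u + \<Lambda> v) \<and> (\<forall>c u. \<Lambda> (\<lambda>x. c * u x) = c * \<Lambda> u)) \<and>
    (\<forall>u\<in>test_functions. (\<forall>\<Lambda>\<in>L. \<Lambda> u = 0) \<longrightarrow>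
      ennreal s * (\<integral>\<^sup>+x. ennreal (V x * (cmod (u x))\<^sup>2) \<partial>lborel) \<le> ennreal (mc.C\<^sub>4 * kin u))"
proof -
  define mx where "mx = enn2real (mixed_norm V)"
  define lg where "lg = enn2real (log_norm_unit_disc V)"
  have mx: "mixed_norm V = ennreal mx" "0 \<le> mx" and lg: "log_norm_unit_disc V = ennreal lg" "0 \<le> lg"
    using mixed log by (auto simp: mx_def lg_def less_top)
  define w where "w = (\<lambda>z. ennreal s * (ennreal (V (pol z)) * ennreal (exp (2 * fst z))))"
  define W where "W = (\<lambda>t. ennreal s * (angular_sup V (exp t) * ennreal (exp (2 * t))))"
  have W_int: "(\<integral>\<^sup>+t. W t \<partial>lborel) = ennreal (s * mx)"
    unfolding W_def using s mx by (subst nn_integral_cmult) (simp_all add: mixed_norm_cylinder[symmetric] ennreal_mult)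
  \<comment> \<open>Twice the L^1 norm is at most 4 pi times the mixed norm. Together with the mass
    \<open>s * mx\<close> this gives at most (1 + 4 pi) s (mx + lg), hence the last factor of
    \<open>C\<^sub>5\<close>.\<close>
  define T where "T = s * (4 * pi * mx + lg)"
  have T0: "0 \<le> T" using s mx lg by (simp add: T_def)
  interpret cp: cyl_potential W w T
  proof
    show "W \<in> borel_measurable borel" unfolding W_def by measurable
    show "(\<integral>\<^sup>+t. W t \<partial>lborel) < \<infinity>" by (simp add: W_int)
    show "w \<in> borel_measurable borel" unfolding w_def by measurable
    show "AE z in lborel. z \<in> cylinder \<longrightarrow> w z \<le> W (fst z)"
      using AE_le_angular_sup[OF V] V0
      by (auto simp: w_def W_def elim!: eventually_mono intro!: mult_left_mono mult_right_mono)
    show "0 \<le> T" by (rule T0)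
    have "(\<integral>\<^sup>+z\<in>cylinder. (w z * ennreal (2 + max 0 (- fst z))) \<partial>lborel)
        = (\<integral>\<^sup>+z. ennreal s * (ennreal (V (pol z)) * ennreal (exp (2 * fst z)) * ennreal (2 + max 0 (- fst z)) * indicator cylinder z) \<partial>lborel)"
      by (intro nn_integral_cong) (simp add: w_def mult.assoc)
    also have "\<dots> = ennreal s * (2 * L1_norm V + log_norm_unit_disc V)"
      by (subst nn_integral_cmult) (measurable, simp only: weighted_cylinder_integral[OF V V0])
    also have "\<dots> \<le> ennreal s * (2 * (ennreal (2 * pi) * mixed_norm V) + log_norm_unit_disc V)"
      by (intro mult_left_mono add_right_mono L1_norm_le_mixed_norm V) auto
    also have "2 * (ennreal (2 * pi) * mixed_norm V) = ennreal (4 * pi * mx)"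
      using mx(2) by (simp add: mx(1) mult.assoc flip: ennreal_mult ennreal_numeral)
    also have "ennreal s * (ennreal (4 * pi * mx) + log_norm_unit_disc V) = ennreal T"
      using s mx lg by (simp add: T_def ennreal_mult)
    finally show "(\<integral>\<^sup>+z\<in>cylinder. (w z * ennreal (2 + max 0 (- fst z))) \<partial>lborel) \<le> ennreal T" .
  qed
  have mass: "cp.mass UNIV = s * mx"
    using cp.ennreal_mass[of UNIV] W_int s mx by simp
  obtain L where L: "finite L" "real (card L) \<le> 192 * pi\<^sup>2 * (cp.mass UNIV + T)"
    "\<And>\<Lambda> U V. \<Lambda> \<in> L \<Longrightarrow> continuous_on UNIV U \<Longrightarrow> continuous_on UNIV V \<Longrightarrow> \<Lambda> (\<lambda>z. U z + V z) = \<Lambda> U + \<Lambda> V"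
    "\<And>\<Lambda> c U. \<Lambda> \<in> L \<Longrightarrow> \<Lambda> (\<lambda>z. c * U z) = c * \<Lambda> U"
    "\<And>U Ut Uh. cyl_fun U Ut Uh \<Longrightarrow> (\<forall>\<Lambda>\<in>L. \<Lambda> U = 0) \<Longrightarrow>
        (\<integral>\<^sup>+z\<in>cylinder. (w z * ennreal ((cmod (U z))\<^sup>2)) \<partial>lborel) \<le> cyl_fun.energy Ut Uh cylinder + cyl_fun.outer_mass U"
    using cp.finite_codimension_bound by blast
  define L' where "L' = (\<lambda>\<Lambda> u. \<Lambda> (polar_pullback u)) ` L"
  have r1: "finite L'" using L(1) by (simp add: L'_def)
  have r2: "real (card L') \<le> C\<^sub>5 * s * (mx + lg)"
  proof -
    have "real (card L') \<le> real (card L)" unfolding L'_def using card_image_le[OF L(1)] by simp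
    also have "\<dots> \<le> 192 * pi\<^sup>2 * (s * mx + T)" using L(2) by (simp add: mass)
    also have "\<dots> \<le> 192 * pi\<^sup>2 * ((1 + 4 * pi) * (s * (mx + lg)))"
    proof (rule mult_left_mono)
      have "0 \<le> 4 * pi * (s * lg)" using s lg by simp
      then show "s * mx + T \<le> (1 + 4 * pi) * (s * (mx + lg))" by (simp add: T_def algebra_simps)
    qed simp
    finally show ?thesis by (simp add: C\<^sub>5_def mult.assoc)
  qed
  have r3: "\<Lambda> (\<lambda>x. u x + v x) = \<Lambda> u + \<Lambda> v" if "\<Lambda> \<in> L'" "u \<in> test_functions" "v \<in> test_functions" for \<Lambda> u v
  proof -
    have "polar_pullback (\<lambda>x. u x + v x) = (\<lambda>z. polar_pullback u z + polar_pullback v z)"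
      by (simp add: polar_pullback_def fun_eq_iff)
    then show ?thesis
      using that L(3) cyl_fun.cont(1)[OF cyl_fun_pullback] by (auto simp: L'_def)
  qed
  have r4: "\<Lambda> (\<lambda>x. c * u x) = c * \<Lambda> u" if "\<Lambda> \<in> L'" for \<Lambda> c u
  proof -
    have "polar_pullback (\<lambda>x. c * u x) = (\<lambda>z. c * polar_pullback u z)"
      by (simp add: polar_pullback_def fun_eq_iff)
    then show ?thesis using that L(4) by (auto simp: L'_def)
  qed
  have r5: "ennreal s * (\<integral>\<^sup>+x. ennreal (V x * (cmod (u x))\<^sup>2) \<partial>lborel) \<le> ennreal (mc.C\<^sub>4 * kin u)"
    if u: "u \<in> test_functions" and zero: "\<forall>\<Lambda>\<in>L'. \<Lambda> u = 0" for u
  proof -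
    note cyl = cyl_fun_pullback[OF u]
    have [measurable]: "u \<in> borel_measurable borel" by (rule test_measurable[OF u])
    have "(\<integral>\<^sup>+x. ennreal (V x * (cmod (u x))\<^sup>2) \<partial>lborel)
        = (\<integral>\<^sup>+z\<in>cylinder. (ennreal (V (pol z) * (cmod (u (pol z)))\<^sup>2) * ennreal (exp (2 * fst z))) \<partial>lborel)"
      by (rule nn_integral_polar) measurable
    then have "ennreal s * (\<integral>\<^sup>+x. ennreal (V x * (cmod (u x))\<^sup>2) \<partial>lborel)
        = (\<integral>\<^sup>+z. ennreal s * (ennreal (V (pol z) * (cmod (u (pol z)))\<^sup>2) * ennreal (exp (2 * fst z)) * indicator cylinder z) \<partial>lborel)"
      by (simp add: nn_integral_cmult)
    also have "\<dots> = (\<integral>\<^sup>+z\<in>cylinder. (w z * ennreal ((cmod (polar_pullback u z))\<^sup>2)) \<partial>lborel)"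
      using V0 by (intro nn_integral_cong) (simp add: w_def polar_pullback_def ennreal_mult ac_simps)
    also have "\<dots> \<le> cyl_fun.energy (pullback_t u) (pullback_h u) cylinder + cyl_fun.outer_mass (polar_pullback u)"
      by (rule L(5)[OF cyl]) (use zero in \<open>auto simp: L'_def\<close>)
    also have "\<dots> \<le> ennreal mc.C\<^sub>4 * mc.magnetic_energy (polar_pullback u) (pullback_t u) (pullback_h u)"
      by (rule mc.energy_le_magnetic_energy[OF cyl pullback_periodic])
    also have "\<dots> = ennreal (mc.C\<^sub>4 * kin u)"
      using mc.C\<^sub>4_pos by (simp add: kin_magnetic_energy[OF u, symmetric] ennreal_mult)
    finally show ?thesis .
  qed
  show ?thesis
    unfolding mx_def[symmetric] lg_def[symmetric] using r1 r2 r3 r4 r5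
    by (intro exI[of _ L'] conjI) simp_all
qed

definition form_norm :: "(real^2 \<Rightarrow> real) \<Rightarrow> real" where
  "form_norm V = enn2real (mixed_norm V) + enn2real (log_norm_unit_disc V)"

text \<open>A number of functionals below 1 is 0, so the estimate holds for every test
  function.\<close>

lemma hardy_inequality:
  fixes V :: "real^2 \<Rightarrow> real"
  assumes V: "V \<in> borel_measurable borel" "\<And>x. 0 \<le> V x" "mixed_norm V < \<infinity>" "log_norm_unit_disc V < \<infinity>"
    and s: "0 \<le> s" and small: "C\<^sub>5 * s * form_norm V < 1" and u: "u \<in> test_functions"
  shows "ennreal s * (\<integral>\<^sup>+x. ennreal (V x * (cmod (u x))\<^sup>2) \<partial>lborel) \<le> ennreal (mc.C\<^sub>4 * kin u)"
proof -
  obtain L :: "((real^2 \<Rightarrow> complex) \<Rightarrow> complex) set" where L: "finite L" "real (card L) \<le> C\<^sub>5 * s * form_norm V"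
    "\<forall>u\<in>test_functions. (\<forall>\<Lambda>\<in>L. \<Lambda> u = 0) \<longrightarrow>
      ennreal s * (\<integral>\<^sup>+x. ennreal (V x * (cmod (u x))\<^sup>2) \<partial>lborel) \<le> ennreal (mc.C\<^sub>4 * kin u)"
    using finite_codimension[OF V s, folded form_norm_def] by (elim exE conjE) (rule that; assumption)
  have "card L = 0" using L(2) small by linarith
  then have "L = {}" using L(1) by simp
  then show ?thesis using L(3) u by simp
qed

lemma angular_sup_truncation:
  assumes [measurable]: "V \<in> borel_measurable borel" and V0: "\<And>x. 0 \<le> V x" and c: "angular_sup V r \<le> ennreal (real k)"
  shows "angular_sup (\<lambda>x. max 0 (V x - real k)) r = 0"
proof -
  have "AE t in lborel. t \<in> {0..2*pi} \<longrightarrow> ennreal \<bar>V (vector [r * cos t, r * sin t])\<bar> \<le> ennreal (real k)"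
    using c by (simp only: angular_sup_le_iff[OF assms(1)])
  then have "AE t in lborel. t \<in> {0..2*pi} \<longrightarrow> ennreal \<bar>max 0 (V (vector [r * cos t, r * sin t]) - real k)\<bar> \<le> 0"
    by eventually_elim (use V0 in \<open>auto simp: max_def\<close>)
  then have "angular_sup (\<lambda>x. max 0 (V x - real k)) r \<le> 0"
    by (subst angular_sup_le_iff) auto
  then show ?thesis by simp
qed

lemma angular_sup_mono:
  assumes [measurable]: "V \<in> borel_measurable borel" "V' \<in> borel_measurable borel" and le: "\<And>x. \<bar>V' x\<bar> \<le> \<bar>V x\<bar>"
  shows "angular_sup V' r \<le> angular_sup V r"
proof -
  have "AE t in lborel. t \<in> {0..2*pi} \<longrightarrow> ennreal \<bar>V (vector [r * cos t, r * sin t])\<bar> \<le> angular_sup V r"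
    using angular_sup_le_iff[OF assms(1), of r "angular_sup V r"] by simp
  then show ?thesis
    by (subst angular_sup_le_iff) (auto elim!: eventually_mono intro: order_trans[OF ennreal_leI[OF le]])
qed

text \<open>Dominated convergence in both norms, with the integrands of \<open>V\<close> itself as
  majorants.\<close>

lemma truncation_tendsto_0:
  fixes V :: "real^2 \<Rightarrow> real"
  assumes V [measurable]: "V \<in> borel_measurable borel" and V0: "\<And>x. 0 \<le> V x"
    and mixed: "mixed_norm V < \<infinity>" and log: "log_norm_unit_disc V < \<infinity>"
  defines "Vk \<equiv> \<lambda>k::nat. \<lambda>x. max 0 (V x - real k)"
  shows "(\<lambda>k. mixed_norm (Vk k)) \<longlonglongrightarrow> 0" "(\<lambda>k. log_norm_unit_disc (Vk k)) \<longlonglongrightarrow> 0"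
    "mixed_norm (Vk k) < \<infinity>" "log_norm_unit_disc (Vk k) < \<infinity>"
proof -
  have [measurable]: "Vk k \<in> borel_measurable borel" for k unfolding Vk_def by measurable
  have le: "\<bar>Vk k x\<bar> \<le> \<bar>V x\<bar>" for k x using V0[of x] by (simp add: Vk_def max_def)
  have ang: "angular_sup (Vk k) r \<le> angular_sup V r" for k r
    by (rule angular_sup_mono) (auto simp: le)
  have mono_m: "angular_sup (Vk k) (exp t) * ennreal (exp (2 * t)) \<le> angular_sup V (exp t) * ennreal (exp (2 * t))" for k t
    by (intro mult_right_mono ang) simp
  have mono_l: "ennreal \<bar>Vk k x * ln (norm x)\<bar> \<le> ennreal \<bar>V x * ln (norm x)\<bar>" for k x
    using le[of k x] by (intro ennreal_leI) (auto simp: abs_mult intro: mult_right_mono)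
  have [measurable]: "ball (0 :: real^2) 1 \<in> sets borel" by simp
  have "mixed_norm (Vk k) \<le> mixed_norm V"
    unfolding mixed_norm_cylinder[OF V] by (subst mixed_norm_cylinder) (auto intro!: nn_integral_mono mono_m)
  then show "mixed_norm (Vk k) < \<infinity>" using mixed by (rule le_less_trans)
  have "log_norm_unit_disc (Vk k) \<le> log_norm_unit_disc V"
    unfolding log_norm_unit_disc_def by (intro nn_integral_mono mult_right_mono mono_l) simp
  then show "log_norm_unit_disc (Vk k) < \<infinity>" using log by (rule le_less_trans)
  have "(\<lambda>k. \<integral>\<^sup>+t. angular_sup (Vk k) (exp t) * ennreal (exp (2 * t)) \<partial>lborel) \<longlonglongrightarrow> (\<integral>\<^sup>+t. 0 \<partial>(lborel :: real measure))"
  proof (rule nn_integral_dominated_convergence[where w="\<lambda>t. angular_sup V (exp t) * ennreal (exp (2 * t))"])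
    show "(\<integral>\<^sup>+t. angular_sup V (exp t) * ennreal (exp (2 * t)) \<partial>lborel) < \<infinity>"
      using mixed by (simp only: mixed_norm_cylinder[OF V])
    then have "AE t in lborel. angular_sup V (exp t) * ennreal (exp (2 * t)) \<noteq> \<infinity>"
      by (intro nn_integral_noteq_infinite) auto
    then show "AE t in lborel. (\<lambda>k. angular_sup (Vk k) (exp t) * ennreal (exp (2 * t))) \<longlonglongrightarrow> 0"
    proof eventually_elim
      case (elim t)
      then have "angular_sup V (exp t) < \<infinity>" by (auto simp: ennreal_mult_eq_top_iff less_top)
      then obtain k0 :: nat where k0: "angular_sup V (exp t) < of_nat k0"
        using ennreal_Ex_less_of_nat[of "angular_sup V (exp t)"] by (auto simp: less_top)
      \<comment> \<open>On almost every circle the supremum is finite, and the truncation vanishes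
        there once \<open>k\<close> exceeds it.\<close>
      have "angular_sup (Vk k) (exp t) = 0" if "k0 \<le> k" for k
      proof -
        have "angular_sup V (exp t) \<le> ennreal (real k)"
          using k0 that by (metis ennreal_of_nat_eq_real_of_nat less_imp_le of_nat_mono order_trans)
        then show ?thesis unfolding Vk_def by (intro angular_sup_truncation V V0)
      qed
      then have "eventually (\<lambda>k. angular_sup (Vk k) (exp t) * ennreal (exp (2 * t)) = 0) sequentially"
        by (auto simp: eventually_sequentially)
      then show ?case by (rule tendsto_eventually)
    qed
  qed (auto intro: mono_m)
  then show "(\<lambda>k. mixed_norm (Vk k)) \<longlonglongrightarrow> 0"
    by (simp add: mixed_norm_cylinder)
  have "(\<lambda>k. \<integral>\<^sup>+x\<in>ball 0 1. ennreal \<bar>Vk k x * ln (norm x)\<bar> \<partial>lborel) \<longlonglongrightarrow> (\<integral>\<^sup>+x. 0 \<partial>(lborel :: (real^2) measure))"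
  proof (rule nn_integral_dominated_convergence[where w="\<lambda>x. ennreal \<bar>V x * ln (norm x)\<bar> * indicator (ball 0 1) x"])
    show "(\<integral>\<^sup>+x\<in>ball 0 1. ennreal \<bar>V x * ln (norm x)\<bar> \<partial>lborel) < \<infinity>"
      using log by (simp add: log_norm_unit_disc_def nn_integral_completion)
    show "AE x in lborel. (\<lambda>k. ennreal \<bar>Vk k x * ln (norm x)\<bar> * indicator (ball 0 1) x) \<longlonglongrightarrow> 0"
    proof (rule AE_I2)
      fix x :: "real^2"
      obtain k0 :: nat where k0: "V x < real k0" using reals_Archimedean2 by blast
      then have "Vk k x = 0" if "k0 \<le> k" for k
        using that by (simp add: Vk_def max_def)
      then have "eventually (\<lambda>k. ennreal \<bar>Vk k x * ln (norm x)\<bar> * indicator (ball 0 1) x = 0) sequentially"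
        by (auto simp: eventually_sequentially intro!: exI[of _ k0])
      then show "(\<lambda>k. ennreal \<bar>Vk k x * ln (norm x)\<bar> * indicator (ball 0 1) x) \<longlonglongrightarrow> 0" by (rule tendsto_eventually)
    qed
  qed (auto intro!: mult_right_mono mono_l)
  then show "(\<lambda>k. log_norm_unit_disc (Vk k)) \<longlonglongrightarrow> 0"
    by (simp add: log_norm_unit_disc_def nn_integral_completion)
qed

text \<open>\<open>V\<close> is at most its excess over \<open>k\<close> plus \<open>k\<close>. For
  large \<open>k\<close> the excess is so small in norm that the Hardy inequality covers it, and the
  constant contributes only to the L^2 term.\<close>

lemma form_bound_borel:
  fixes V :: "real^2 \<Rightarrow> real"
  assumes V [measurable]: "V \<in> borel_measurable borel" and V0: "\<And>x. 0 \<le> V x"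
    and fin: "mixed_norm V < \<infinity>" "log_norm_unit_disc V < \<infinity>"
  shows "\<exists>k\<ge>0. \<forall>u\<in>test_functions. (\<integral>\<^sup>+x. ennreal (V x * (cmod (u x))\<^sup>2) \<partial>lborel) \<le> ennreal (kin u / 2 + k * (l2_norm lebesgue u)\<^sup>2)"
proof -
  define Vk where "Vk = (\<lambda>k::nat. \<lambda>x. max 0 (V x - real k))"
  have tr: "(\<lambda>k. mixed_norm (Vk k)) \<longlonglongrightarrow> 0" "(\<lambda>k. log_norm_unit_disc (Vk k)) \<longlonglongrightarrow> 0"
    "mixed_norm (Vk k) < \<infinity>" "log_norm_unit_disc (Vk k) < \<infinity>" for k
    unfolding Vk_def by (rule truncation_tendsto_0[OF V V0 fin])+
  have "(\<lambda>k. form_norm (Vk k)) \<longlonglongrightarrow> 0 + 0"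
    unfolding form_norm_def by (intro tendsto_add tendsto_enn2real) (simp_all add: tr)
  then have "(\<lambda>k. C\<^sub>5 * (2 * mc.C\<^sub>4) * form_norm (Vk k)) \<longlonglongrightarrow> C\<^sub>5 * (2 * mc.C\<^sub>4) * 0"
    by (intro tendsto_intros) simp
  then have "eventually (\<lambda>k. C\<^sub>5 * (2 * mc.C\<^sub>4) * form_norm (Vk k) < 1) sequentially"
    by (rule order_tendstoD) simp
  \<comment> \<open>The coupling is twice \<open>mc.C\<^sub>4\<close> in order to keep half of the
    kinetic energy.\<close>
  then obtain k where k: "C\<^sub>5 * (2 * mc.C\<^sub>4) * form_norm (Vk k) < 1"
    by (auto simp: eventually_sequentially)
  have [measurable]: "Vk k \<in> borel_measurable borel" unfolding Vk_def by measurable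
  have Vk0: "0 \<le> Vk k x" for x by (simp add: Vk_def)
  have "(\<integral>\<^sup>+x. ennreal (V x * (cmod (u x))\<^sup>2) \<partial>lborel) \<le> ennreal (kin u / 2 + real k * (l2_norm lebesgue u)\<^sup>2)"
    if u: "u \<in> test_functions" for u
  proof -
    have [measurable]: "u \<in> borel_measurable borel" by (rule test_measurable[OF u])
    let ?I = "\<integral>\<^sup>+x. ennreal (Vk k x * (cmod (u x))\<^sup>2) \<partial>lborel"
    have "ennreal (2 * mc.C\<^sub>4) * ?I \<le> ennreal (mc.C\<^sub>4 * kin u)"
      using mc.C\<^sub>4_pos by (intro hardy_inequality Vk0 tr k u) auto
    also have "ennreal (mc.C\<^sub>4 * kin u) = ennreal (2 * mc.C\<^sub>4) * ennreal (kin u / 2)"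
      using mc.C\<^sub>4_pos by (subst ennreal_mult[symmetric]) auto
    finally have I: "?I \<le> ennreal (kin u / 2)"
      using mc.C\<^sub>4_pos by (subst (asm) ennreal_mult_le_mult_iff) auto
    have "(\<integral>\<^sup>+x. ennreal (V x * (cmod (u x))\<^sup>2) \<partial>lborel)
        \<le> (\<integral>\<^sup>+x. (ennreal (Vk k x * (cmod (u x))\<^sup>2) + ennreal (real k) * ennreal ((cmod (u x))\<^sup>2)) \<partial>lborel)"
    proof (rule nn_integral_mono)
      fix x
      have "V x \<le> Vk k x + real k" by (simp add: Vk_def)
      then have "V x * (cmod (u x))\<^sup>2 \<le> (Vk k x + real k) * (cmod (u x))\<^sup>2" by (intro mult_right_mono) auto
      then have "ennreal (V x * (cmod (u x))\<^sup>2) \<le> ennreal (Vk k x * (cmod (u x))\<^sup>2 + real k * (cmod (u x))\<^sup>2)"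
        by (intro ennreal_leI) (simp add: distrib_right)
      then show "ennreal (V x * (cmod (u x))\<^sup>2) \<le> ennreal (Vk k x * (cmod (u x))\<^sup>2) + ennreal (real k) * ennreal ((cmod (u x))\<^sup>2)"
        using Vk0[of x] by (simp add: ennreal_mult)
    qed
    also have "\<dots> = ?I + ennreal (real k) * (\<integral>\<^sup>+x. ennreal ((cmod (u x))\<^sup>2) \<partial>lborel)"
      by (subst nn_integral_add) (auto simp: nn_integral_cmult)
    also have "(\<integral>\<^sup>+x. ennreal ((cmod (u x))\<^sup>2) \<partial>lborel) = ennreal ((l2_norm lebesgue u)\<^sup>2)"
      unfolding l2_norm_sq_integral nn_integral_completion[symmetric, of lborel]
      by (rule nn_integral_eq_integral) (use test_L2[OF u] in \<open>auto simp: L2_def\<close>)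
    also have "?I + ennreal (real k) * ennreal ((l2_norm lebesgue u)\<^sup>2) \<le> ennreal (kin u / 2) + ennreal (real k) * ennreal ((l2_norm lebesgue u)\<^sup>2)"
      by (intro add_right_mono I)
    also have "\<dots> = ennreal (kin u / 2 + real k * (l2_norm lebesgue u)\<^sup>2)"
      by (simp add: ennreal_mult)
    finally show ?thesis .
  qed
  then show ?thesis by (intro exI[of _ "real k"]) auto
qed

text \<open>The square root turns the potential energy into a squared norm, so that the form becomes
  a difference of inner products.\<close>

definition pot :: "(real^2 \<Rightarrow> real) \<Rightarrow> (real^2 \<Rightarrow> complex) \<Rightarrow> real^2 \<Rightarrow> complex" where
  "pot V u x = of_real (sqrt (V x)) * u x"

definition sform :: "(real^2 \<Rightarrow> real) \<Rightarrow> (real^2 \<Rightarrow> complex) \<Rightarrow> (real^2 \<Rightarrow> complex) \<Rightarrow> complex" where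
  "sform V u v = (\<Sum>j\<in>UNIV. l2_inner lebesgue (mder j u) (mder j v)) - l2_inner lebesgue (pot V u) (pot V v)"

end

section \<open>Closability and the eigenvalue bound\<close>

locale magnetic_potential = magnetic_field +
  fixes V V' :: "real^2 \<Rightarrow> real"
  assumes V_meas: "V \<in> borel_measurable lebesgue" and V_nonneg: "\<And>x. 0 \<le> V x"
    and V'_meas: "V' \<in> borel_measurable borel" and V'_nonneg: "\<And>x. 0 \<le> V' x"
    and V_eq: "AE x in lebesgue. V x = V' x"
    and mixed_finite: "mixed_norm V < \<infinity>" and log_finite: "log_norm_unit_disc V < \<infinity>"
begin

lemma V_norms: "mixed_norm V' = mixed_norm V" "log_norm_unit_disc V' = log_norm_unit_disc V"
  using mixed_norm_AE_eq[OF V'_meas V_eq] log_norm_AE_eq[OF V_eq] by simp_all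

lemma V_integrable: "integrable lebesgue V"
proof -
  have "(\<integral>\<^sup>+x. ennreal (norm (V x)) \<partial>lebesgue) = L1_norm V'"
    using L1_norm_AE_eq[OF V_eq] by (simp add: L1_norm_def)
  also have "\<dots> \<le> ennreal (2 * pi) * mixed_norm V'" by (rule L1_norm_le_mixed_norm[OF V'_meas])
  also have "\<dots> < \<infinity>" using mixed_finite by (simp add: V_norms ennreal_mult_less_top)
  finally show ?thesis using V_meas by (simp add: integrable_iff_bounded)
qed

lemma pot_integrable:
  assumes u: "u \<in> test_functions"
  shows "integrable lebesgue (\<lambda>x. V x * (cmod (u x))\<^sup>2)"
proof -
  obtain C where C: "0 < C" "\<And>x. cmod (u x) \<le> C" using test_bounded[OF u] by blast
  show ?thesis
  proof (rule Bochner_Integration.integrable_bound)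
    show "integrable lebesgue (\<lambda>x. V x * C\<^sup>2)" using V_integrable by simp
    show "(\<lambda>x. V x * (cmod (u x))\<^sup>2) \<in> borel_measurable lebesgue"
      using V_meas test_measurable_lebesgue[OF u] by measurable
    have "V x * (cmod (u x))\<^sup>2 \<le> V x * C\<^sup>2" for x
      using C by (intro mult_left_mono power_mono V_nonneg) auto
    then show "AE x in lebesgue. norm (V x * (cmod (u x))\<^sup>2) \<le> norm (V x * C\<^sup>2)"
      using V_nonneg by simp
  qed
qed

lemma pot_sq: "(cmod (pot V u x))\<^sup>2 = V x * (cmod (u x))\<^sup>2"
  using V_nonneg[of x] by (simp add: pot_def norm_mult power_mult_distrib)

lemma pot_L2: "u \<in> test_functions \<Longrightarrow> pot V u \<in> L2 lebesgue"
proof -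
  assume u: "u \<in> test_functions"
  have "pot V u \<in> borel_measurable lebesgue"
    unfolding pot_def[abs_def] using V_meas test_measurable_lebesgue[OF u] by measurable
  then show ?thesis using pot_integrable[OF u] by (simp add: L2_def pot_sq)
qed

lemma pot_lincomb: "pot V (\<lambda>x. u x + c * v x) = (\<lambda>x. pot V u x + c * pot V v x)"
  by (simp add: pot_def fun_eq_iff algebra_simps)

lemma magnetic_form_eq:
  assumes u: "u \<in> test_functions"
  shows "magnetic_form B V u = kin u - (l2_norm lebesgue (pot V u))\<^sup>2"
  unfolding magnetic_form_def kin_integral(2)[OF u] l2_norm_sq_integral pot_sq mder_def[symmetric]
  by (intro Bochner_Integration.integral_diff kin_integral(1) pot_integrable u)

lemma magnetic_form_sform: "u \<in> test_functions \<Longrightarrow> magnetic_form B V u = Re (sform V u u)"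
  by (simp add: magnetic_form_eq sform_def kin_def l2_inner_self mder_L2 pot_L2)

text \<open>Links the Bochner integral with \<open>V\<close>, as in the form, to the nonnegative
  integral with the Borel version, as on the cylinder.\<close>

lemma pot_nn_integral:
  assumes u: "u \<in> test_functions"
  shows "ennreal ((l2_norm lebesgue (pot V u))\<^sup>2) = (\<integral>\<^sup>+x. ennreal (V' x * (cmod (u x))\<^sup>2) \<partial>lborel)"
proof -
  have "ennreal ((l2_norm lebesgue (pot V u))\<^sup>2) = (\<integral>\<^sup>+x. ennreal (V x * (cmod (u x))\<^sup>2) \<partial>lebesgue)"
    unfolding l2_norm_sq_integral pot_sq
    by (rule nn_integral_eq_integral[symmetric]) (auto simp: pot_integrable u V_nonneg)
  also have "\<dots> = (\<integral>\<^sup>+x. ennreal (V' x * (cmod (u x))\<^sup>2) \<partial>lebesgue)"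
    using V_eq by (intro nn_integral_cong_AE) auto
  finally show ?thesis by (simp add: nn_integral_completion)
qed

lemma form_bound:
  "\<exists>k\<ge>0. \<forall>u\<in>test_functions. (l2_norm lebesgue (pot V u))\<^sup>2 \<le> kin u / 2 + k * (l2_norm lebesgue u)\<^sup>2"
proof -
  obtain k where k: "0 \<le> k" "\<And>u. u \<in> test_functions \<Longrightarrow>
      (\<integral>\<^sup>+x. ennreal (V' x * (cmod (u x))\<^sup>2) \<partial>lborel) \<le> ennreal (kin u / 2 + k * (l2_norm lebesgue u)\<^sup>2)"
    using form_bound_borel[OF V'_meas V'_nonneg] mixed_finite log_finite by (auto simp: V_norms)
  have "(l2_norm lebesgue (pot V u))\<^sup>2 \<le> kin u / 2 + k * (l2_norm lebesgue u)\<^sup>2" if u: "u \<in> test_functions" for u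
    using k(2)[OF u] k(1) unfolding pot_nn_integral[OF u, symmetric] by (subst (asm) ennreal_le_iff) auto
  with k(1) show ?thesis by blast
qed

sublocale sf: hermitian_form test_functions "sform V"
proof
  fix u v w :: "real^2 \<Rightarrow> complex" and c :: complex
  show "(\<lambda>_. 0) \<in> test_functions" by (rule test_zero)
  assume u: "u \<in> test_functions"
  show "(\<lambda>x. c * u x) \<in> test_functions" by (rule test_scale[OF u])
  assume w: "w \<in> test_functions"
  have lin: "sform V (\<lambda>x. v x + c * u x) w = sform V v w + c * sform V u w" if v: "v \<in> test_functions" for v c
    using u v w
    by (simp add: sform_def mder_lincomb pot_lincomb l2.form_add l2.form_scale mder_L2 pot_L2 L2_scale
        sum.distrib sum_distrib_left right_diff_distrib)
  have "sform V (\<lambda>_. 0) w = 0"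
  proof -
    have "mder j (\<lambda>_. 0) = (\<lambda>_. 0)" for j
      using mder_lincomb[OF test_zero test_zero, of j "-1"] by (simp add: mder_def fun_eq_iff partial_deriv_def)
    then show ?thesis using w by (simp add: sform_def pot_def[abs_def] l2_inner_def)
  qed
  then show "sform V (\<lambda>x. c * u x) w = c * sform V u w" using lin[OF test_zero, of c] by simp
  have "l2_inner lebesgue (mder j w) (mder j u) = cnj (l2_inner lebesgue (mder j u) (mder j w))" for j
    by (rule l2.form_cnj) (auto intro: mder_L2 u w)
  moreover have "l2_inner lebesgue (pot V w) (pot V u) = cnj (l2_inner lebesgue (pot V u) (pot V w))"
    by (rule l2.form_cnj) (auto intro: pot_L2 u w)
  ultimately show "sform V w u = cnj (sform V u w)"
    by (simp add: sform_def)
next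
  fix u v w :: "real^2 \<Rightarrow> complex"
  assume u: "u \<in> test_functions" and v: "v \<in> test_functions"
  show "(\<lambda>x. u x + v x) \<in> test_functions" by (rule test_add[OF u v])
  assume w: "w \<in> test_functions"
  show "sform V (\<lambda>x. u x + v x) w = sform V u w + sform V v w"
    using u v w mder_lincomb[OF u v, where c=1] pot_lincomb[of u 1 v]
    by (simp add: sform_def l2.form_add mder_L2 pot_L2 sum.distrib)
qed

text \<open>Boundedness of \<open>A\<close> makes the form norm equivalent to the Sobolev norm, so it suffices that
  \<open>\<nabla>w\<^sub>n \<rightarrow> 0\<close>. Integration by parts gives \<open>\<langle>\<nabla>w\<^sub>n, \<nabla>w\<^sub>m\<rangle> = -\<langle>w\<^sub>n, \<Delta>w\<^sub>m\<rangle> \<rightarrow> 0\<close> for fixed \<open>m\<close>.\<close>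

lemma gradient_tendsto_0:
  assumes w: "\<And>n. w n \<in> test_functions" and l2: "(\<lambda>n. l2_norm lebesgue (w n)) \<longlonglongrightarrow> 0"
    and cauchy: "((\<lambda>p. l2_norm lebesgue (partial_deriv j (\<lambda>x. w (fst p) x - w (snd p) x))) \<longlongrightarrow> 0) (sequentially \<times>\<^sub>F sequentially)"
  shows "(\<lambda>n. l2_norm lebesgue (partial_deriv j (w n))) \<longlonglongrightarrow> 0"
proof -
  let ?g = "\<lambda>n. partial_deriv j (w n)"
  let ?N = "l2_norm lebesgue"
  have g: "?g n \<in> L2 lebesgue" for n by (intro test_L2 test_partial w)
  have diff: "partial_deriv j (\<lambda>x. w m x - w n x) = (\<lambda>x. ?g m x - ?g n x)" for m n
    using test_partial_lincomb[OF w w, where c="-1"] by (simp add: fun_eq_iff)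
  have C: "\<exists>K. \<forall>m\<ge>K. \<forall>n\<ge>K. ?N (\<lambda>x. ?g m x - ?g n x) < e" if "0 < e" for e
    using cauchy double_limit_iff[of "\<lambda>m n. ?N (\<lambda>x. ?g m x - ?g n x)"] that by (simp add: diff)
  obtain K0 where K0: "\<And>m n. K0 \<le> m \<Longrightarrow> K0 \<le> n \<Longrightarrow> ?N (\<lambda>x. ?g m x - ?g n x) < 1" using C[of 1] by auto
  define R where "R = ?N (?g K0) + 1"
  have R: "?N (?g n) \<le> R" if "K0 \<le> n" for n
  proof -
    have "?N (\<lambda>x. (?g n x - ?g K0 x) + ?g K0 x) \<le> ?N (\<lambda>x. ?g n x - ?g K0 x) + ?N (?g K0)"
      by (intro l2_norm_add_le l2.diff_mem g)
    then show ?thesis using K0[OF that order_refl] by (simp add: R_def)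
  qed
  have R0: "0 < R" by (simp add: R_def add_nonneg_pos)
  have "(\<lambda>n. (?N (?g n))\<^sup>2) \<longlonglongrightarrow> 0"
    unfolding LIMSEQ_iff
  proof (intro allI impI)
    fix e :: real assume e: "0 < e"
    then have "0 < e / (2 * R)" using R0 by simp
    then obtain K1 where K1: "\<And>m n. K1 \<le> m \<Longrightarrow> K1 \<le> n \<Longrightarrow> ?N (\<lambda>x. ?g m x - ?g n x) < e / (2 * R)"
      using C by blast
    define m where "m = max K0 K1"
    define G where "G = ?N (partial_deriv j (?g m))"
    have "(\<lambda>n. ?N (w n) * G) \<longlonglongrightarrow> 0 * G" by (intro tendsto_intros l2)
    then have "eventually (\<lambda>n. ?N (w n) * G < e / 2) sequentially"
      using e by (intro order_tendstoD) auto
    then obtain K2 where K2: "\<And>n. K2 \<le> n \<Longrightarrow> ?N (w n) * G < e / 2" by (auto simp: eventually_sequentially)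
    have "norm ((?N (?g n))\<^sup>2 - 0) < e" if n: "max m K2 \<le> n" for n
    proof -
      \<comment> \<open>Split against the fixed \<open>?g m\<close>: the first product is small by
        the Cauchy property and the bound \<open>R\<close>, the second after integration by parts
        because \<open>w n\<close> tends to 0 while \<open>G\<close> does not depend on
        \<open>n\<close>.\<close>
      have "(?N (?g n))\<^sup>2 = Re (l2_inner lebesgue (?g n) (\<lambda>x. (?g n x - ?g m x) + ?g m x))"
        by (simp add: l2_inner_self g)
      also have "\<dots> = Re (l2_inner lebesgue (?g n) (\<lambda>x. ?g n x - ?g m x)) + Re (l2_inner lebesgue (?g n) (?g m))"
        by (subst l2.form_add_right) (auto intro: l2.diff_mem g)
      also have "Re (l2_inner lebesgue (?g n) (\<lambda>x. ?g n x - ?g m x)) \<le> ?N (?g n) * ?N (\<lambda>x. ?g n x - ?g m x)"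
        by (rule order_trans[OF complex_Re_le_cmod]) (intro l2_cauchy_schwarz l2.diff_mem g)
      also have "?N (?g n) * ?N (\<lambda>x. ?g n x - ?g m x) \<le> R * (e / (2 * R))"
        using n R[of n] K1[of n m] R0 by (intro mult_mono) (auto simp: m_def less_imp_le)
      also have "R * (e / (2 * R)) = e / 2" using R0 by simp
      also have "Re (l2_inner lebesgue (?g n) (?g m)) \<le> ?N (w n) * G"
      proof -
        have "l2_inner lebesgue (?g n) (?g m) = - l2_inner lebesgue (w n) (partial_deriv j (?g m))"
          by (rule integration_by_parts[OF w w])
        then have "cmod (l2_inner lebesgue (?g n) (?g m)) \<le> ?N (w n) * G"
          unfolding G_def by (simp add: l2_cauchy_schwarz test_L2 test_partial w)
        then show ?thesis using complex_Re_le_cmod order_trans by blast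
      qed
      finally show ?thesis using K2[of n] n by simp
    qed
    then show "\<exists>no. \<forall>n\<ge>no. norm ((?N (?g n))\<^sup>2 - 0) < e" by blast
  qed
  then have "(\<lambda>n. sqrt ((?N (?g n))\<^sup>2)) \<longlonglongrightarrow> sqrt 0" by (rule tendsto_real_sqrt)
  then show ?thesis by simp
qed

lemma mder_norm_sq_le_kin: "(l2_norm lebesgue (mder j u))\<^sup>2 \<le> kin u"
  unfolding kin_def by (rule member_le_sum) auto

text \<open>With relative bound 1/2 the form controls half of the kinetic energy up to an L^2 term.
  A sequence that is Cauchy for the form and null in L^2 is therefore Cauchy for the kinetic energy;
  its gradients tend to 0, then the kinetic energy, and by the form bound also the potential
  energy.\<close>

lemma form_closable: "form_closable lebesgue test_functions (magnetic_form B V)"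
proof -
  let ?N = "l2_norm lebesgue"
  obtain k where k: "0 \<le> k" "\<And>u. u \<in> test_functions \<Longrightarrow> (?N (pot V u))\<^sup>2 \<le> kin u / 2 + k * (?N u)\<^sup>2"
    using form_bound by blast
  have lower: "kin u / 2 - k * (?N u)\<^sup>2 \<le> magnetic_form B V u" if "u \<in> test_functions" for u
    using k(2)[OF that] by (simp add: magnetic_form_eq that)
  have "form_bounded_below lebesgue test_functions (magnetic_form B V)"
    unfolding form_bounded_below_def
  proof (intro exI[of _ "- k"] ballI)
    fix u :: "real^2 \<Rightarrow> complex" assume u: "u \<in> test_functions"
    show "- k * (?N u)\<^sup>2 \<le> magnetic_form B V u" using lower[OF u] kin_nonneg[of u] by linarith
  qed
  moreover have "(\<lambda>n. magnetic_form B V (w n)) \<longlonglongrightarrow> 0"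
    if conv: "form_converges lebesgue test_functions (magnetic_form B V) w (\<lambda>_. 0)" for w
  proof -
    let ?F = "sequentially \<times>\<^sub>F sequentially :: (nat \<times> nat) filter"
    have w: "w n \<in> test_functions" for n using conv by (simp add: form_converges_def)
    have l2: "(\<lambda>n. ?N (w n)) \<longlonglongrightarrow> 0" using conv by (simp add: form_converges_def)
    let ?d = "\<lambda>p x. w (fst p) x - w (snd p) x"
    have d: "?d p \<in> test_functions" for p by (intro test_diff w)
    have q: "((\<lambda>p. magnetic_form B V (?d p)) \<longlongrightarrow> 0) ?F"
      using conv double_limit_iff[of "\<lambda>m n. magnetic_form B V (\<lambda>x. w m x - w n x)"] by (simp add: form_converges_def)
    have n: "((\<lambda>p. ?N (?d p)) \<longlongrightarrow> 0) ?F"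
    proof (rule squeeze_0)
      have "((\<lambda>p. ?N (w (fst p)) + ?N (w (snd p))) \<longlongrightarrow> 0 + 0) ?F"
        by (intro tendsto_add filterlim_compose[OF l2] filterlim_fst filterlim_snd)
      then show "((\<lambda>p. ?N (w (fst p)) + ?N (w (snd p))) \<longlongrightarrow> 0) ?F" by simp
      fix p
      show "?N (?d p) \<le> ?N (w (fst p)) + ?N (w (snd p))"
        using l2_norm_add_le[OF test_L2[OF w] L2_scale[OF test_L2[OF w]], of "fst p" "-1" "snd p"]
        by (simp add: l2_norm_cmult[of _ _ "-1", simplified] test_L2 w)
    qed simp
    have kin: "((\<lambda>p. kin (?d p)) \<longlongrightarrow> 0) ?F"
    proof (rule squeeze_0)
      have "((\<lambda>p. 2 * magnetic_form B V (?d p) + 2 * k * (?N (?d p))\<^sup>2) \<longlongrightarrow> 2 * 0 + 2 * k * 0\<^sup>2) ?F"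
        by (intro tendsto_intros q n)
      then show "((\<lambda>p. 2 * magnetic_form B V (?d p) + 2 * k * (?N (?d p))\<^sup>2) \<longlongrightarrow> 0) ?F" by simp
      show "kin (?d p) \<le> 2 * magnetic_form B V (?d p) + 2 * k * (?N (?d p))\<^sup>2" for p
        using lower[OF d[of p]] by simp
    qed simp
    have grad: "(\<lambda>n. ?N (partial_deriv j (w n))) \<longlonglongrightarrow> 0" for j
    proof (rule gradient_tendsto_0[OF w l2], rule squeeze_0)
      have "((\<lambda>p. sqrt (kin (?d p)) + M * ?N (?d p)) \<longlongrightarrow> sqrt 0 + M * 0) ?F"
        by (intro tendsto_intros kin n)
      then show "((\<lambda>p. sqrt (kin (?d p)) + M * ?N (?d p)) \<longlongrightarrow> 0) ?F" by simp
      fix p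
      have "?N (mder j (?d p)) \<le> sqrt (kin (?d p))"
        by (rule real_le_rsqrt[OF mder_norm_sq_le_kin])
      then show "?N (partial_deriv j (?d p)) \<le> sqrt (kin (?d p)) + M * ?N (?d p)"
        using partial_norm_le[OF d, of j p] by linarith
    qed simp
    have mder0: "(\<lambda>n. ?N (mder j (w n))) \<longlonglongrightarrow> 0" for j
    proof (rule squeeze_0)
      have "(\<lambda>n. ?N (partial_deriv j (w n)) + M * ?N (w n)) \<longlonglongrightarrow> 0 + M * 0"
        by (intro tendsto_intros grad l2)
      then show "(\<lambda>n. ?N (partial_deriv j (w n)) + M * ?N (w n)) \<longlonglongrightarrow> 0" by simp
    qed (use mder_norm_le[OF w] in simp_all)
    have "(\<lambda>n. kin (w n)) \<longlonglongrightarrow> (\<Sum>j\<in>(UNIV :: 2 set). 0\<^sup>2)"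
      unfolding kin_def by (intro tendsto_intros mder0)
    then have kin0: "(\<lambda>n. kin (w n)) \<longlonglongrightarrow> 0" by simp
    have "(\<lambda>n. (?N (pot V (w n)))\<^sup>2) \<longlonglongrightarrow> 0"
    proof (rule squeeze_0)
      have "(\<lambda>n. kin (w n) / 2 + k * (?N (w n))\<^sup>2) \<longlonglongrightarrow> 0 / 2 + k * 0\<^sup>2"
        by (intro tendsto_intros kin0 l2) simp
      then show "(\<lambda>n. kin (w n) / 2 + k * (?N (w n))\<^sup>2) \<longlonglongrightarrow> 0" by simp
    qed (use k(2)[OF w] in simp_all)
    then have "(\<lambda>n. kin (w n) - (?N (pot V (w n)))\<^sup>2) \<longlonglongrightarrow> 0 - 0"
      by (intro tendsto_diff kin0)
    then show ?thesis by (simp add: magnetic_form_eq w)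
  qed
  ultimately show ?thesis unfolding form_closable_def by blast
qed

sublocale cf: closable_form test_functions "sform V" lebesgue "magnetic_form B V"
  by unfold_locales (auto simp: test_L2 magnetic_form_sform form_closable)

text \<open>With coupling \<open>mc.C\<^sub>4\<close> this constant cancels on the common kernel,
  where potential energy is then at most kinetic energy; it survives only in the number of
  functionals.\<close>

theorem eigenvalue_count_bound:
  "eigenvalue_count lebesgue (magnetic_schroedinger B V) 0
    \<le> ennreal (C\<^sub>5 * mc.C\<^sub>4) * (log_norm_unit_disc V + mixed_norm V)"
proof -
  have C4: "0 \<le> mc.C\<^sub>4" using mc.C\<^sub>4_pos by simp
  have fin: "mixed_norm V' < \<infinity>" "log_norm_unit_disc V' < \<infinity>"
    using mixed_finite log_finite by (simp_all add: V_norms)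
  obtain L :: "((real^2 \<Rightarrow> complex) \<Rightarrow> complex) set" where L: "finite L"
    "real (card L) \<le> C\<^sub>5 * mc.C\<^sub>4 * form_norm V'"
    "\<forall>\<Lambda>\<in>L. (\<forall>u\<in>test_functions. \<forall>v\<in>test_functions. \<Lambda> (\<lambda>x. u x + v x) = \<Lambda> u + \<Lambda> v) \<and> (\<forall>c u. \<Lambda> (\<lambda>x. c * u x) = c * \<Lambda> u)"
    "\<forall>u\<in>test_functions. (\<forall>\<Lambda>\<in>L. \<Lambda> u = 0) \<longrightarrow>
      ennreal mc.C\<^sub>4 * (\<integral>\<^sup>+x. ennreal (V' x * (cmod (u x))\<^sup>2) \<partial>lborel) \<le> ennreal (mc.C\<^sub>4 * kin u)"
    using finite_codimension[OF V'_meas V'_nonneg fin C4, folded form_norm_def]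
    by (elim exE conjE) (rule that; assumption)
  \<comment> \<open>The variational bound takes a family indexed by natural numbers, so the set of
    functionals is enumerated.\<close>
  obtain h where h: "bij_betw h {..<card L} L"
    using ex_bij_betw_nat_finite[OF L(1)] by (auto simp: atLeast0LessThan)
  have hL: "h j \<in> L" if "j < card L" for j using h that by (auto simp: bij_betw_def)
  have "eigenvalue_count lebesgue (friedrichs_operator lebesgue test_functions (magnetic_form B V)) 0 \<le> of_nat (card L)"
  proof (rule cf.eigenvalue_count_le[where \<Lambda>=h])
    fix f :: "real^2 \<Rightarrow> complex"
    assume f: "f \<in> test_functions" and zero: "\<And>j. j < card L \<Longrightarrow> h j f = 0"
    have "\<forall>\<Lambda>\<in>L. \<Lambda> f = 0"
    proof
      fix \<Lambda> assume "\<Lambda> \<in> L"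
      then have "\<Lambda> \<in> h ` {..<card L}" using h by (simp add: bij_betw_def)
      then show "\<Lambda> f = 0" using zero by auto
    qed
    then have "ennreal mc.C\<^sub>4 * (\<integral>\<^sup>+x. ennreal (V' x * (cmod (f x))\<^sup>2) \<partial>lborel) \<le> ennreal (mc.C\<^sub>4 * kin f)"
      using L(4) f by simp
    then have "ennreal mc.C\<^sub>4 * ennreal ((l2_norm lebesgue (pot V f))\<^sup>2) \<le> ennreal (mc.C\<^sub>4 * kin f)"
      by (simp only: pot_nn_integral[OF f])
    then have "(l2_norm lebesgue (pot V f))\<^sup>2 \<le> kin f"
      using mc.C\<^sub>4_pos C4 by (simp flip: ennreal_mult)
    then show "0 \<le> magnetic_form B V f" by (simp add: magnetic_form_eq f)
  qed (use L(3) hL in auto)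
  also have "of_nat (card L) = ennreal (real (card L))" by (simp add: ennreal_of_nat_eq_real_of_nat)
  also have "\<dots> \<le> ennreal (C\<^sub>5 * mc.C\<^sub>4 * form_norm V')" by (intro ennreal_leI L(2))
  also have "\<dots> = ennreal (C\<^sub>5 * mc.C\<^sub>4) * (log_norm_unit_disc V + mixed_norm V)"
  proof -
    have "ennreal (form_norm V') = log_norm_unit_disc V + mixed_norm V"
      using mixed_finite log_finite by (simp add: form_norm_def V_norms ennreal_plus add.commute less_top)
    then show ?thesis using C\<^sub>5_pos mc.C\<^sub>4_pos by (simp add: ennreal_mult form_norm_def)
  qed
  finally show ?thesis by (simp add: magnetic_schroedinger_def)
qed

end

text \<open>Local integrability is applied to the compact closed unit disc, which contains the open
  one.\<close>

lemma log_norm_finite: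
  assumes "L1_loc_log V"
  shows "log_norm_unit_disc V < \<infinity>"
proof -
  have "set_integrable lebesgue (cball 0 1) (\<lambda>x. V x * \<bar>ln (norm x)\<bar>)"
    using assms compact_cball unfolding L1_loc_log_def by (elim allE impE)
  then have "integrable lebesgue (\<lambda>x. indicator (cball 0 1) x *\<^sub>R (V x * \<bar>ln (norm x)\<bar>))"
    by (simp only: set_integrable_def)
  then have "(\<integral>\<^sup>+x. ennreal (norm (indicator (cball 0 1) x *\<^sub>R (V x * \<bar>ln (norm x)\<bar>))) \<partial>lebesgue) < \<infinity>"
    by (simp add: integrable_iff_bounded)
  moreover have "log_norm_unit_disc V \<le> (\<integral>\<^sup>+x. ennreal (norm (indicator (cball 0 1) x *\<^sub>R (V x * \<bar>ln (norm x)\<bar>))) \<partial>lebesgue)"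
    unfolding log_norm_unit_disc_def
    by (intro nn_integral_mono) (auto simp: indicator_def abs_mult)
  ultimately show ?thesis by (rule le_less_trans[rotated])
qed

theorem theorem3p8:
  fixes B :: "real^2 \<Rightarrow> real" and b :: "real \<Rightarrow> real"
  assumes radial: "\<And>x. B x = b (norm x)"
    and integrable_profile: "set_integrable lebesgue {0<..} (\<lambda>r. b r * (1 + r))"
    and flux_not_integer: "total_flux B \<notin> \<int>"
  shows "\<exists>C\<^sub>1::real. C\<^sub>1 > 0 \<and>
    (\<forall>V :: real^2 \<Rightarrow> real.
       V \<in> borel_measurable lebesgue \<longrightarrow> (\<forall>x. 0 \<le> V x) \<longrightarrow> L1_loc_log V \<longrightarrow> mixed_norm V < \<infinity> \<longrightarrow>
         form_closable lebesgue test_functions (magnetic_form B V) \<and>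
         eigenvalue_count lebesgue (magnetic_schroedinger B V) 0
           \<le> ennreal C\<^sub>1 * (log_norm_unit_disc V + mixed_norm V) \<and>
         ((\<exists>v. \<forall>x. V x = v (norm x)) \<longrightarrow>
            eigenvalue_count lebesgue (magnetic_schroedinger B V) 0
              \<le> ennreal C\<^sub>1 * (log_norm_unit_disc V + L1_norm V)))"
proof -
  interpret radial_field B b by unfold_locales fact+
  obtain M T\<^sub>0 \<kappa> where mc: "magnetic_cylinder (\<lambda>t. flux B (exp t)) M T\<^sub>0 \<kappa>" and M: "0 \<le> M"
    and lin: "\<And>r. 0 < r \<Longrightarrow> \<bar>flux B r\<bar> \<le> M * r"
    using ex_magnetic_cylinder by blast
  interpret mc: magnetic_cylinder "\<lambda>t. flux B (exp t)" M T\<^sub>0 \<kappa> by (rule mc)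
  interpret mf: magnetic_field B b M T\<^sub>0 \<kappa> by unfold_locales (use M lin in auto)
  show ?thesis
  \<comment> \<open>The constant is built from \<open>M\<close>, \<open>T\<^sub>0\<close> and
    \<kappa>, hence from \<open>B\<close> alone, and is fixed before the potential is
    introduced.\<close>
  proof (intro exI[of _ "mf.C\<^sub>5 * mc.C\<^sub>4"] conjI allI impI)
    show "0 < mf.C\<^sub>5 * mc.C\<^sub>4" using mf.C\<^sub>5_pos mc.C\<^sub>4_pos by simp
    fix V :: "real^2 \<Rightarrow> real"
    assume V: "V \<in> borel_measurable lebesgue" "\<forall>x. 0 \<le> V x" and log: "L1_loc_log V" and mixed: "mixed_norm V < \<infinity>"
    obtain V' where V': "V' \<in> borel_measurable borel" "\<And>x. 0 \<le> V' x" "AE x in lebesgue. V x = V' x"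
      using ex_borel_version[OF V(1)] V(2) by blast
    interpret mp: magnetic_potential B b M T\<^sub>0 \<kappa> V V'
      by unfold_locales (rule V(1), use V(2) in blast, rule V'(1), rule V'(2), rule V'(3), rule mixed, rule log_norm_finite[OF log])
    show "form_closable lebesgue test_functions (magnetic_form B V)" by (rule mp.form_closable)
    show bound: "eigenvalue_count lebesgue (magnetic_schroedinger B V) 0 \<le> ennreal (mf.C\<^sub>5 * mc.C\<^sub>4) * (log_norm_unit_disc V + mixed_norm V)"
      by (rule mp.eigenvalue_count_bound)
    assume "\<exists>v. \<forall>x. V x = v (norm x)"
    then obtain v where "\<And>x. V x = v (norm x)" by blast
    then have "mixed_norm V \<le> L1_norm V" using V by (intro mixed_norm_radial_le) auto
    then have "ennreal (mf.C\<^sub>5 * mc.C\<^sub>4) * (log_norm_unit_disc V + mixed_norm V) \<le> ennreal (mf.C\<^sub>5 * mc.C\<^sub>4) * (log_norm_unit_disc V + L1_norm V)"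
      by (intro mult_left_mono add_left_mono) auto
    with bound show "eigenvalue_count lebesgue (magnetic_schroedinger B V) 0 \<le> ennreal (mf.C\<^sub>5 * mc.C\<^sub>4) * (log_norm_unit_disc V + L1_norm V)"
      by (rule order_trans)
  qed
qed

end
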